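(* Let $Y$ be a second-order stationary MUCOGARCH$(1,1)$ volatility process with parameters $A,B\in M_d(\mathbb{R})$, $C\in\mathbb{S}_d^{++}$ driven by a $d$-dimensional Lévy process $L$ with Lévy measure $\nu_L$, and let $V_t=C+Y_t$. Assume that there is $\sigma_L\in\mathbb{R}^+$ with $\int_{\mathbb{R}^d}xx^*\nu_L(dx)=\sigma_LI_d$, that $\int_{\mathbb{R}^d}\|x\|^4\nu_L(dx)<\infty$, and that there is a real constant $\rho_L$ with $\int_{\mathbb{R}^d}\operatorname{vec}(xx^* )\operatorname{vec}(xx^* )^*\nu_L(dx)=\rho_L(I_{d^2}+K_d+\operatorname{vec}(I_d)\operatorname{vec}(I_d)^* )$. Put $$\mathscr{B}:=B\otimes I_d+I_d\otimes B+\sigma_LA\otimes A,\qquad \mathscr{A}:=(A\otimes A)\otimes(A\otimes A),\qquad \mathcal{R}:=\rho_L(\mathcal{Q}+\mathcal{K}_d\mathcal{Q}+I_{d^4}),$$ $$\mathscr{C}:=(B\otimes I_d+I_d\otimes B)\otimes I_{d^2}+I_{d^2}\otimes(B\otimes I_d+I_d\otimes B)+\sigma_L\bigl((A\otimes A)\otimes I_{d^2}+I_{d^2}\otimes(A\otimes A)\bigr)+\mathscr{A}\mathcal{R},$$ and assume that $\mathscr{C}$ is invertible. Then the stationary variance $\operatorname{var}(\operatorname{vec}(Y_0))=\operatorname{var}(\operatorname{vec}(V_0))$ is given by $$\operatorname{vec}(\operatorname{var}(\operatorname{vec}(Y_0)))=-\mathscr{C}^{-1}\Bigl[\bigl(\sigma_L^2\mathscr{C}(\mathscr{B}^{-1}\otimes\mathscr{B}^{-1})\mathscr{A}+\mathscr{A}\mathcal{R}\bigr)\bigl(\operatorname{vec}(C)\otimes\operatorname{vec}(C)\bigr)$$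 $$\quad+\bigl(\sigma_L(A\otimes A)\otimes I_{d^2}+\mathscr{A}\mathcal{R}\bigr)\bigl(\operatorname{vec}(C)\otimes E(\operatorname{vec}(Y_0))\bigr)+\bigl(\sigma_LI_{d^2}\otimes(A\otimes A)+\mathscr{A}\mathcal{R}\bigr)\bigl(E(\operatorname{vec}(Y_0))\otimes\operatorname{vec}(C)\bigr)\Bigr].$$
   Context: $M_n(\mathbb{R})$: real $n\times n$ matrices; $I_n$ the identity; $\mathbb{S}_d^+$ (resp. $\mathbb{S}_d^{++}$): positive semidefinite (resp. positive definite) symmetric $d\times d$ matrices; $X^*$ is the transpose; $X^{1/2}$ the positive semidefinite square root; $\otimes$ the Kronecker product; $\operatorname{vec}$ stacks the columns of a matrix; $\mathbb{R}^+=[0,\infty)$. $K_d\in M_{d^2}(\mathbb{R})$ is the commutation matrix: $K_d\operatorname{vec}(X)=\operatorname{vec}(X^* )$ for all $X\in M_d(\mathbb{R})$. $\mathbf{Q}:M_{d^2}(\mathbb{R})\to M_{d^2}(\mathbb{R})$ is the linear map $(\mathbf{Q}X)_{(k-1)d+l,(p-1)d+q}=X_{(k-1)d+p,(l-1)d+q}$ for $k,l,p,q\in\{1,\dots,d\}$; $\mathcal{Q}\in M_{d^4}(\mathbb{R})$ is the matrix of $\operatorname{vec}\circ\mathbf{Q}\circ\operatorname{vec}^{-1}$ on $\mathbb{R}^{d^4}$ and $\mathcal{K}_d\in M_{d^4}(\mathbb{R})$ the matrix of $x\mapsto\operatorname{vec}(K_d\operatorname{vec}^{-1}(x))$, with $\operatorname{vec}:M_{d^2}(\mathbb{R})\to\mathbb{R}^{d^4}$.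 For a random vector $X$, $\operatorname{var}(X)=E(XX^* )-E(X)E(X)^*$. All processes live on a filtered probability space satisfying the usual conditions; $L$ is a càdlàg $\mathbb{R}^d$-valued Lévy process with respect to this filtration, $L_0=0$; $Y_0$ is $\mathcal{F}_0$-measurable. $[L,L]^{\mathfrak{d}}_t=\sum_{0\le s\le t}(\Delta L_s)(\Delta L_s)^*$. The MUCOGARCH$(1,1)$ volatility process with parameters $A,B,C$ driven by $L$ is the (unique) $\mathbb{S}_d^+$-valued càdlàg adapted solution of $$dY_t=(BY_{t-}+Y_{t-}B^* )\,dt+A(C+Y_{t-})^{1/2}\,d[L,L]_t^{\mathfrak{d}}\,(C+Y_{t-})^{1/2}A^*$$ with initial value $Y_0$ in $\mathbb{S}_d^+$. Second-order stationary means finite second moments, mean constant in time, and $\operatorname{cov}(\operatorname{vec}(Y_{t+h}),\operatorname{vec}(Y_t))$ depending only on $h\ge0$. *)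

theory Defs
  imports "HOL-Probability.Probability"
begin

section \<open>Matrices\<close>

text \<open>
  Index sets of size $d^2$ and $d^4$ are the product types \<open>'d \<times> 'd\<close> and
  \<open>('d \<times> 'd) \<times> ('d \<times> 'd)\<close>: the pair \<open>(k, l)\<close> plays the role of the position
  $(k-1)d+l$, i.e. positions are read lexicographically.  With this reading the functions below are
  the usual Kronecker product and column stacking: entry $(k-1)d+p$ of the stacked vector is
  the entry in column $k$ and row $p$.
\<close>

definition kron :: "real^'n^'m \<Rightarrow> real^'q^'p \<Rightarrow> real^('n \<times> 'q)^('m \<times> 'p)" (infixl "\<otimes>\<^sub>m" 71)
  where "A \<otimes>\<^sub>m B = (\<chi> i j. A $ fst i $ fst j * B $ snd i $ snd j)"

definition kron_vec :: "real^'m \<Rightarrow> real^'p \<Rightarrow> real^('m \<times> 'p)" (infixl "\<otimes>\<^sub>v" 71)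
  where "x \<otimes>\<^sub>v y = (\<chi> i. x $ fst i * y $ snd i)"

definition stack :: "real^'n^'m \<Rightarrow> real^('n \<times> 'm)"
  where "stack X = (\<chi> i. X $ snd i $ fst i)"

definition unstack :: "real^('n \<times> 'm) \<Rightarrow> real^'n^'m"
  where "unstack x = (\<chi> i j. x $ (j, i))"

definition outer :: "real^'m \<Rightarrow> real^'n \<Rightarrow> real^'n^'m"
  where "outer x y = (\<chi> i j. x $ i * y $ j)"

definition psd :: "real^'n^'n \<Rightarrow> bool"
  where "psd X \<longleftrightarrow> transpose X = X \<and> (\<forall>x. 0 \<le> x \<bullet> (X *v x))"

definition pos_def :: "real^'n^'n \<Rightarrow> bool"
  where "pos_def X \<longleftrightarrow> transpose X = X \<and> (\<forall>x. x \<noteq> 0 \<longrightarrow> 0 < x \<bullet> (X *v x))"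

definition psd_sqrt :: "real^'n^'n \<Rightarrow> real^'n^'n"
  where "psd_sqrt X = (THE S. psd S \<and> S ** S = X)"

definition commutation_matrix :: "real^('d::finite \<times> 'd)^('d \<times> 'd)"
  where "commutation_matrix = matrix (\<lambda>x. stack (transpose (unstack x)))"

definition Q_map :: "real^('d::finite \<times> 'd)^('d \<times> 'd) \<Rightarrow> real^('d \<times> 'd)^('d \<times> 'd)"
  where "Q_map X = (\<chi> i j. X $ (fst i, fst j) $ (snd i, snd j))"

definition Q_matrix ::
    "real^(('d::finite \<times> 'd) \<times> ('d \<times> 'd))^(('d \<times> 'd) \<times> ('d \<times> 'd))"
  where "Q_matrix = matrix (stack \<circ> Q_map \<circ> unstack)"

definition K_matrix ::
    "real^(('d::finite \<times> 'd) \<times> ('d \<times> 'd))^(('d \<times> 'd) \<times> ('d \<times> 'd))"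
  where "K_matrix = matrix (\<lambda>x. stack (commutation_matrix ** unstack x))"

lemma unstack_stack [simp]: "unstack (stack X) = X"
  by (simp add: unstack_def stack_def vec_eq_iff)

lemma stack_unstack [simp]: "stack (unstack x) = x"
  by (simp add: unstack_def stack_def vec_eq_iff)

lemma commutation_matrix_stack: "commutation_matrix *v stack X = stack (transpose X)"
proof -
  have "linear (\<lambda>x :: real^('a \<times> 'a). stack (transpose (unstack x)))"
    by (rule linearI) (simp_all add: stack_def unstack_def transpose_def vec_eq_iff)
  from fun_cong[OF matrix_vector_mul(2)[OF this]] show ?thesis
    by (simp add: commutation_matrix_def)
qed

lemma Q_map_nth: "Q_map X $ (k, l) $ (p, q) = X $ (k, p) $ (l, q)"
  by (simp add: Q_map_def)

lemma Q_matrix_stack: "Q_matrix *v stack X = stack (Q_map X)"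
proof -
  have "linear (stack \<circ> Q_map \<circ> (unstack :: real^(('a \<times> 'a) \<times> ('a \<times> 'a)) \<Rightarrow> _))"
    by (rule linearI) (simp_all add: stack_def unstack_def Q_map_def vec_eq_iff)
  from fun_cong[OF matrix_vector_mul(2)[OF this]] show ?thesis
    by (simp add: Q_matrix_def)
qed

lemma K_matrix_stack: "K_matrix *v stack X = stack (commutation_matrix ** X)"
proof -
  have "linear (\<lambda>x :: real^(('a \<times> 'a) \<times> ('a \<times> 'a)). stack (commutation_matrix ** unstack x))"
    by (rule linearI)
       (simp_all add: stack_def unstack_def matrix_matrix_mult_def vec_eq_iff
          distrib_left sum.distrib sum_distrib_left mult.left_commute)
  from fun_cong[OF matrix_vector_mul(2)[OF this]] show ?thesis
    by (simp add: K_matrix_def)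
qed

section \<open>Path properties and pathwise integrals\<close>

definition cadlag :: "(real \<Rightarrow> 'b::topological_space) \<Rightarrow> bool"
  where "cadlag f \<longleftrightarrow>
    (\<forall>t\<ge>0. (f \<longlongrightarrow> f t) (at_right t)) \<and> (\<forall>t>0. \<exists>l. (f \<longlongrightarrow> l) (at_left t))"

text \<open>The time set is $[0,\infty)$; values of paths at negative times are irrelevant.
  By the usual convention there is no jump at time 0.\<close>

definition left_lim :: "(real \<Rightarrow> 'b::t2_space) \<Rightarrow> real \<Rightarrow> 'b"
  where "left_lim f t = (if 0 < t then Lim (at_left t) f else f 0)"

definition jump :: "(real \<Rightarrow> 'b::{t2_space,minus}) \<Rightarrow> real \<Rightarrow> 'b"
  where "jump f t = f t - left_lim f t"

definition disc_quad_var :: "(real \<Rightarrow> real^'d) \<Rightarrow> real \<Rightarrow> real^'d^'d"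
  where "disc_quad_var l t = (\<Sum>\<^sub>\<infinity>s\<in>{0..t}. outer (jump l s) (jump l s))"

text \<open>Lebesgue--Stieltjes integral of \<open>f\<close> over $(0,t]$ against a right-continuous integrator \<open>F\<close>
  of finite variation on $[0,t]$: \<open>F\<close> is split into a difference of two nondecreasing functions.
  The value does not depend on the splitting.\<close>

definition has_LS_integral :: "(real \<Rightarrow> real) \<Rightarrow> (real \<Rightarrow> real) \<Rightarrow> real \<Rightarrow> real \<Rightarrow> bool"
  where "has_LS_integral f F t I \<longleftrightarrow>
    (\<exists>G H. mono G \<and> mono H \<and>
       (\<forall>s. continuous (at_right s) G) \<and> (\<forall>s. continuous (at_right s) H) \<and>
       (\<forall>s\<in>{0..t}. F s = G s - H s) \<and>
       set_integrable (interval_measure G) {0<..t} f \<and>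
       set_integrable (interval_measure H) {0<..t} f \<and>
       I = (LINT s:{0<..t}|interval_measure G. f s) - (LINT s:{0<..t}|interval_measure H. f s))"

text \<open>$\int_{(0,t]} G_s\,dM_s\,H_s$ for matrix-valued functions, whose $(i,j)$ entry is
  $\sum_{k,l}\int_{(0,t]} (G_s)_{ik}(H_s)_{lj}\,d(M_s)_{kl}$.\<close>

definition has_matrix_LS_integral ::
    "(real \<Rightarrow> real^'d^'d) \<Rightarrow> (real \<Rightarrow> real^'d^'d) \<Rightarrow> (real \<Rightarrow> real^'d^'d) \<Rightarrow> real \<Rightarrow> real^'d^'d \<Rightarrow> bool"
  where "has_matrix_LS_integral G M H t J \<longleftrightarrow>
    (\<forall>i j. \<exists>I. (\<forall>k l. has_LS_integral (\<lambda>s. G s $ i $ k * H s $ l $ j) (\<lambda>s. M s $ k $ l) t (I k l))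
       \<and> J $ i $ j = (\<Sum>k\<in>UNIV. \<Sum>l\<in>UNIV. I k l))"

section \<open>Filtered probability spaces and Levy processes\<close>

definition usual_conditions :: "'a measure \<Rightarrow> (real \<Rightarrow> 'a measure) \<Rightarrow> bool"
  where "usual_conditions M F \<longleftrightarrow> prob_space M \<and>
    (\<forall>t\<ge>0. subalgebra M (F t)) \<and>
    (\<forall>s\<ge>0. \<forall>t\<ge>s. sets (F s) \<subseteq> sets (F t)) \<and>
    (\<forall>t\<ge>0. sets (F t) = (\<Inter>u\<in>{t<..}. sets (F u))) \<and>
    (\<forall>N\<in>null_sets M. \<forall>S\<subseteq>N. S \<in> sets (F 0))"

definition adapted :: "(real \<Rightarrow> 'a measure) \<Rightarrow> (real \<Rightarrow> 'a \<Rightarrow> 'b::topological_space) \<Rightarrow> bool"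
  where "adapted F X \<longleftrightarrow> (\<forall>t\<ge>0. X t \<in> borel_measurable (F t))"

text \<open>Stochastic continuity is not listed because it follows from the path property and
  the stationarity of the increments.\<close>

definition levy_process ::
    "'a measure \<Rightarrow> (real \<Rightarrow> 'a measure) \<Rightarrow> (real \<Rightarrow> 'a \<Rightarrow> real^'d) \<Rightarrow> bool"
  where "levy_process M F L \<longleftrightarrow>
    adapted F L \<and>
    (AE \<omega> in M. L 0 \<omega> = 0 \<and> cadlag (\<lambda>t. L t \<omega>)) \<and>
    (\<forall>s\<ge>0. \<forall>t\<ge>s. prob_space.indep_set M (sets (F s))
       {(\<lambda>\<omega>. L t \<omega> - L s \<omega>) -` S \<inter> space M | S. S \<in> sets borel}) \<and>
    (\<forall>s\<ge>0. \<forall>h\<ge>0. distr M borel (\<lambda>\<omega>. L (s + h) \<omega> - L s \<omega>) = distr M borel (L h))"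

text \<open>The Levy measure of a Borel set is the expected number of jumps in that set
  per unit of time.\<close>

definition is_levy_measure ::
    "'a measure \<Rightarrow> (real \<Rightarrow> 'a \<Rightarrow> real^'d) \<Rightarrow> (real^'d) measure \<Rightarrow> bool"
  where "is_levy_measure M L \<nu> \<longleftrightarrow> sets \<nu> = sets borel \<and>
    (\<forall>S\<in>sets borel. emeasure \<nu> S =
       (\<integral>\<^sup>+\<omega>. emeasure (count_space UNIV)
          {s\<in>{0<..1}. jump (\<lambda>t. L t \<omega>) s \<noteq> 0 \<and> jump (\<lambda>t. L t \<omega>) s \<in> S} \<partial>M))"

section \<open>The MUCOGARCH(1,1) volatility process\<close>

definition mucogarch_volatility ::
    "'a measure \<Rightarrow> (real \<Rightarrow> 'a measure) \<Rightarrow> (real \<Rightarrow> 'a \<Rightarrow> real^'d) \<Rightarrow>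
     real^'d^'d \<Rightarrow> real^'d^'d \<Rightarrow> real^'d^'d \<Rightarrow> (real \<Rightarrow> 'a \<Rightarrow> real^'d^'d) \<Rightarrow> bool"
  where "mucogarch_volatility M F L A B C Y \<longleftrightarrow>
    adapted F Y \<and>
    (AE \<omega> in M.
       cadlag (\<lambda>t. Y t \<omega>) \<and> (\<forall>t\<ge>0. psd (Y t \<omega>)) \<and>
       (let Yl = left_lim (\<lambda>t. Y t \<omega>) in
        \<forall>t\<ge>0. \<exists>J.
          has_matrix_LS_integral
            (\<lambda>s. A ** psd_sqrt (C + Yl s))
            (disc_quad_var (\<lambda>t. L t \<omega>))
            (\<lambda>s. psd_sqrt (C + Yl s) ** transpose A) t J \<and>
          Y t \<omega> = Y 0 \<omega> + (LINT s:{0..t}|lborel. B ** Yl s + Yl s ** transpose B) + J))"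

section \<open>Second-order structure\<close>

definition cov_vec :: "'a measure \<Rightarrow> ('a \<Rightarrow> real^'m) \<Rightarrow> ('a \<Rightarrow> real^'n) \<Rightarrow> real^'n^'m"
  where "cov_vec M X Z =
    (LINT \<omega>|M. outer (X \<omega>) (Z \<omega>)) - outer (LINT \<omega>|M. X \<omega>) (LINT \<omega>|M. Z \<omega>)"

definition var_vec :: "'a measure \<Rightarrow> ('a \<Rightarrow> real^'m) \<Rightarrow> real^'m^'m"
  where "var_vec M X = (LINT \<omega>|M. outer (X \<omega>) (X \<omega>)) - outer (LINT \<omega>|M. X \<omega>) (LINT \<omega>|M. X \<omega>)"

definition second_order_stationary :: "'a measure \<Rightarrow> (real \<Rightarrow> 'a \<Rightarrow> real^'d^'d) \<Rightarrow> bool"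
  where "second_order_stationary M Y \<longleftrightarrow>
    (\<forall>t\<ge>0. Y t \<in> borel_measurable M \<and> integrable M (\<lambda>\<omega>. (norm (Y t \<omega>))\<^sup>2)) \<and>
    (\<forall>t\<ge>0. (LINT \<omega>|M. Y t \<omega>) = (LINT \<omega>|M. Y 0 \<omega>)) \<and>
    (\<forall>h\<ge>0. \<forall>t\<ge>0. cov_vec M (\<lambda>\<omega>. stack (Y (t + h) \<omega>)) (\<lambda>\<omega>. stack (Y t \<omega>)) =
                   cov_vec M (\<lambda>\<omega>. stack (Y h \<omega>)) (\<lambda>\<omega>. stack (Y 0 \<omega>)))"

definition scr_B :: "real^'d::finite^'d \<Rightarrow> real^'d^'d \<Rightarrow> real \<Rightarrow> real^('d \<times> 'd)^('d \<times> 'd)"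
  where "scr_B A B \<sigma> = B \<otimes>\<^sub>m mat 1 + mat 1 \<otimes>\<^sub>m B + \<sigma> *\<^sub>R (A \<otimes>\<^sub>m A)"

definition scr_A ::
    "real^'d::finite^'d \<Rightarrow> real^(('d \<times> 'd) \<times> ('d \<times> 'd))^(('d \<times> 'd) \<times> ('d \<times> 'd))"
  where "scr_A A = (A \<otimes>\<^sub>m A) \<otimes>\<^sub>m (A \<otimes>\<^sub>m A)"

definition cal_R ::
    "real \<Rightarrow> real^(('d::finite \<times> 'd) \<times> ('d \<times> 'd))^(('d \<times> 'd) \<times> ('d \<times> 'd))"
  where "cal_R \<rho> = \<rho> *\<^sub>R (Q_matrix + K_matrix ** Q_matrix + mat 1)"

definition scr_C ::
    "real^'d::finite^'d \<Rightarrow> real^'d^'d \<Rightarrow> real \<Rightarrow> real \<Rightarrow>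
     real^(('d \<times> 'd) \<times> ('d \<times> 'd))^(('d \<times> 'd) \<times> ('d \<times> 'd))"
  where "scr_C A B \<sigma> \<rho> =
    (B \<otimes>\<^sub>m mat 1 + mat 1 \<otimes>\<^sub>m B) \<otimes>\<^sub>m mat 1 + mat 1 \<otimes>\<^sub>m (B \<otimes>\<^sub>m mat 1 + mat 1 \<otimes>\<^sub>m B)
    + \<sigma> *\<^sub>R ((A \<otimes>\<^sub>m A) \<otimes>\<^sub>m mat 1 + mat 1 \<otimes>\<^sub>m (A \<otimes>\<^sub>m A))
    + scr_A A ** cal_R \<rho>"

end

theory Submission
  imports Defs
begin

text \<open>
  Paths of \<open>Y\<close> consist of a Lebesgue integral and a summable series of jumps, so integration by parts
  writes the increments of the entries of \<open>Y\<close> and of their products as time integrals plus sums of terms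
  \<open>\<phi> (Y (s-)) g (\<Delta>L s)\<close> over the jumps. The compensation formula
  \<open>E (\<Sum>s. \<phi> (Y (s-)) g (\<Delta>L s)) = (\<integral> g d\<nu>) E (\<integral> \<phi> (Y (s-)) ds)\<close> then turns the constancy of the
  first two moments into linear equations for \<open>E vec Y\<close> and \<open>E (vec Y \<otimes> vec Y)\<close>: the moment
  assumptions on \<open>\<nu>\<close> make all square roots recombine to \<open>V\<close>.

  The compensation formula rests on a Laplace transform argument: for continuous \<open>g \<ge> 0\<close> vanishing
  near 0, sums of \<open>g\<close> over the increments of \<open>L\<close> along finer and finer partitions of \<open>(s, s + u]\<close> converge to the
  sum of \<open>g\<close> over the jumps, and their Laplace transforms conditional on the past factorise and depend only on
  \<open>u\<close>.

  Invertibility of \<open>scr_B\<close> follows from that of \<open>scr_C\<close>: since \<open>E Y\<close> is a positive semidefinite solution of the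
  first moment equation, a left null vector \<open>z\<close> of \<open>scr_B\<close> vanishes on the range of \<open>A \<otimes> A\<close>; hence
  \<open>z \<otimes> z\<close> is a left null vector of \<open>scr_C\<close>, and \<open>z = 0\<close>.
\<close>

section \<open>Square roots of positive semidefinite matrices\<close>

text \<open>\<open>levy_process\<close> and \<open>is_levy_measure\<close> speak only of increments
  and of expected jump counts, so the Poisson structure of the jumps has to be recovered as far as
  it is used; this is why the compensation formula takes up so much of the proof. Two encodings
  shape the pathwise part. \<open>has_LS_integral\<close> asserts that some splitting of the
  integrator exists, so the integral is identified through left Riemann sums, which see only
  increments of the integrator. \<open>disc_quad_var\<close> is an unconditional sum with a default
  value where it diverges; the squared jumps on (0, 1] are almost surely summable by the
  compensation formula for the constant process 1 and the finite second moment of \<nu>. Square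
  roots enter only through products of two entries of the volatility factor. Such products grow
  linearly, because the factor times its transpose is affine in the state; products of four entries
  are therefore quadratic and controlled by the second moments of \<open>Y\<close>. All moment
  balances are taken over the time interval [0, 1].\<close>

lemma selfadjoint_eigenvector:
  fixes f :: "'a::euclidean_space \<Rightarrow> 'a"
  assumes "linear f" and adj: "\<And>x y. x \<bullet> f y = f x \<bullet> y"
    and U: "subspace U" "f ` U \<subseteq> U" "U \<noteq> {0}"
  obtains v l where "v \<in> U" "norm v = 1" "f v = l *\<^sub>R v"
proof -
  interpret linear f by fact
  have bl: "bounded_linear f" using \<open>linear f\<close> by (simp add: linear_conv_bounded_linear)
  let ?K = "U \<inter> sphere 0 1"
  have "compact ?K" using closed_subspace[OF U(1)] by (intro closed_Int_compact) auto
  moreover have "?K \<noteq> {}"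
  proof -
    obtain x where x: "x \<in> U" "x \<noteq> 0" using U(1,3) subspace_0 by blast
    then have "(1 / norm x) *\<^sub>R x \<in> ?K" using U(1) by (auto simp: subspace_scale)
    then show ?thesis by blast
  qed
  moreover have "continuous_on ?K (\<lambda>x. x \<bullet> f x)"
    by (intro continuous_intros linear_continuous_on bl)
  \<comment> \<open>\<open>v\<close> maximises the Rayleigh quotient on the unit sphere of
    \<open>U\<close>. The residual \<open>w\<close> of the eigenvalue equation must vanish, since
    moving from \<open>v\<close> towards \<open>w\<close> would otherwise increase the
    quotient.\<close>
  ultimately obtain v where v: "v \<in> ?K" "\<And>x. x \<in> ?K \<Longrightarrow> x \<bullet> f x \<le> v \<bullet> f v"
    using continuous_attains_sup by metis
  define l where "l = v \<bullet> f v"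
  have vv: "v \<bullet> v = 1" "v \<in> U" using v by (auto simp: norm_eq_1)
  have le: "x \<bullet> f x \<le> l * (x \<bullet> x)" if "x \<in> U" for x
  proof (cases "x = 0")
    case False
    have "(1 / norm x) *\<^sub>R x \<in> ?K" using that False U(1) by (auto simp: subspace_scale)
    from v(2)[OF this] have "(x \<bullet> f x) / (norm x * norm x) \<le> l"
      by (simp add: scale l_def)
    then show ?thesis using False by (simp add: dot_square_norm power2_eq_square divide_simps)
  qed (simp add: zero)
  define w where "w = f v - l *\<^sub>R v"
  have w: "w \<in> U" unfolding w_def using U vv by (intro subspace_diff subspace_scale) auto
  have wv: "w \<bullet> v = 0" by (simp add: w_def inner_diff_left vv) (simp add: l_def inner_commute)
  have wfv: "w \<bullet> f v = w \<bullet> w" "v \<bullet> f w = w \<bullet> w"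
  proof -
    have "f v = w + l *\<^sub>R v" by (simp add: w_def)
    then show "w \<bullet> f v = w \<bullet> w" using wv by (simp add: inner_add_right)
    then show "v \<bullet> f w = w \<bullet> w" using adj[of v w] by (simp add: inner_commute)
  qed
  have "w = 0"
  proof (rule ccontr)
    assume "w \<noteq> 0"
    define a where "a = w \<bullet> w"
    define c where "c = l * a - w \<bullet> f w"
    \<comment> \<open>The first-order gain 2 t a beats the second-order term t^2 c as soon as t
      \<bar>c\<bar> < a.\<close>
    define t where "t = a / (\<bar>c\<bar> + 1)"
    have a: "a > 0" using \<open>w \<noteq> 0\<close> by (simp add: a_def)
    then have t: "t > 0" by (simp add: t_def)
    have "v + t *\<^sub>R w \<in> U" using vv w U by (intro subspace_add subspace_scale) auto
    from le[OF this] have "2 * t * a \<le> t * t * c"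
      using wfv wv vv by (simp add: add scale inner_add_left inner_add_right inner_commute a_def c_def l_def algebra_simps)
    then have "2 * a \<le> t * c" using t by (simp add: mult.assoc)
    also have "t * c \<le> t * \<bar>c\<bar>" using t by simp
    also have "\<dots> < a" using a by (simp add: t_def field_simps)
    finally show False using a by simp
  qed
  then show ?thesis using that[of v l] vv by (simp add: w_def norm_eq_1)
qed

text \<open>Induction on the dimension: after splitting off a unit eigenvector, its orthogonal
  complement inside \<open>U\<close> is again invariant, by self-adjointness.\<close>

lemma selfadjoint_spectral_on:
  fixes f :: "'a::euclidean_space \<Rightarrow> 'a"
  assumes "linear f" and adj: "\<And>x y. x \<bullet> f y = f x \<bullet> y"
    and "subspace U" "f ` U \<subseteq> U"
  shows "\<exists>E. finite E \<and> E \<subseteq> U \<and> pairwise orthogonal E \<and> span E = U \<and>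
    (\<forall>e\<in>E. norm e = 1 \<and> (\<exists>l. f e = l *\<^sub>R e))"
  using assms(3,4)
proof (induction "dim U" arbitrary: U rule: less_induct)
  case less
  show ?case
  proof (cases "U = {0}")
    case True
    then show ?thesis by (intro exI[of _ "{}"]) auto
  next
    case False
    then obtain v l where v: "v \<in> U" "norm v = 1" "f v = l *\<^sub>R v"
      using selfadjoint_eigenvector[OF assms(1) adj less.prems] by blast
    have vv: "v \<bullet> v = 1" using v by (simp add: norm_eq_1)
    let ?W = "{x \<in> U. v \<bullet> x = 0}"
    have W: "subspace ?W" using less.prems(1)
      by (auto simp: subspace_def inner_add_right)
    have fW: "f ` ?W \<subseteq> ?W" using less.prems(2) v by (auto simp: adj)
    have "v \<notin> ?W" using vv by simp
    then have "?W \<noteq> U" using v(1) by blast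
    moreover have "dim ?W \<le> dim U" by (intro dim_subset) auto
    ultimately have "dim ?W < dim U"
      using subspace_dim_equal[OF W less.prems(1)] by force
    from less.hyps[OF this W fW] obtain E where E: "finite E" "E \<subseteq> ?W" "pairwise orthogonal E"
      "span E = ?W" "\<forall>e\<in>E. norm e = 1 \<and> (\<exists>l. f e = l *\<^sub>R e)" by blast
    show ?thesis
    proof (intro exI[of _ "insert v E"] conjI)
      show "pairwise orthogonal (insert v E)"
        using E(2,3) by (auto simp: pairwise_insert orthogonal_def inner_commute)
      show "span (insert v E) = U"
      proof
        show "span (insert v E) \<subseteq> U" using E v less.prems by (intro span_minimal) auto
        show "U \<subseteq> span (insert v E)"
        proof
          fix x assume x: "x \<in> U"
          have "x - (v \<bullet> x) *\<^sub>R v \<in> ?W" using x v vv less.prems(1)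
            by (auto simp: inner_diff_right subspace_diff subspace_scale)
          then show "x \<in> span (insert v E)"
            using E(4) by (metis span_breakdown_eq)
        qed
      qed
    qed (use E v in auto)
  qed
qed

lemma dot_matrix_symmetric:
  fixes V :: "real^'n^'n"
  assumes "transpose V = V"
  shows "x \<bullet> (V *v y) = (V *v x) \<bullet> y"
  by (metis assms dot_lmul_matrix vector_transpose_matrix)

lemma symmetric_spectral:
  fixes V :: "real^'n^'n"
  assumes "transpose V = V"
  obtains E \<mu> where "finite E" "pairwise orthogonal E" "span E = (UNIV :: (real^'n) set)"
    "\<And>e. e \<in> E \<Longrightarrow> norm e = 1" "\<And>e. e \<in> E \<Longrightarrow> V *v e = \<mu> e *\<^sub>R e"
proof -
  have "\<exists>E. finite E \<and> E \<subseteq> UNIV \<and> pairwise orthogonal E \<and> span E = (UNIV :: (real^'n) set) \<and>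
    (\<forall>e\<in>E. norm e = 1 \<and> (\<exists>l. V *v e = l *\<^sub>R e))"
    by (rule selfadjoint_spectral_on) (use dot_matrix_symmetric[OF assms] in auto)
  then show ?thesis using that by metis
qed

lemma orthonormal_inner:
  fixes E :: "'a::real_inner set"
  assumes "pairwise orthogonal E" "\<And>e. e \<in> E \<Longrightarrow> norm e = 1" "a \<in> E" "b \<in> E"
  shows "a \<bullet> b = (if a = b then 1 else 0)"
  using assms by (auto simp: pairwise_def orthogonal_def norm_eq_1)

text \<open>The root scales each vector of an orthonormal eigenbasis by the square root of its
  eigenvalue.\<close>

lemma psd_sqrt_exists:
  fixes V :: "real^'n^'n"
  assumes "psd V"
  shows "\<exists>S. psd S \<and> S ** S = V"
proof -
  obtain E \<mu> where E: "finite E" "pairwise orthogonal E" "span E = (UNIV :: (real^'n) set)"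
    "\<And>e. e \<in> E \<Longrightarrow> norm e = 1" "\<And>e. e \<in> E \<Longrightarrow> V *v e = \<mu> e *\<^sub>R e"
    using symmetric_spectral[of V] assms by (auto simp: psd_def)
  have on: "a \<bullet> b = (if a = b then 1 else 0)" if "a \<in> E" "b \<in> E" for a b
    using orthonormal_inner[of E a b] E(2,4) that by blast
  have pos: "\<mu> e \<ge> 0" if "e \<in> E" for e
  proof -
    have "0 \<le> e \<bullet> (V *v e)" using assms by (simp add: psd_def)
    then show ?thesis using E(5)[OF that] on[OF that that] by simp
  qed
  have ex: "(\<Sum>e\<in>E. (x \<bullet> e) *\<^sub>R e) = x" for x :: "real^'n"
    by (rule orthonormal_basis_expand) (use E in auto)
  define s where "s x = (\<Sum>e\<in>E. (sqrt (\<mu> e) * (x \<bullet> e)) *\<^sub>R e)" for x :: "real^'n"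
  have lin: "linear s"
    by (rule linearI) (auto simp: s_def inner_add_left algebra_simps sum.distrib scaleR_sum_right)
  define S where "S = matrix s"
  have Sv: "S *v x = s x" for x by (simp add: S_def lin)
  have "S *v (S *v x) = V *v x" for x
  proof -
    have "s x \<bullet> e = sqrt (\<mu> e) * (x \<bullet> e)" if "e \<in> E" for e
    proof -
      have "s x \<bullet> e = (\<Sum>a\<in>E. sqrt (\<mu> a) * (x \<bullet> a) * (a \<bullet> e))" by (simp add: s_def inner_sum_left)
      also have "\<dots> = (\<Sum>a\<in>E. if a = e then sqrt (\<mu> a) * (x \<bullet> a) else 0)"
        using that by (intro sum.cong refl) (simp add: on)
      finally show ?thesis using that E(1) by simp
    qed
    then have "s (s x) = (\<Sum>e\<in>E. (\<mu> e * (x \<bullet> e)) *\<^sub>R e)"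
      unfolding s_def[of "s x"] using pos by (intro sum.cong refl) (simp flip: mult.assoc)
    also have "\<dots> = V *v (\<Sum>e\<in>E. (x \<bullet> e) *\<^sub>R e)"
      using E(5) by (simp add: linear_sum[OF matrix_vector_mul_linear] matrix_vector_mult_scaleR o_def mult.commute)
    finally show ?thesis by (simp add: ex Sv)
  qed
  then have "S ** S = V" by (simp add: matrix_eq matrix_vector_mul_assoc)
  moreover have "psd S"
  proof -
    have "x \<bullet> s y = s x \<bullet> y" for x y
      by (simp add: s_def inner_sum_left inner_sum_right algebra_simps inner_commute)
    then have "transpose S = S"
      by (metis Sv adjoint_matrix adjoint_unique matrix_of_matrix_vector_mul)
    moreover have "x \<bullet> s x \<ge> 0" for x
      by (auto simp: s_def inner_sum_right pos mult.assoc intro!: sum_nonneg)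
    ultimately show ?thesis by (simp add: psd_def Sv)
  qed
  ultimately show ?thesis by blast
qed

lemma norm_matrix_vector_mult_le:
  fixes A :: "real^'n^'m"
  shows "norm (A *v x) \<le> norm A * norm x"
proof -
  have "norm (A *v x) = L2_set (\<lambda>i. \<bar>A $ i \<bullet> x\<bar>) UNIV"
    by (simp add: norm_vec_def matrix_vector_mul_component)
  also have "\<dots> \<le> L2_set (\<lambda>i. norm (A $ i) * norm x) UNIV"
    by (intro L2_set_mono) (auto simp: Cauchy_Schwarz_ineq2)
  also have "\<dots> = norm A * norm x"
    by (simp add: norm_vec_def L2_set_left_distrib)
  finally show ?thesis .
qed

text \<open>For a unit eigenvector \<open>v\<close> of \<open>S - T\<close> with eigenvalue \<open>l\<close>,
  \<open>v \<bullet> (S\<^sup>2 - T\<^sup>2) v = l (v \<bullet> S v + v \<bullet> T v)\<close> and \<open>\<bar>l\<bar> \<le> v \<bullet> S v + v \<bullet> T v\<close>.\<close>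

lemma psd_diff_bound:
  fixes S T :: "real^'n^'n"
  assumes "psd S" "psd T"
  shows "norm ((S - T) *v x) \<le> sqrt (norm (S ** S - T ** T)) * norm x"
proof -
  define D where "D = S - T"
  define N where "N = norm (S ** S - T ** T)"
  have symS: "transpose S = S" and symT: "transpose T = T" using assms by (auto simp: psd_def)
  have "transpose D = D" using symS symT by (simp add: D_def transpose_def vec_eq_iff)
  then obtain E \<mu> where E: "finite E" "pairwise orthogonal E" "span E = (UNIV :: (real^'n) set)"
    "\<And>e. e \<in> E \<Longrightarrow> norm e = 1" "\<And>e. e \<in> E \<Longrightarrow> D *v e = \<mu> e *\<^sub>R e"
    using symmetric_spectral by blast
  have on: "a \<bullet> b = (if a = b then 1 else 0)" if "a \<in> E" "b \<in> E" for a b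
    using orthonormal_inner[of E a b] E(2,4) that by blast
  have \<mu>: "(\<mu> e)\<^sup>2 \<le> N" if e: "e \<in> E" for e
  proof -
    let ?p = "e \<bullet> (S *v e)" and ?q = "e \<bullet> (T *v e)"
    have pq: "0 \<le> ?p" "0 \<le> ?q" using assms by (auto simp: psd_def)
    have ee: "e \<bullet> e = 1" using on[OF e e] by simp
    have l: "\<mu> e = ?p - ?q" using E(5)[OF e] ee
      by (metis D_def inner_diff_right inner_scaleR_right matrix_vector_mult_diff_rdistrib mult.right_neutral)
    have "e \<bullet> ((S ** S - T ** T) *v e) = (S *v e) \<bullet> (S *v e) - (T *v e) \<bullet> (T *v e)"
      by (simp add: matrix_vector_mult_diff_rdistrib inner_diff_right dot_matrix_symmetric[OF symS]
          dot_matrix_symmetric[OF symT] flip: matrix_vector_mul_assoc)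
    also have "\<dots> = (D *v e) \<bullet> (S *v e) + (D *v e) \<bullet> (T *v e)"
      by (simp add: D_def matrix_vector_mult_diff_rdistrib inner_diff_left inner_diff_right inner_commute)
    also have "\<dots> = \<mu> e * (?p + ?q)" by (simp add: E(5)[OF e] distrib_left)
    finally have *: "\<mu> e * (?p + ?q) = e \<bullet> ((S ** S - T ** T) *v e)" by simp
    have "(\<mu> e)\<^sup>2 = \<bar>\<mu> e\<bar> * \<bar>\<mu> e\<bar>" by (simp add: power2_eq_square)
    also have "\<dots> \<le> \<bar>\<mu> e\<bar> * (?p + ?q)" using l pq by (intro mult_left_mono) auto
    also have "\<dots> = \<bar>e \<bullet> ((S ** S - T ** T) *v e)\<bar>" using pq * by (metis abs_mult abs_of_nonneg add_nonneg_nonneg)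
    also have "\<dots> \<le> norm e * norm ((S ** S - T ** T) *v e)" by (rule Cauchy_Schwarz_ineq2)
    also have "\<dots> \<le> N" using norm_matrix_vector_mult_le[of "S ** S - T ** T" e] E(4)[OF e] by (simp add: N_def)
    finally show ?thesis .
  qed
  have ex: "(\<Sum>e\<in>E. (x \<bullet> e) *\<^sub>R e) = x"
    by (rule orthonormal_basis_expand) (use E in auto)
  have sq: "(\<Sum>e\<in>E. c e *\<^sub>R e) \<bullet> (\<Sum>e\<in>E. c e *\<^sub>R e) = (\<Sum>e\<in>E. (c e)\<^sup>2)" for c
  proof -
    have "(\<Sum>e\<in>E. c e *\<^sub>R e) \<bullet> (\<Sum>e\<in>E. c e *\<^sub>R e) = (\<Sum>a\<in>E. \<Sum>b\<in>E. c a * c b * (a \<bullet> b))"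
      by (simp add: inner_sum_left inner_sum_right mult.assoc sum_distrib_left inner_commute mult.left_commute)
    also have "\<dots> = (\<Sum>a\<in>E. \<Sum>b\<in>E. if a = b then c a * c b else 0)"
      by (intro sum.cong refl) (simp add: on)
    finally show ?thesis using E(1) by (simp add: power2_eq_square)
  qed
  have "D *v x = D *v (\<Sum>e\<in>E. (x \<bullet> e) *\<^sub>R e)" by (simp add: ex)
  also have "\<dots> = (\<Sum>e\<in>E. (x \<bullet> e * \<mu> e) *\<^sub>R e)"
    using E(5) by (simp add: linear_sum[OF matrix_vector_mul_linear] matrix_vector_mult_scaleR o_def)
  finally have "(norm (D *v x))\<^sup>2 = (\<Sum>e\<in>E. (x \<bullet> e * \<mu> e)\<^sup>2)"
    by (simp add: power2_norm_eq_inner sq)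
  also have "\<dots> \<le> (\<Sum>e\<in>E. N * (x \<bullet> e)\<^sup>2)"
    using \<mu> by (intro sum_mono) (simp add: power_mult_distrib mult.commute mult_right_mono)
  also have "\<dots> = N * (norm x)\<^sup>2"
    using sq[of "\<lambda>e. x \<bullet> e"] ex by (simp add: sum_distrib_left[symmetric] power2_norm_eq_inner)
  finally have "norm (D *v x) \<le> sqrt (N * (norm x)\<^sup>2)" by (rule real_le_rsqrt)
  then show ?thesis by (simp add: D_def N_def real_sqrt_mult)
qed

lemma psd_sqrt_unique:
  assumes "psd S" "psd T" "S ** S = T ** T"
  shows "S = T"
proof -
  have "(S - T) *v x = 0" for x using psd_diff_bound[OF assms(1,2), of x] assms(3) by simp
  then have "S - T = 0" by (simp add: matrix_eq)
  then show ?thesis by simp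
qed

lemma
  assumes "psd V"
  shows psd_psd_sqrt: "psd (psd_sqrt V)" and psd_sqrt_square: "psd_sqrt V ** psd_sqrt V = V"
proof -
  have "\<exists>!S. psd S \<and> S ** S = V" using psd_sqrt_exists[OF assms] psd_sqrt_unique by blast
  from theI'[OF this] show "psd (psd_sqrt V)" "psd_sqrt V ** psd_sqrt V = V"
    by (auto simp: psd_sqrt_def)
qed

lemma norm_matrix_nth_le: "\<bar>(A :: real^'n^'m) $ i $ j\<bar> \<le> norm A"
  using Finite_Cartesian_Product.norm_nth_le[of "A $ i" j] Finite_Cartesian_Product.norm_nth_le[of A i]
  by simp

text \<open>By \<open>psd_diff_bound\<close> the root is Hoelder continuous with exponent 1/2; the
  entries are read off on basis vectors. Continuity is what lets the volatility factor commute with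
  left limits of paths.\<close>

lemma continuous_on_psd_sqrt: "continuous_on {V. psd V} (psd_sqrt :: real^'n^'n \<Rightarrow> _)"
proof -
  have "continuous_on {V. psd V} (\<lambda>V :: real^'n^'n. psd_sqrt V $ i $ j)" for i j
    unfolding continuous_on_def
  proof (intro ballI)
    fix V :: "real^'n^'n" assume V: "V \<in> {V. psd V}"
    have le: "norm (psd_sqrt W $ i $ j - psd_sqrt V $ i $ j) \<le> sqrt (norm (W - V))" if "psd W" for W
    proof -
      have "norm (psd_sqrt W $ i $ j - psd_sqrt V $ i $ j) = norm (((psd_sqrt W - psd_sqrt V) *v axis j 1) $ i)"
        by (simp add: matrix_vector_mult_basis column_def)
      also have "\<dots> \<le> norm ((psd_sqrt W - psd_sqrt V) *v axis j 1)"
        using Finite_Cartesian_Product.norm_nth_le[of "(psd_sqrt W - psd_sqrt V) *v axis j 1" i] by simp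
      also have "\<dots> \<le> sqrt (norm (W - V))"
        using psd_diff_bound[OF psd_psd_sqrt[OF that] psd_psd_sqrt, of V "axis j 1"] V that
        by (simp add: psd_sqrt_square norm_axis_1)
      finally show ?thesis .
    qed
    have ev: "\<forall>\<^sub>F W in at V within {V. psd V}. norm (psd_sqrt W $ i $ j - psd_sqrt V $ i $ j) \<le> sqrt (norm (W - V))"
      using le by (auto simp: eventually_at_filter)
    have "((\<lambda>W. sqrt (norm (W - V))) \<longlongrightarrow> sqrt (norm (V - V))) (at V within {V. psd V})"
      by (intro tendsto_intros)
    then have lim: "((\<lambda>W. sqrt (norm (W - V))) \<longlongrightarrow> 0) (at V within {V. psd V})"
      by simp
    show "((\<lambda>V :: real^'n^'n. psd_sqrt V $ i $ j) \<longlongrightarrow> psd_sqrt V $ i $ j) (at V within {V. psd V})"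
      using Lim_null_comparison[OF ev lim] by (simp add: LIM_zero_iff)
  qed
  then have "continuous_on {V. psd V} (\<lambda>V :: real^'n^'n. \<chi> i j. psd_sqrt V $ i $ j)"
    by (intro continuous_on_vec_lambda)
  then show ?thesis by simp
qed

lemma psd_zero: "psd 0"
  by (simp add: psd_def transpose_def vec_eq_iff)

lemma psd_add: "psd X \<Longrightarrow> psd Z \<Longrightarrow> psd (X + Z)"
  by (auto simp: psd_def matrix_vector_mult_add_rdistrib inner_add_right transpose_def vec_eq_iff)

lemma psd_scaleR: "psd X \<Longrightarrow> 0 \<le> c \<Longrightarrow> psd (c *\<^sub>R X)"
  by (auto simp: psd_def scaleR_matrix_vector_assoc[symmetric] transpose_def vec_eq_iff)

lemma convex_psd: "convex {V :: real^'n^'n. psd V}"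
  unfolding convex_def by (auto intro!: psd_add psd_scaleR)

lemma closed_psd: "closed {V :: real^'n^'n. psd V}"
proof -
  have "{V :: real^'n^'n. psd V} = {V. transpose V = V} \<inter> (\<Inter>x. {V. 0 \<le> x \<bullet> (V *v x)})"
    by (auto simp: psd_def)
  also have "closed \<dots>"
    by (intro closed_Int closed_INT ballI closed_Collect_eq closed_Collect_le continuous_intros
        linear_continuous_on linear_conv_bounded_linear[THEN iffD1])
      (auto intro!: linearI simp: transpose_def vec_eq_iff matrix_vector_mult_add_rdistrib inner_add_right
        scaleR_matrix_vector_assoc[symmetric])
  finally show ?thesis .
qed

lemma pos_def_imp_psd: "pos_def C \<Longrightarrow> psd C"
  unfolding pos_def_def psd_def by (metis inner_zero_left less_eq_real_def)

section \<open>Kronecker products and invertibility of the mean operator\<close>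

lemma sum_UNIV_prod:
  "(\<Sum>i\<in>(UNIV :: ('a::finite \<times> 'b::finite) set). f i) = (\<Sum>a\<in>UNIV. \<Sum>b\<in>UNIV. f (a, b))"
  unfolding UNIV_Times_UNIV[symmetric] by (subst sum.cartesian_product) simp

lemma kron_mult_kron_vec: "(P \<otimes>\<^sub>m Q) *v (x \<otimes>\<^sub>v y) = (P *v x) \<otimes>\<^sub>v (Q *v y)"
  by (simp add: vec_eq_iff kron_def kron_vec_def matrix_vector_mult_def sum_UNIV_prod
      sum_product algebra_simps)

lemma transpose_kron: "transpose (P \<otimes>\<^sub>m Q) = transpose P \<otimes>\<^sub>m transpose Q"
  by (simp add: vec_eq_iff kron_def transpose_def)

lemma inner_kron_vec: "(x \<otimes>\<^sub>v y) \<bullet> (u \<otimes>\<^sub>v w) = (x \<bullet> u) * (y \<bullet> w)"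
  by (simp add: inner_vec_def kron_vec_def sum_UNIV_prod sum_product algebra_simps)

lemma norm_kron_vec: "norm (x \<otimes>\<^sub>v y) = norm x * norm y"
  by (simp add: norm_eq_sqrt_inner inner_kron_vec real_sqrt_mult)

lemma kron_vec_axis: "axis k (1::real) \<otimes>\<^sub>v axis l 1 = axis (k, l) 1"
  by (auto simp: vec_eq_iff kron_vec_def axis_def)

lemma kron_vec_add_left: "(x + y) \<otimes>\<^sub>v z = x \<otimes>\<^sub>v z + y \<otimes>\<^sub>v z"
  and kron_vec_add_right: "z \<otimes>\<^sub>v (x + y) = z \<otimes>\<^sub>v x + z \<otimes>\<^sub>v y"
  and kron_vec_diff_left: "(x - y) \<otimes>\<^sub>v z = x \<otimes>\<^sub>v z - y \<otimes>\<^sub>v z"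
  and kron_vec_diff_right: "z \<otimes>\<^sub>v (x - y) = z \<otimes>\<^sub>v x - z \<otimes>\<^sub>v y"
  and kron_vec_scaleR_left: "(c *\<^sub>R x) \<otimes>\<^sub>v z = c *\<^sub>R (x \<otimes>\<^sub>v z)"
  and kron_vec_scaleR_right: "z \<otimes>\<^sub>v (c *\<^sub>R x) = c *\<^sub>R (z \<otimes>\<^sub>v x)"
  by (simp_all add: vec_eq_iff kron_vec_def algebra_simps)

lemma kron_vec_zero [simp]: "0 \<otimes>\<^sub>v z = 0" "z \<otimes>\<^sub>v 0 = 0"
  by (simp_all add: vec_eq_iff kron_vec_def)

lemma stack_outer: "stack (outer x y) = y \<otimes>\<^sub>v x"
  by (simp add: vec_eq_iff stack_def outer_def kron_vec_def)

lemma kron_mult_stack: "(P \<otimes>\<^sub>m Q) *v stack X = stack (Q ** X ** transpose P)"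
proof -
  have "(\<Sum>a\<in>UNIV. \<Sum>b\<in>UNIV. P $ i $ a * Q $ j $ b * X $ b $ a)
      = (\<Sum>k\<in>UNIV. (\<Sum>b\<in>UNIV. Q $ j $ b * X $ b $ k) * P $ i $ k)" for i j
    by (simp add: sum_distrib_right sum_distrib_left mult_ac)
  then show ?thesis
    by (simp add: vec_eq_iff kron_def stack_def matrix_vector_mult_def matrix_matrix_mult_def
        transpose_def sum_UNIV_prod)
qed

text \<open>This form shows the Leibniz rule for the mean operator \<open>scr_B\<close> on tensors,
  plus the contribution of simultaneous jumps of both factors. It also makes left null vectors of
  \<open>scr_B\<close> testable against \<open>scr_C\<close> by tensoring.\<close>

lemma scr_C_alt: "scr_C A B \<sigma> \<rho> =
    scr_B A B \<sigma> \<otimes>\<^sub>m mat 1 + mat 1 \<otimes>\<^sub>m scr_B A B \<sigma> + scr_A A ** cal_R \<rho>"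
  by (simp add: vec_eq_iff scr_C_def scr_B_def kron_def algebra_simps)

lemma vector_matrix_mult_add_rdistrib: "(x :: real^'m) v* (P + Q) = x v* P + x v* Q"
  and vector_matrix_mult_diff_rdistrib: "(x :: real^'m) v* (P - Q) = x v* P - x v* Q"
  and vector_matrix_mult_scaleR: "(x :: real^'m) v* (c *\<^sub>R P) = c *\<^sub>R (x v* P)"
  by (simp_all add: vec_eq_iff vector_matrix_mult_def algebra_simps sum.distrib sum_subtractf
      sum_distrib_left)

lemma
  assumes "invertible A"
  shows matrix_inv_mult: "A ** matrix_inv A = mat 1" and matrix_inv_mult': "matrix_inv A ** A = mat 1"
proof -
  have "A ** matrix_inv A = mat 1 \<and> matrix_inv A ** A = mat 1"
    unfolding matrix_inv_def using assms unfolding invertible_def by (rule someI_ex)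
  then show "A ** matrix_inv A = mat 1" "matrix_inv A ** A = mat 1" by auto
qed

section \<open>Left null vectors of the mean operator\<close>

lemma pos_def_lower_bound:
  fixes C :: "real^'n^'n"
  assumes "pos_def C"
  obtains c where "c > 0" "\<And>x. c * (norm x)\<^sup>2 \<le> x \<bullet> (C *v x)"
proof -
  have "continuous_on (sphere 0 1) (\<lambda>x :: real^'n. x \<bullet> (C *v x))"
    by (intro continuous_intros linear_continuous_on)
      (simp add: matrix_vector_mul_linear linear_linear)
  moreover have "sphere (0 :: real^'n) 1 \<noteq> {}" by simp
  ultimately obtain v where v: "v \<in> sphere 0 1" "\<And>x :: real^'n. x \<in> sphere 0 1 \<Longrightarrow> v \<bullet> (C *v v) \<le> x \<bullet> (C *v x)"
    using continuous_attains_inf[OF compact_sphere, of "0 :: real^'n" 1 "\<lambda>x. x \<bullet> (C *v x)"] by blast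
  let ?c = "v \<bullet> (C *v v)"
  have "v \<noteq> 0" using v(1) by auto
  then have "?c > 0" using assms by (simp add: pos_def_def)
  moreover have "?c * (norm x)\<^sup>2 \<le> x \<bullet> (C *v x)" for x
  proof (cases "x = 0")
    case False
    have "?c \<le> ((1 / norm x) *\<^sub>R x) \<bullet> (C *v ((1 / norm x) *\<^sub>R x))"
      by (rule v(2)) (use False in auto)
    also have "\<dots> = (x \<bullet> (C *v x)) / (norm x)\<^sup>2"
      by (simp add: matrix_vector_mult_scaleR power2_eq_square)
    finally show ?thesis using False by (simp add: field_simps)
  qed simp
  ultimately show ?thesis using that by blast
qed

text \<open>The step size 1 / (norm B + 1) makes h B a strict contraction, so a nonzero kernel
  vector of 1 - h B would be strictly shorter than itself.\<close>

lemma Cayley_inverse_exists: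
  fixes B :: "real^'n^'n"
  obtains h G where "h > 0" "G ** (mat 1 - h *\<^sub>R B) = mat 1" "(mat 1 - h *\<^sub>R B) ** G = mat 1"
proof -
  define h where "h = 1 / (norm B + 1)"
  have h: "h > 0" by (simp add: h_def add_nonneg_pos)
  have nb: "norm B + 1 > 0" by (simp add: add_nonneg_pos)
  have "x = 0" if "(mat 1 - h *\<^sub>R B) *v x = 0" for x
  proof (rule ccontr)
    assume "x \<noteq> 0"
    have "x = h *\<^sub>R (B *v x)"
      using that by (simp add: matrix_vector_mult_diff_rdistrib scaleR_matrix_vector_assoc)
    then have "norm x = h * norm (B *v x)" using h by (metis abs_of_pos norm_scaleR)
    also have "\<dots> \<le> h * (norm B * norm x)"
      using norm_matrix_vector_mult_le[of B x] h by (intro mult_left_mono) auto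
    also have "\<dots> = (norm B / (norm B + 1)) * norm x" by (simp add: h_def)
    also have "\<dots> < 1 * norm x"
      using \<open>x \<noteq> 0\<close> nb by (intro mult_strict_right_mono) auto
    finally show False by simp
  qed
  then obtain G where "G ** (mat 1 - h *\<^sub>R B) = mat 1"
    using matrix_left_invertible_ker[of "mat 1 - h *\<^sub>R B"] by blast
  then show ?thesis using that h matrix_left_right_inverse by blast
qed

lemma sum_list_concat_pair:
  "sum_list (map f (map g xs @ map h xs)) = (\<Sum>x\<leftarrow>xs. f (g x) + f (h x) :: real)"
  by (induction xs) (auto simp: algebra_simps)

text \<open>All words of length k in \<open>R\<close> and \<open>S\<close>: the Kraus operators of
  the k-th iterate of X -> R X R^T + S X S^T. A list keeps multiplicities, since different words may
  give the same matrix.\<close>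

primrec products :: "real^'n^'n \<Rightarrow> real^'n^'n \<Rightarrow> nat \<Rightarrow> (real^'n^'n) list"
  where "products R S 0 = [mat 1]"
  | "products R S (Suc k) = map (\<lambda>M. M ** R) (products R S k) @ map (\<lambda>M. M ** S) (products R S k)"

text \<open>With \<open>G = (1 - h B)\<^sup>-\<^sup>1\<close>, \<open>R = G (1 + h B)\<close> and \<open>S = sqrt (2 h \<sigma>) G A\<close>, the equation
  \<open>T X = B X + X B\<^sup>T + \<sigma> A X A\<^sup>T = Z\<close> reads \<open>R X R\<^sup>T + S X S\<^sup>T = X + 2 h G Z G\<^sup>T\<close>.
  Iterating this completely positive map at the positive semidefinite \<open>E\<close> shows that the iterates of
  \<open>G A C A\<^sup>T G\<^sup>T\<close> are summable, while a functional annihilating the range of \<open>T\<close> is constant along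
  the iteration; hence it vanishes on all \<open>A X A\<^sup>T\<close>.\<close>

lemma left_kernel_vanishes:
  fixes A B C E :: "real^'d^'d" and z :: "real^('d \<times> 'd)"
  assumes C: "pos_def C" and E: "psd E" and \<sigma>: "\<sigma> > 0"
    and eq: "\<And>p. 2 * ((p v* B) \<bullet> (E *v p)) + \<sigma> * ((p v* A) \<bullet> ((C + E) *v (p v* A))) = 0"
    and z: "z v* scr_B A B \<sigma> = 0"
  shows "z v* (A \<otimes>\<^sub>m A) = 0"
proof -
  obtain c where c: "c > 0" "\<And>x. c * (norm x)\<^sup>2 \<le> x \<bullet> (C *v x)"
    using pos_def_lower_bound[OF C] by blast
  obtain h G where h: "h > 0" and G: "G ** (mat 1 - h *\<^sub>R B) = mat 1" "(mat 1 - h *\<^sub>R B) ** G = mat 1"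
    by (rule Cayley_inverse_exists[of B])
  define P where "P = mat 1 - h *\<^sub>R B"
  define Q where "Q = mat 1 + h *\<^sub>R B"
  define R where "R = G ** Q"
  define s where "s = sqrt (2 * h * \<sigma>)"
  define S where "S = s *\<^sub>R (G ** A)"
  have s2: "s * s = 2 * h * \<sigma>" using h \<sigma> by (simp add: s_def)
  have PG: "P *v (G *v x) = x" for x using G by (simp add: P_def matrix_vector_mul_assoc)
  define b where "b p q = z \<bullet> (p \<otimes>\<^sub>v q)" for p q
  have b0: "b (B *v p) q + b p (B *v q) + \<sigma> * b (A *v p) (A *v q) = 0" for p q
  proof -
    have "0 = (z v* scr_B A B \<sigma>) \<bullet> (p \<otimes>\<^sub>v q)" using z by simp
    also have "\<dots> = z \<bullet> (scr_B A B \<sigma> *v (p \<otimes>\<^sub>v q))" by (rule dot_lmul_matrix)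
    also have "\<dots> = b (B *v p) q + b p (B *v q) + \<sigma> * b (A *v p) (A *v q)"
      by (simp add: scr_B_def matrix_vector_mult_add_rdistrib kron_mult_kron_vec
          scaleR_matrix_vector_assoc[symmetric] inner_add_right b_def)
    finally show ?thesis by simp
  qed
  \<comment> \<open>Precomposing with \<open>P\<close>, the inverse of \<open>G\<close>, cancels the
    factor \<open>G\<close> in \<open>R\<close> and \<open>S\<close>.\<close>
  define b' where "b' p q = b (P *v p) (P *v q)" for p q
  have Pv: "P *v p = p - h *\<^sub>R (B *v p)" and Qv: "Q *v p = p + h *\<^sub>R (B *v p)" for p
    by (simp_all add: P_def Q_def matrix_vector_mult_add_rdistrib matrix_vector_mult_diff_rdistrib
        scaleR_matrix_vector_assoc)
  have Sv: "S *v p = s *\<^sub>R (G *v (A *v p))" for p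
    by (simp add: S_def scaleR_matrix_vector_assoc[symmetric] matrix_vector_mul_assoc)
  have b'_step: "b' (R *v p) (R *v q) + b' (S *v p) (S *v q) = b' p q" for p q
  proof -
    have "b' (R *v p) (R *v q) = b (Q *v p) (Q *v q)"
      by (simp add: b'_def R_def matrix_vector_mul_assoc[symmetric] PG)
    moreover have "b' (S *v p) (S *v q) = 2 * h * \<sigma> * b (A *v p) (A *v q)"
      by (simp add: b'_def Sv matrix_vector_mult_scaleR PG b_def kron_vec_scaleR_left
          kron_vec_scaleR_right s2[symmetric])
    moreover have "b (Q *v p) (Q *v q) - b (P *v p) (P *v q) = 2 * h * (b (B *v p) q + b p (B *v q))"
      by (simp add: Pv Qv b_def kron_vec_add_left kron_vec_add_right kron_vec_diff_left
          kron_vec_diff_right kron_vec_scaleR_left kron_vec_scaleR_right inner_add_right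
          inner_diff_right algebra_simps)
    moreover have "2 * h * (b (B *v p) q + b p (B *v q)) + 2 * h * \<sigma> * b (A *v p) (A *v q) = 0"
      using b0[of p q] by (metis (no_types, opaque_lifting) distrib_left mult.assoc mult_zero_right)
    ultimately show ?thesis by (simp add: b'_def)
  qed
  let ?W = "products R S"
  have b'_iter: "(\<Sum>M\<leftarrow>?W k. b' (M *v p) (M *v q)) = b' p q" for k p q
  proof (induction k arbitrary: p q)
    case (Suc k)
    have "(\<Sum>M\<leftarrow>?W (Suc k). b' (M *v p) (M *v q)) =
        (\<Sum>M\<leftarrow>?W k. b' (M *v (R *v p)) (M *v (R *v q))) + (\<Sum>M\<leftarrow>?W k. b' (M *v (S *v p)) (M *v (S *v q)))"
      by (simp only: products.simps sum_list_concat_pair sum_list_addf matrix_vector_mul_assoc)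
    then show ?case using Suc b'_step by simp
  qed simp
  have b'_le: "\<bar>b' p q\<bar> \<le> norm z * (norm P * norm P) * (norm p * norm q)" for p q
  proof -
    have "\<bar>b' p q\<bar> \<le> norm z * norm ((P *v p) \<otimes>\<^sub>v (P *v q))"
      unfolding b'_def b_def by (rule Cauchy_Schwarz_ineq2)
    also have "\<dots> \<le> norm z * ((norm P * norm p) * (norm P * norm q))"
      unfolding norm_kron_vec by (intro mult_left_mono mult_mono norm_matrix_vector_mult_le) auto
    finally show ?thesis by (simp add: mult_ac)
  qed
  define e where "e p = p \<bullet> (E *v p)" for p
  have symE: "p \<bullet> (E *v q) = (E *v p) \<bullet> q" for p q
    by (rule dot_matrix_symmetric) (use E in \<open>simp add: psd_def\<close>)
  have e_pos: "e p \<ge> 0" for p using E by (simp add: e_def psd_def)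
  define g where "g r = ((r v* G) v* A) \<bullet> (C *v ((r v* G) v* A))" for r
  \<comment> \<open>The equation at X = E, where the right-hand side Z equals - \<sigma> A C A^T. It
    is evaluated as a quadratic form at the row vector \<open>r\<close>, so the transposed factors
    act from the left.\<close>
  have e_step: "e (r v* R) + e (r v* S) = e r - 2 * h * \<sigma> * g r" for r
  proof -
    define p where "p = r v* G"
    have rR: "r v* R = p v* Q" by (simp add: R_def p_def vector_matrix_mul_assoc)
    have rS: "r v* S = s *\<^sub>R (p v* A)"
      by (simp add: S_def p_def vector_matrix_mul_assoc vector_scaleR_matrix_ac scaleR_vector_matrix_assoc)
    have rr: "r = p v* P" using G(1) by (simp add: p_def P_def vector_matrix_mul_assoc)
    have pQ: "p v* Q = p + h *\<^sub>R (p v* B)" and pP: "p v* P = p - h *\<^sub>R (p v* B)"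
      by (simp_all add: Q_def P_def vector_matrix_mult_add_rdistrib vector_matrix_mult_diff_rdistrib
          vector_matrix_mult_scaleR)
    have "e (p v* Q) - e (p v* P) = 2 * h * (2 * ((p v* B) \<bullet> (E *v p)))"
    proof -
      have "p \<bullet> (E *v (p v* B)) = (p v* B) \<bullet> (E *v p)"
        using symE[of p "p v* B"] by (simp add: inner_commute)
      then show ?thesis
        by (simp add: e_def pQ pP matrix_vector_mult_diff_distrib matrix_vector_right_distrib
            matrix_vector_mult_scaleR inner_add_left inner_add_right inner_diff_left inner_diff_right
            distrib_left right_diff_distrib)
    qed
    also have "2 * ((p v* B) \<bullet> (E *v p)) = - (\<sigma> * ((p v* A) \<bullet> ((C + E) *v (p v* A))))"
      using eq[of p] by linarith
    also have "2 * h * - (\<sigma> * ((p v* A) \<bullet> ((C + E) *v (p v* A)))) = - 2 * h * \<sigma> * ((p v* A) \<bullet> ((C + E) *v (p v* A)))"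
      by simp
    also have "\<dots> = - 2 * h * \<sigma> * g r - e (r v* S)"
      by (simp add: g_def p_def[symmetric] rS e_def matrix_vector_mult_scaleR mult.assoc[symmetric] s2
          matrix_vector_mult_add_rdistrib inner_add_right distrib_left)
    finally show ?thesis using rR rr by simp
  qed
  have e_iter: "(\<Sum>M\<leftarrow>?W n. e (r v* M)) = e r - 2 * h * \<sigma> * (\<Sum>k<n. \<Sum>M\<leftarrow>?W k. g (r v* M))" for n r
  proof (induction n)
    case (Suc n)
    have "(\<Sum>M\<leftarrow>?W (Suc n). e (r v* M)) = (\<Sum>M\<leftarrow>?W n. e ((r v* M) v* R) + e ((r v* M) v* S))"
      by (simp only: products.simps sum_list_concat_pair vector_matrix_mul_assoc)
    also have "\<dots> = (\<Sum>M\<leftarrow>?W n. e (r v* M)) - 2 * h * \<sigma> * (\<Sum>M\<leftarrow>?W n. g (r v* M))"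
      by (simp only: e_step sum_list_subtractf sum_list_const_mult)
    finally show ?case using Suc by (simp add: algebra_simps)
  qed simp
  \<comment> \<open>Squared Frobenius norms of \<open>G ** A\<close> under all words of length k.
    Their partial sums stay bounded: \<open>e\<close> remains nonnegative while each step consumes
    \<open>g\<close>, and \<open>g\<close> dominates the squared norms by the lower bound
    \<open>c\<close> of the form \<open>C\<close>.\<close>
  define N where "N k = (\<Sum>M\<leftarrow>?W k. (norm (M ** (G ** A)))\<^sup>2)" for k
  have frob: "(norm M)\<^sup>2 = (\<Sum>i\<in>UNIV. (norm (axis i 1 v* M))\<^sup>2)" for M :: "real^'d^'d"
  proof -
    have "axis i 1 v* M = M $ i" for i
      by (simp add: vec_eq_iff vector_matrix_mult_def axis_def if_distrib[of "\<lambda>c. c * _"] cong: if_cong)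
    then show ?thesis by (simp add: norm_vec_def L2_set_def sum_nonneg real_sqrt_pow2)
  qed
  have N_le: "2 * h * \<sigma> * c * (\<Sum>k<n. N k) \<le> (\<Sum>i\<in>UNIV. e (axis i 1))" for n
  proof -
    have swap: "(\<Sum>M\<leftarrow>xs. \<Sum>i\<in>UNIV. g (axis i 1 v* M)) = (\<Sum>i\<in>UNIV. \<Sum>M\<leftarrow>xs. g (axis i 1 v* M))"
      for xs :: "(real^'d^'d) list"
      by (induction xs) (auto simp: sum.distrib)
    have Nk: "c * N k \<le> (\<Sum>i\<in>UNIV. \<Sum>M\<leftarrow>?W k. g (axis i 1 v* M))" for k
    proof -
      have "c * N k = (\<Sum>M\<leftarrow>?W k. \<Sum>i\<in>UNIV. c * (norm (((axis i 1 v* M) v* G) v* A))\<^sup>2)"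
      proof -
        have "(norm (M ** (G ** A)))\<^sup>2 = (\<Sum>i\<in>UNIV. (norm (((axis i 1 v* M) v* G) v* A))\<^sup>2)" for M :: "real^'d^'d"
          by (subst frob) (simp add: vector_matrix_mul_assoc matrix_mul_assoc)
        then show ?thesis by (simp add: N_def sum_list_const_mult[symmetric] sum_distrib_left)
      qed
      also have "\<dots> \<le> (\<Sum>M\<leftarrow>?W k. \<Sum>i\<in>UNIV. g (axis i 1 v* M))"
        unfolding g_def by (intro sum_list_mono sum_mono c(2))
      also have "\<dots> = (\<Sum>i\<in>UNIV. \<Sum>M\<leftarrow>?W k. g (axis i 1 v* M))"
        by (rule swap)
      finally show ?thesis .
    qed
    have "2 * h * \<sigma> * c * (\<Sum>k<n. N k) = 2 * h * \<sigma> * (\<Sum>k<n. c * N k)"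
      by (simp add: sum_distrib_left mult.assoc)
    also have "\<dots> \<le> 2 * h * \<sigma> * (\<Sum>k<n. \<Sum>i\<in>UNIV. \<Sum>M\<leftarrow>?W k. g (axis i 1 v* M))"
      using h \<sigma> by (intro mult_left_mono sum_mono Nk) auto
    also have "\<dots> = (\<Sum>i\<in>UNIV. 2 * h * \<sigma> * (\<Sum>k<n. \<Sum>M\<leftarrow>?W k. g (axis i 1 v* M)))"
      by (subst sum.swap) (simp add: sum_distrib_left)
    also have "\<dots> = (\<Sum>i\<in>UNIV. e (axis i 1) - (\<Sum>M\<leftarrow>?W n. e (axis i 1 v* M)))"
      by (simp add: e_iter)
    also have "\<dots> \<le> (\<Sum>i\<in>UNIV. e (axis i 1))"
      by (intro sum_mono) (auto intro!: sum_list_nonneg e_pos)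
    finally show ?thesis .
  qed
  \<comment> \<open>For every k, \<open>b'_iter\<close> writes the same number as a sum over words
    of length k, of size at most K N k. If it were nonzero, the partial sums of \<open>N\<close>
    would grow linearly.\<close>
  have b_zero: "b (A *v u) (A *v v) = 0" for u v
  proof (rule ccontr)
    assume nz: "b (A *v u) (A *v v) \<noteq> 0"
    define K where "K = norm z * (norm P * norm P) * (norm u * norm v)"
    have K: "K \<ge> 0" by (simp add: K_def)
    have le: "\<bar>b (A *v u) (A *v v)\<bar> \<le> K * N k" for k
    proof -
      have "b (A *v u) (A *v v) = b' ((G ** A) *v u) ((G ** A) *v v)"
        by (simp add: b'_def PG flip: matrix_vector_mul_assoc)
      also have "\<dots> = (\<Sum>M\<leftarrow>?W k. b' (M *v ((G ** A) *v u)) (M *v ((G ** A) *v v)))"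
        by (simp add: b'_iter)
      finally have "\<bar>b (A *v u) (A *v v)\<bar> \<le> (\<Sum>M\<leftarrow>?W k. \<bar>b' (M *v ((G ** A) *v u)) (M *v ((G ** A) *v v))\<bar>)"
        using sum_list_abs[of "map (\<lambda>M. b' (M *v ((G ** A) *v u)) (M *v ((G ** A) *v v))) (?W k)"]
        by (simp add: o_def)
      also have "\<dots> \<le> (\<Sum>M\<leftarrow>?W k. K * (norm (M ** (G ** A)))\<^sup>2)"
      proof (intro sum_list_mono)
        fix M :: "real^'d^'d"
        let ?N = "M ** (G ** A)"
        have "\<bar>b' (?N *v u) (?N *v v)\<bar> \<le> norm z * (norm P * norm P) * (norm (?N *v u) * norm (?N *v v))"
          by (rule b'_le)
        also have "\<dots> \<le> norm z * (norm P * norm P) * ((norm ?N * norm u) * (norm ?N * norm v))"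
          by (intro mult_left_mono mult_mono norm_matrix_vector_mult_le) auto
        finally show "\<bar>b' (M *v ((G ** A) *v u)) (M *v ((G ** A) *v v))\<bar> \<le> K * (norm ?N)\<^sup>2"
          by (simp add: K_def power2_eq_square mult_ac matrix_vector_mul_assoc)
      qed
      finally show ?thesis by (simp add: N_def sum_list_const_mult)
    qed
    define T where "T = (\<Sum>i\<in>UNIV. e (axis i 1))"
    let ?q = "2 * h * \<sigma> * c"
    have q: "?q > 0" using h \<sigma> c by simp
    have "real n * (?q * \<bar>b (A *v u) (A *v v)\<bar>) \<le> K * T" for n
    proof -
      have "real n * \<bar>b (A *v u) (A *v v)\<bar> \<le> (\<Sum>k<n. K * N k)"
        using sum_mono[of "{..<n}" "\<lambda>_. \<bar>b (A *v u) (A *v v)\<bar>" "\<lambda>k. K * N k"] le by simp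
      then have "?q * (real n * \<bar>b (A *v u) (A *v v)\<bar>) \<le> ?q * (\<Sum>k<n. K * N k)"
        using q by (intro mult_left_mono) auto
      also have "\<dots> = K * (?q * (\<Sum>k<n. N k))" by (simp add: sum_distrib_left mult_ac)
      also have "\<dots> \<le> K * T" unfolding T_def by (intro mult_left_mono N_le K)
      finally show ?thesis by (simp add: mult_ac)
    qed
    moreover have "?q * \<bar>b (A *v u) (A *v v)\<bar> > 0" using q nz by simp
    ultimately show False using reals_Archimedean3 by (metis linorder_not_less)
  qed
  show ?thesis
  proof (rule vec_eq_iff[THEN iffD2, rule_format])
    fix i :: "'d \<times> 'd"
    have "(z v* (A \<otimes>\<^sub>m A)) $ i = (z v* (A \<otimes>\<^sub>m A)) \<bullet> axis i 1" by (simp add: inner_axis)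
    also have "\<dots> = z \<bullet> ((A \<otimes>\<^sub>m A) *v (axis (fst i) 1 \<otimes>\<^sub>v axis (snd i) 1))"
      by (simp only: dot_lmul_matrix kron_vec_axis prod.collapse)
    also have "\<dots> = 0" using b_zero by (simp add: kron_mult_kron_vec b_def)
    finally show "(z v* (A \<otimes>\<^sub>m A)) $ i = 0 $ i" by simp
  qed
qed

lemma kron_vec_mult_kron: "(x \<otimes>\<^sub>v y) v* (P \<otimes>\<^sub>m Q) = (x v* P) \<otimes>\<^sub>v (y v* Q)"
  using kron_mult_kron_vec[of "transpose P" "transpose Q" x y] by (simp flip: transpose_kron)

lemma scr_B_invertible:
  fixes A B C E :: "real^'d^'d"
  assumes C: "pos_def C" and E: "psd E" and \<sigma>: "\<sigma> \<ge> 0" "\<sigma> = 0 \<Longrightarrow> \<rho> = 0"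
    and eq: "B ** E + E ** transpose B + \<sigma> *\<^sub>R (A ** (C + E) ** transpose A) = 0"
    and inv: "invertible (scr_C A B \<sigma> \<rho>)"
  shows "invertible (scr_B A B \<sigma>)"
proof -
  have quad: "2 * ((p v* B) \<bullet> (E *v p)) + \<sigma> * ((p v* A) \<bullet> ((C + E) *v (p v* A))) = 0" for p
  proof -
    have "p \<bullet> ((B ** E + E ** transpose B + \<sigma> *\<^sub>R (A ** (C + E) ** transpose A)) *v p) = 0"
      by (simp add: eq)
    moreover have "p \<bullet> (E *v (p v* B)) = (p v* B) \<bullet> (E *v p)"
      using dot_matrix_symmetric[of E p "p v* B"] E by (simp add: psd_def inner_commute)
    ultimately show ?thesis
      by (simp add: matrix_vector_mult_add_rdistrib[of "B ** E + E ** transpose B"] matrix_vector_mult_add_rdistrib[of "B ** E"]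
          scaleR_matrix_vector_assoc[symmetric] inner_add_right dot_lmul_matrix
          flip: matrix_vector_mul_assoc)
  qed
  have "z = 0" if z: "z v* scr_B A B \<sigma> = 0" for z
  proof -
    have "(z \<otimes>\<^sub>v z) v* (scr_A A ** cal_R \<rho>) = 0"
    \<comment> \<open>The iteration argument requires \<sigma> > 0. For \<sigma> = 0 the factor
      \<rho> of \<open>cal_R\<close> vanishes instead.\<close>
    proof (cases "\<sigma> = 0")
      case True
      then show ?thesis using \<sigma> by (simp add: cal_R_def matrix_matrix_mult_def vector_matrix_mult_def vec_eq_iff)
    next
      case False
      then have "z v* (A \<otimes>\<^sub>m A) = 0" using left_kernel_vanishes[OF C E _ quad z] \<sigma> by simp
      then have "(z \<otimes>\<^sub>v z) v* scr_A A = 0" by (simp add: scr_A_def kron_vec_mult_kron)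
      then show ?thesis by (simp flip: vector_matrix_mul_assoc)
    qed
    then have "(z \<otimes>\<^sub>v z) v* scr_C A B \<sigma> \<rho> = 0"
      by (simp add: scr_C_alt vector_matrix_mult_add_rdistrib kron_vec_mult_kron z)
    then have "(z \<otimes>\<^sub>v z) v* (scr_C A B \<sigma> \<rho> ** matrix_inv (scr_C A B \<sigma> \<rho>)) = 0"
      by (simp flip: vector_matrix_mul_assoc)
    then have "z \<otimes>\<^sub>v z = 0" using matrix_inv_mult[OF inv] by simp
    then have "norm z * norm z = 0" by (metis norm_kron_vec norm_zero)
    then show "z = 0" by simp
  qed
  then have "\<exists>W. W ** transpose (scr_B A B \<sigma>) = mat 1"
    unfolding matrix_left_invertible_ker by simp
  then show ?thesis
    using invertible_left_inverse transpose_invertible transpose_transpose by metis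
qed

section \<open>Cadlag paths\<close>

text \<open>End points of the grid cell (k h, (k + 1) h] that contains \<open>s\<close>. Cells are
  open on the left, so \<open>lgrid h s\<close> is strictly below \<open>s\<close> and values taken
  there tend to the left limit, while values at \<open>rgrid h s\<close> tend to the value at
  \<open>s\<close> of a right-continuous path.\<close>

definition lgrid :: "real \<Rightarrow> real \<Rightarrow> real"
  where "lgrid h s = h * (of_int \<lceil>s / h\<rceil> - 1)"

definition rgrid :: "real \<Rightarrow> real \<Rightarrow> real"
  where "rgrid h s = h * of_int \<lceil>s / h\<rceil>"

lemma grid_bounds:
  assumes "h > 0"
  shows "lgrid h s < s" "s - h \<le> lgrid h s" "s \<le> rgrid h s" "rgrid h s < s + h"
proof -
  have "s / h \<le> of_int \<lceil>s / h\<rceil>" "of_int \<lceil>s / h\<rceil> - 1 < s / h" by linarith+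
  then have "s \<le> of_int \<lceil>s / h\<rceil> * h" "(of_int \<lceil>s / h\<rceil> - 1) * h < s"
    using assms pos_divide_le_eq pos_less_divide_eq by blast+
  then show "lgrid h s < s" "s - h \<le> lgrid h s" "s \<le> rgrid h s" "rgrid h s < s + h"
    by (simp_all add: lgrid_def rgrid_def algebra_simps)
qed

lemma grid_eq:
  assumes "h > 0" "s \<in> {real k * h<..real (Suc k) * h}"
  shows "lgrid h s = real k * h" "rgrid h s = real (Suc k) * h"
proof -
  have "\<lceil>s / h\<rceil> = int (Suc k)"
    using assms by (intro ceiling_unique) (auto simp: field_simps)
  then show "lgrid h s = real k * h" "rgrid h s = real (Suc k) * h"
    by (simp_all add: lgrid_def rgrid_def)
qed

lemma grid_index:
  assumes "h > 0" "0 < s"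
  obtains k where "s \<in> {real k * h<..real (Suc k) * h}"
proof -
  define k where "k = nat (\<lceil>s / h\<rceil> - 1)"
  have "\<lceil>s / h\<rceil> \<ge> 1" using assms by (simp add: le_ceiling_iff)
  then have k: "real k = of_int \<lceil>s / h\<rceil> - 1" by (simp add: k_def)
  have "real k < s / h" "s / h \<le> real k + 1" using k by linarith+
  then show ?thesis using assms that[of k] by (simp add: field_simps)
qed

lemma lgrid_nonneg: "h > 0 \<Longrightarrow> s > 0 \<Longrightarrow> lgrid h s \<ge> 0"
  using grid_index[of h s] grid_eq(1)[of h s] by (metis less_imp_le mult_nonneg_nonneg of_nat_0_le_iff)

abbreviation grid :: "real \<Rightarrow> nat \<Rightarrow> nat \<Rightarrow> real"
  where "grid t n k \<equiv> real k * (t / real (Suc n))"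

abbreviation cell :: "real \<Rightarrow> nat \<Rightarrow> nat \<Rightarrow> real set"
  where "cell t n k \<equiv> {grid t n k<..grid t n (Suc k)}"

lemma mesh_limit: "(\<lambda>n. t / real (Suc n)) \<longlonglongrightarrow> 0"
  by (rule LIMSEQ_Suc, rule lim_const_over_n)

lemma filterlim_lgrid:
  assumes "t > 0"
  shows "filterlim (\<lambda>n. lgrid (t / real (Suc n)) s) (at_left s) sequentially"
proof -
  have h: "t / real (Suc n) > 0" for n using assms by simp
  have "(\<lambda>n. lgrid (t / real (Suc n)) s) \<longlonglongrightarrow> s"
  proof (rule tendsto_sandwich)
    show "(\<lambda>n. s - t / real (Suc n)) \<longlonglongrightarrow> s"
      using tendsto_diff[OF tendsto_const mesh_limit[of t], of s] by simp
    show "\<forall>\<^sub>F n in sequentially. s - t / real (Suc n) \<le> lgrid (t / real (Suc n)) s"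
      "\<forall>\<^sub>F n in sequentially. lgrid (t / real (Suc n)) s \<le> s"
      by (auto intro!: always_eventually less_imp_le[OF grid_bounds(1)[OF h]] grid_bounds(2)[OF h]
          simp del: of_nat_Suc)
  qed simp
  then show ?thesis
    by (auto simp: filterlim_at less_imp_neq[OF grid_bounds(1)[OF h]] grid_bounds(1)[OF h] simp del: of_nat_Suc)
qed

lemma tendsto_rgrid:
  assumes "t > 0" "(f \<longlongrightarrow> f s) (at_right s)"
  shows "(\<lambda>n. f (rgrid (t / real (Suc n)) s)) \<longlonglongrightarrow> f s"
proof -
  have h: "t / real (Suc n) > 0" for n using assms by simp
  have *: "(\<lambda>n. rgrid (t / real (Suc n)) s) \<longlonglongrightarrow> s"
  proof (rule tendsto_sandwich[of "\<lambda>_. s" _ _ "\<lambda>n. s + t / real (Suc n)"])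
    show "(\<lambda>n. s + t / real (Suc n)) \<longlonglongrightarrow> s"
      using tendsto_add[OF tendsto_const mesh_limit[of t], of s] by simp
    show "\<forall>\<^sub>F n in sequentially. s \<le> rgrid (t / real (Suc n)) s"
      "\<forall>\<^sub>F n in sequentially. rgrid (t / real (Suc n)) s \<le> s + t / real (Suc n)"
      by (auto intro!: always_eventually less_imp_le[OF grid_bounds(4)[OF h]] grid_bounds(3)[OF h]
          simp del: of_nat_Suc)
  qed simp
  \<comment> \<open>\<open>rgrid\<close> may hit \<open>s\<close> itself, so convergence is taken
    within the closed half-line rather than along \<open>at_right s\<close>.\<close>
  have "continuous (at s within {s..}) f"
    using assms(2) by (simp add: continuous_within at_within_Ici_at_right)
  then show ?thesis
    by (rule continuous_within_tendsto_compose) (use * grid_bounds(3)[OF h] in auto)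
qed

lemma cadlag_left_lim:
  fixes f :: "real \<Rightarrow> 'b::t2_space"
  assumes "cadlag f" "s > 0"
  shows "(f \<longlongrightarrow> left_lim f s) (at_left s)"
proof -
  obtain l where l: "(f \<longlongrightarrow> l) (at_left s)" using assms by (auto simp: cadlag_def)
  then have "Lim (at_left s) f = l" by (intro tendsto_Lim) auto
  then show ?thesis using l assms by (simp add: left_lim_def)
qed

lemma cadlag_right_lim: "cadlag f \<Longrightarrow> s \<ge> 0 \<Longrightarrow> (f \<longlongrightarrow> f s) (at_right s)"
  by (simp add: cadlag_def)

lemma cadlag_lgrid:
  fixes f :: "real \<Rightarrow> 'b::t2_space"
  assumes "cadlag f" "s > 0" "t > 0"
  shows "(\<lambda>n. f (lgrid (t / real (Suc n)) s)) \<longlonglongrightarrow> left_lim f s"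
  using filterlim_compose[OF cadlag_left_lim[OF assms(1,2)] filterlim_lgrid[OF assms(3)]] .

lemma cadlag_rgrid:
  fixes f :: "real \<Rightarrow> 'b::t2_space"
  assumes "cadlag f" "s \<ge> 0" "t > 0"
  shows "(\<lambda>n. f (rgrid (t / real (Suc n)) s)) \<longlonglongrightarrow> f s"
  using tendsto_rgrid[OF assms(3) cadlag_right_lim[OF assms(1,2)]] .

lemma left_lim_eqI:
  fixes f :: "real \<Rightarrow> 'b::t2_space"
  assumes "(f \<longlongrightarrow> l) (at_left s)" "s > 0"
  shows "left_lim f s = l"
  using assms(2) tendsto_Lim[OF trivial_limit_at_left_real assms(1)] by (simp add: left_lim_def)

lemma cadlag_compose:
  fixes f :: "real \<Rightarrow> 'b::t2_space" and g :: "'b \<Rightarrow> 'c::t2_space"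
  assumes f: "cadlag f" and g: "continuous_on UNIV g"
  shows "cadlag (\<lambda>t. g (f t))" and "t \<ge> 0 \<Longrightarrow> left_lim (\<lambda>t. g (f t)) t = g (left_lim f t)"
proof -
  have *: "((\<lambda>t. g (f t)) \<longlongrightarrow> g l) G" if "(f \<longlongrightarrow> l) G" for l G
    using continuous_on_tendsto_compose[OF g that] by simp
  show "cadlag (\<lambda>t. g (f t))" using f * unfolding cadlag_def by meson
  show "left_lim (\<lambda>t. g (f t)) t = g (left_lim f t)" if "t \<ge> 0"
  proof (cases "t = 0")
    case False
    then show ?thesis using *[OF cadlag_left_lim[OF f, of t]] that by (intro left_lim_eqI) auto
  qed (simp add: left_lim_def)
qed

lemma filterlim_plus_at_right: "filterlim ((+) a) (at_right (a + t)) (at_right (t :: real))"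
  and filterlim_plus_at_left: "filterlim ((+) a) (at_left (a + t)) (at_left (t :: real))"
  by (auto simp: filterlim_at eventually_at_filter intro!: tendsto_eq_intros)

lemma cadlag_shift:
  fixes f :: "real \<Rightarrow> 'b::topological_space"
  assumes "cadlag f" "a \<ge> 0"
  shows "cadlag (\<lambda>t. f (a + t))"
  unfolding cadlag_def
proof (intro conjI allI impI)
  show "((\<lambda>t. f (a + t)) \<longlongrightarrow> f (a + t)) (at_right t)" if "t \<ge> 0" for t
    using filterlim_compose[OF _ filterlim_plus_at_right] cadlag_right_lim[OF assms(1), of "a + t"] assms that
    by auto
  show "\<exists>l. ((\<lambda>t. f (a + t)) \<longlongrightarrow> l) (at_left t)" if t: "t > 0" for t
  proof -
    obtain l where "(f \<longlongrightarrow> l) (at_left (a + t))"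
      using assms t unfolding cadlag_def by (meson add_nonneg_pos)
    from filterlim_compose[OF this filterlim_plus_at_left] show ?thesis by blast
  qed
qed

lemma left_lim_shift:
  fixes f :: "real \<Rightarrow> 'b::t2_space"
  assumes "cadlag f" "a \<ge> 0" "t > 0"
  shows "left_lim (\<lambda>t. f (a + t)) t = left_lim f (a + t)"
proof (rule left_lim_eqI)
  have "(f \<longlongrightarrow> left_lim f (a + t)) (at_left (a + t))"
    using assms by (intro cadlag_left_lim) auto
  then show "((\<lambda>t. f (a + t)) \<longlongrightarrow> left_lim f (a + t)) (at_left t)"
    by (rule filterlim_compose[OF _ filterlim_plus_at_left])
qed fact

text \<open>Compactness of [0, t] in Bolzano's form. Near each time the path stays close to its left
  limit before that time and close to its value from that time on, so the time itself is the only
  cut point needed locally. The condition on \<open>{x<..y}\<close> fits right-continuity: an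
  interval may start in \<open>D\<close> but may not run into it.\<close>

lemma cadlag_oscillation:
  fixes f :: "real \<Rightarrow> 'b::metric_space"
  assumes f: "cadlag f" and "e > 0" "t \<ge> 0"
  shows "\<exists>D. finite D \<and>
    (\<forall>x y. 0 \<le> x \<longrightarrow> x \<le> y \<longrightarrow> y \<le> t \<longrightarrow> {x<..y} \<inter> D = {} \<longrightarrow> dist (f x) (f y) < e)"
proof -
  define P where "P a b \<longleftrightarrow> (\<exists>D. finite D \<and> (\<forall>x y. 0 \<le> x \<longrightarrow> a \<le> x \<longrightarrow> x \<le> y \<longrightarrow> y \<le> b \<longrightarrow> {x<..y} \<inter> D = {} \<longrightarrow> dist (f x) (f y) < e))" for a b
  have "P 0 t"
  proof (rule Bolzano[OF \<open>t \<ge> 0\<close>])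
    fix a b c assume "P a b" "P b c" "a \<le> b" "b \<le> c"
    then obtain D D' where D: "finite D" "\<And>x y. 0 \<le> x \<Longrightarrow> a \<le> x \<Longrightarrow> x \<le> y \<Longrightarrow> y \<le> b \<Longrightarrow> {x<..y} \<inter> D = {} \<Longrightarrow> dist (f x) (f y) < e"
      and D': "finite D'" "\<And>x y. 0 \<le> x \<Longrightarrow> b \<le> x \<Longrightarrow> x \<le> y \<Longrightarrow> y \<le> c \<Longrightarrow> {x<..y} \<inter> D' = {} \<Longrightarrow> dist (f x) (f y) < e"
      unfolding P_def by blast
    show "P a c"
      unfolding P_def
    \<comment> \<open>With \<open>b\<close> as a further cut point, an admissible interval lies
      entirely in one of the two pieces.\<close>
    proof (intro exI[of _ "insert b (D \<union> D')"] conjI allI impI)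
      fix x y assume xy: "0 \<le> x" "a \<le> x" "x \<le> y" "y \<le> c" "{x<..y} \<inter> insert b (D \<union> D') = {}"
      then have "y < b \<or> b \<le> x" by force
      then show "dist (f x) (f y) < e"
        using D(2)[of x y] D'(2)[of x y] xy by (auto simp: Int_Un_distrib)
    qed (use D(1) D'(1) in auto)
  next
    fix s :: real assume s: "0 \<le> s" "s \<le> t"
    have "\<forall>\<^sub>F x in at_right s. dist (f x) (f s) < e / 2"
      using tendstoD[OF cadlag_right_lim[OF f s(1)], of "e / 2"] \<open>e > 0\<close> by simp
    then obtain u where u: "u > s" "\<And>x. s < x \<Longrightarrow> x < u \<Longrightarrow> dist (f x) (f s) < e / 2"
      unfolding eventually_at_right_field by blast
    define d1 where "d1 = u - s"
    have d1: "d1 > 0" "\<And>x. s < x \<Longrightarrow> x < s + d1 \<Longrightarrow> dist (f x) (f s) < e / 2"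
      using u by (auto simp: d1_def)
    obtain d2 l where d2: "d2 > 0" "\<And>x. 0 \<le> x \<Longrightarrow> s - d2 < x \<Longrightarrow> x < s \<Longrightarrow> dist (f x) l < e / 2"
    proof (cases "s = 0")
      case True
      then show ?thesis using that[of 1] by auto
    next
      case False
      then have "\<forall>\<^sub>F x in at_left s. dist (f x) (left_lim f s) < e / 2"
        using tendstoD[OF cadlag_left_lim[OF f, of s], of "e / 2"] s \<open>e > 0\<close> by simp
      then obtain b where b: "b < s" "\<And>x. b < x \<Longrightarrow> x < s \<Longrightarrow> dist (f x) (left_lim f s) < e / 2"
        unfolding eventually_at_left_field by blast
      then show ?thesis using that[of "s - b" "left_lim f s"] by auto
    qed
    show "\<exists>d>0. \<forall>a b. a \<le> s \<and> s \<le> b \<and> b - a < d \<longrightarrow> P a b"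
    proof (intro exI[of _ "min d1 d2"] conjI allI impI)
      fix a b assume ab: "a \<le> s \<and> s \<le> b \<and> b - a < min d1 d2"
      show "P a b"
        unfolding P_def
      proof (intro exI[of _ "{s}"] conjI allI impI)
        fix x y assume xy: "0 \<le> x" "a \<le> x" "x \<le> y" "y \<le> b" "{x<..y} \<inter> {s} = {}"
        consider "y < s" | "s \<le> x" using xy by force
        then show "dist (f x) (f y) < e"
        proof cases
          case 1
          have "dist (f x) l < e / 2" "dist (f y) l < e / 2"
            using 1 xy ab d2(2)[of x] d2(2)[of y] by auto
          then show ?thesis by (rule dist_triangle_half_l)
        next
          case 2
          have *: "dist (f z) (f s) < e / 2" if z: "s \<le> z" "z \<le> b" for z
            using d1(2)[of z] z ab \<open>e > 0\<close> by (cases "z = s") auto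
          have "dist (f x) (f s) < e / 2" "dist (f y) (f s) < e / 2"
            using 2 xy *[of x] *[of y] by auto
          then show ?thesis by (rule dist_triangle_half_l)
        qed
      qed simp
    qed (use d1 d2 in auto)
  qed
  then show ?thesis unfolding P_def by meson
qed

text \<open>Every time is reached from the last cut point before it, or from 0, without crossing
  another one, so the path there is within distance 1 of one of finitely many values.\<close>

lemma cadlag_bounded:
  fixes f :: "real \<Rightarrow> 'b::real_normed_vector"
  assumes f: "cadlag f"
  obtains K where "K > 0" "\<And>s. 0 \<le> s \<Longrightarrow> s \<le> t \<Longrightarrow> norm (f s) \<le> K"
proof (cases "t \<ge> 0")
  case t: True
  obtain D where D: "finite D"
    "\<forall>x y. 0 \<le> x \<longrightarrow> x \<le> y \<longrightarrow> y \<le> t \<longrightarrow> {x<..y} \<inter> D = {} \<longrightarrow> dist (f x) (f y) < 1"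
    using cadlag_oscillation[OF f zero_less_one t] by blast
  note D = D(1) D(2)[rule_format]
  define E where "E = insert 0 (D \<inter> {0..t})"
  have E: "finite E" "0 \<in> E" using D by (auto simp: E_def)
  define K where "K = (\<Sum>s\<in>E. norm (f s)) + 1"
  have "norm (f s) \<le> K" if s: "0 \<le> s" "s \<le> t" for s
  proof -
    define x where "x = Max (E \<inter> {..s})"
    have "0 \<in> E \<inter> {..s}" using E s by auto
    then have "x \<in> E \<inter> {..s}" unfolding x_def using E by (intro Max_in) auto
    then have x: "x \<in> E" "x \<le> s" by auto
    have "{x<..s} \<inter> D = {}"
    proof (rule ccontr)
      assume "{x<..s} \<inter> D \<noteq> {}"
      then obtain y where y: "y \<in> D" "x < y" "y \<le> s" by auto
      have "x \<ge> 0" using x by (auto simp: E_def)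
      then have "y \<in> E \<inter> {..s}" using y s by (auto simp: E_def)
      then have "y \<le> x" unfolding x_def using E by (intro Max_ge) auto
      then show False using y by simp
    qed
    then have "dist (f x) (f s) < 1" using x s by (intro D(2)) (auto simp: E_def)
    then have "norm (f s) \<le> norm (f x) + 1"
      using norm_triangle_ineq2[of "f s" "f x"] by (simp add: dist_norm norm_minus_commute)
    also have "norm (f x) \<le> (\<Sum>s\<in>E. norm (f s))" using x E by (intro member_le_sum) auto
    finally show ?thesis by (simp add: K_def)
  qed
  moreover have "K > 0" unfolding K_def by (simp add: add_nonneg_pos sum_nonneg)
  ultimately show ?thesis using that by blast
next
  case False
  then show ?thesis using that[of 1] by auto
qed

lemma jump_le_oscillation:
  fixes f :: "real \<Rightarrow> 'b::real_normed_vector"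
  assumes f: "cadlag f" and D: "finite D"
    "\<And>x y. 0 \<le> x \<Longrightarrow> x \<le> y \<Longrightarrow> y \<le> t \<Longrightarrow> {x<..y} \<inter> D = {} \<Longrightarrow> dist (f x) (f y) < e"
    and s: "0 < s" "s \<le> t" "s \<notin> D"
  shows "norm (jump f s) \<le> e"
proof -
  have "((\<lambda>x. dist (f x) (f s)) \<longlongrightarrow> dist (left_lim f s) (f s)) (at_left s)"
    using s by (intro tendsto_dist cadlag_left_lim f) auto
  moreover have "\<forall>\<^sub>F x in at_left s. dist (f x) (f s) \<le> e"
  proof -
    \<comment> \<open>No cut point lies strictly between \<open>m\<close> and \<open>s\<close>, and
      \<open>s\<close> itself is none, so the intervals from x to s with m < x are admissible. The
      inserted 0 keeps the maximum defined and nonnegative.\<close>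
    define m where "m = Max (insert 0 (D \<inter> {..<s}))"
    have fin: "finite (insert 0 (D \<inter> {..<s}))" using D by auto
    have m: "m < s" "0 \<le> m" unfolding m_def using s fin by auto
    have "\<forall>\<^sub>F x in at_left s. x \<in> {m<..<s}" by (rule eventually_at_left_real[OF m(1)])
    then show ?thesis
    proof (rule eventually_mono)
      fix x assume x: "x \<in> {m<..<s}"
      have "{x<..s} \<inter> D = {}"
      proof (rule ccontr)
        assume "{x<..s} \<inter> D \<noteq> {}"
        then obtain y where y: "x < y" "y \<le> s" "y \<in> D" by auto
        then have "y \<in> insert 0 (D \<inter> {..<s})" using s by (cases "y = s") auto
        then have "y \<le> m" unfolding m_def using fin by (rule Max_ge[rotated])
        then show False using y x by auto
      qed
      then show "dist (f x) (f s) \<le> e" using D(2)[of x s] x m s by auto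
    qed
  qed
  ultimately have "dist (left_lim f s) (f s) \<le> e" by (intro tendsto_upperbound) auto
  then show ?thesis by (simp add: jump_def dist_norm norm_minus_commute)
qed

text \<open>A jump larger than 1 / (n + 1) can only sit at one of the finitely many cut points for
  that oscillation bound.\<close>

lemma countable_jumps:
  fixes f :: "real \<Rightarrow> 'b::real_normed_vector"
  assumes f: "cadlag f"
  shows "countable {s\<in>{0<..t}. left_lim f s \<noteq> f s}"
proof (cases "t \<ge> 0")
  case True
  have "finite {s\<in>{0<..t}. norm (jump f s) > 1 / real (Suc n)}" for n
  proof -
    have n: "1 / real (Suc n) > 0" by simp
    obtain D where D: "finite D"
      "\<forall>x y. 0 \<le> x \<longrightarrow> x \<le> y \<longrightarrow> y \<le> t \<longrightarrow> {x<..y} \<inter> D = {} \<longrightarrow> dist (f x) (f y) < 1 / real (Suc n)"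
      using cadlag_oscillation[OF f n True] by blast
    note D = D(1) D(2)[rule_format]
    have "{s\<in>{0<..t}. norm (jump f s) > 1 / real (Suc n)} \<subseteq> D"
    proof (rule subsetI, rule ccontr)
      fix s assume s: "s \<in> {s\<in>{0<..t}. norm (jump f s) > 1 / real (Suc n)}" "s \<notin> D"
      have "norm (jump f s) \<le> 1 / real (Suc n)"
        by (rule jump_le_oscillation[OF f D]) (use s in auto)
      then show False using s by auto
    qed
    then show ?thesis using D(1) finite_subset by blast
  qed
  then have "countable (\<Union>n. {s\<in>{0<..t}. norm (jump f s) > 1 / real (Suc n)})"
    by (intro countable_UN) (auto intro: countable_finite)
  moreover have "{s\<in>{0<..t}. left_lim f s \<noteq> f s} \<subseteq> (\<Union>n. {s\<in>{0<..t}. norm (jump f s) > 1 / real (Suc n)})"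
  proof
    fix s assume s: "s \<in> {s\<in>{0<..t}. left_lim f s \<noteq> f s}"
    then have "norm (jump f s) > 0" by (auto simp: jump_def)
    then obtain n where "inverse (real (Suc n)) < norm (jump f s)" using reals_Archimedean by blast
    then show "s \<in> (\<Union>n. {s\<in>{0<..t}. norm (jump f s) > 1 / real (Suc n)})"
      using s by (auto simp: inverse_eq_divide)
  qed
  ultimately show ?thesis by (rule countable_subset[rotated])
qed simp

text \<open>The increments over grid cells avoiding the finitely many large oscillations do not contribute.\<close>

lemma sum_increments_tendsto_jumps:
  fixes f :: "real \<Rightarrow> 'b::real_normed_vector" and g :: "'b \<Rightarrow> real"
  assumes f: "cadlag f" and t: "t > 0" and e: "e > 0"
    and g: "continuous_on UNIV g" "\<And>x. norm x \<le> e \<Longrightarrow> g x = 0"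
  obtains D where "finite D" "D \<subseteq> {0<..t}" "\<forall>s\<in>{0<..t} - D. g (jump f s) = 0"
    "(\<lambda>n. \<Sum>k<Suc n. g (f (grid t n (Suc k)) - f (grid t n k)))
      \<longlonglongrightarrow> (\<Sum>s\<in>D. g (jump f s))"
proof -
  obtain D0 where D0: "finite D0"
    "\<forall>x y. 0 \<le> x \<longrightarrow> x \<le> y \<longrightarrow> y \<le> t \<longrightarrow> {x<..y} \<inter> D0 = {} \<longrightarrow> dist (f x) (f y) < e"
    using cadlag_oscillation[OF f e less_imp_le[OF t]] by blast
  note D0 = D0(1) D0(2)[rule_format]
  define D where "D = D0 \<inter> {0<..t}"
  have D: "finite D" "D \<subseteq> {0<..t}" using D0 by (auto simp: D_def)
  have z: "\<forall>s\<in>{0<..t} - D. g (jump f s) = 0"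
    by (rule ballI, rule g(2), rule jump_le_oscillation[OF f D0]) (auto simp: D_def)
  define h where "h n = t / real (Suc n)" for n
  have h: "h n > 0" for n using t by (simp add: h_def)
  define S where "S n = (\<Sum>k<Suc n. g (f (real (Suc k) * h n) - f (real k * h n)))" for n
  define S' where "S' n = (\<Sum>s\<in>D. g (f (rgrid (h n) s) - f (lgrid (h n) s)))" for n
  have "S' \<longlonglongrightarrow> (\<Sum>s\<in>D. g (jump f s))"
    unfolding S'_def
  proof (intro tendsto_sum)
    fix s assume "s \<in> D"
    then have "s > 0" using D by auto
    then have "(\<lambda>n. f (rgrid (h n) s) - f (lgrid (h n) s)) \<longlonglongrightarrow> jump f s"
      unfolding jump_def h_def using t by (intro tendsto_diff cadlag_rgrid cadlag_lgrid f) auto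
    then show "(\<lambda>n. g (f (rgrid (h n) s) - f (lgrid (h n) s))) \<longlonglongrightarrow> g (jump f s)"
      using g(1) by (intro continuous_on_tendsto_compose[OF g(1)]) auto
  qed
  moreover have "\<forall>\<^sub>F n in sequentially. S' n = S n"
  proof -
    \<comment> \<open>Once the mesh is below the smallest distance between points of
      \<open>D\<close>, each cell contains at most one of them. The inserted 1 keeps the minimum
      defined when \<open>D\<close> has fewer than two points.\<close>
    define \<delta> where "\<delta> = Min (insert 1 ((\<lambda>(x, y). \<bar>x - y\<bar>) ` {p \<in> D \<times> D. fst p \<noteq> snd p}))"
    have fin: "finite (insert 1 ((\<lambda>(x, y). \<bar>x - y\<bar>) ` {p \<in> D \<times> D. fst p \<noteq> snd p}))" using D by auto
    have \<delta>: "\<delta> > 0" unfolding \<delta>_def using fin by (auto simp: Min_gr_iff)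
    have sep: "\<delta> \<le> \<bar>x - y\<bar>" if "x \<in> D" "y \<in> D" "x \<noteq> y" for x y
      unfolding \<delta>_def using fin that by (intro Min_le) force+
    have "\<forall>\<^sub>F n in sequentially. h n < \<delta>"
      using order_tendstoD(2)[OF mesh_limit[of t] \<delta>] by (simp add: h_def)
    then show ?thesis
    proof (rule eventually_mono)
      fix n assume hn: "h n < \<delta>"
      have "\<forall>s\<in>D. \<exists>k. s \<in> {real k * h n<..real (Suc k) * h n}"
        using grid_index[OF h[of n]] D by (metis greaterThanAtMost_iff subsetD)
      then obtain \<kappa> where \<kappa>: "\<And>s. s \<in> D \<Longrightarrow> s \<in> {real (\<kappa> s) * h n<..real (Suc (\<kappa> s)) * h n}"
        by metis
      have inj: "inj_on \<kappa> D"
      proof (rule inj_onI, rule ccontr)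
        fix x y assume xy: "x \<in> D" "y \<in> D" "\<kappa> x = \<kappa> y" "x \<noteq> y"
        have "\<bar>x - y\<bar> < h n" using \<kappa>[OF xy(1)] \<kappa>[OF xy(2)] xy(3) by (auto simp: algebra_simps)
        then show False using sep[OF xy(1,2,4)] hn by simp
      qed
      have sub: "\<kappa> ` D \<subseteq> {..<Suc n}"
      proof (intro image_subsetI)
        fix s assume s: "s \<in> D"
        have "real (\<kappa> s) * h n < t" using \<kappa>[OF s] D s by force
        then have "t * real (\<kappa> s) < t * real (Suc n)" by (simp add: h_def field_simps del: of_nat_Suc)
        then have "real (\<kappa> s) < real (Suc n)" using t mult_less_cancel_left_pos by blast
        then show "\<kappa> s \<in> {..<Suc n}" by simp
      qed
      have "S n = (\<Sum>k\<in>\<kappa> ` D. g (f (real (Suc k) * h n) - f (real k * h n)))"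
        unfolding S_def
      proof (intro sum.mono_neutral_right sub ballI)
        fix k assume k: "k \<in> {..<Suc n} - \<kappa> ` D"
        have kn: "real (Suc k) * h n \<le> t"
        proof -
          have "real (Suc k) \<le> real (Suc n)" using k by auto
          then show ?thesis using t by (simp add: h_def field_simps del: of_nat_Suc)
        qed
        have "{real k * h n<..real (Suc k) * h n} \<inter> D0 = {}"
        proof (rule ccontr)
          assume "{real k * h n<..real (Suc k) * h n} \<inter> D0 \<noteq> {}"
          then obtain s where s: "s \<in> D0" "s \<in> {real k * h n<..real (Suc k) * h n}" by blast
          have "0 \<le> real k * h n" using h[of n] by simp
          then have "s \<in> D" using s kn by (auto simp: D_def)
          then have "\<kappa> s = k"
            using grid_eq(1)[OF h s(2)] grid_eq(1)[OF h \<kappa>[OF \<open>s \<in> D\<close>]] h[of n] by simp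
          then show False using k \<open>s \<in> D\<close> by auto
        qed
        then have "dist (f (real k * h n)) (f (real (Suc k) * h n)) < e"
          using kn h[of n] by (intro D0(2)) (auto simp: algebra_simps)
        then show "g (f (real (Suc k) * h n) - f (real k * h n)) = 0"
          by (intro g(2)) (simp add: dist_norm norm_minus_commute)
      qed simp
      also have "\<dots> = S' n"
        unfolding S'_def using grid_eq[OF h \<kappa>]
        by (subst sum.reindex[OF inj]) (auto intro!: sum.cong)
      finally show "S' n = S n" ..
    qed
  qed
  ultimately have "S \<longlonglongrightarrow> (\<Sum>s\<in>D. g (jump f s))" by (rule Lim_transform_eventually)
  then show ?thesis using that[OF D z] unfolding S_def h_def by blast
qed

section \<open>Pathwise integrals as limits of Riemann sums\<close>

lemma cells_disjoint:
  assumes "h > 0" "j \<noteq> k"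
  shows "{real j * h<..real (Suc j) * h} \<inter> {real k * h<..real (Suc k) * h} = {}"
proof (rule ccontr)
  assume "{real j * h<..real (Suc j) * h} \<inter> {real k * h<..real (Suc k) * h} \<noteq> {}"
  then obtain s where s: "s \<in> {real j * h<..real (Suc j) * h}" "s \<in> {real k * h<..real (Suc k) * h}"
    by blast
  then have "real j * h = real k * h" using grid_eq(1)[OF assms(1)] by metis
  then show False using assms by simp
qed

lemma cells_Union:
  assumes "t > 0"
  shows "(\<Union>k<Suc n. cell t n k) = {0<..t}"
proof (intro equalityI subsetI)
  let ?h = "t / real (Suc n)"
  have h: "?h > 0" using assms by simp
  {
    fix s assume "s \<in> (\<Union>k<Suc n. {real k * ?h<..real (Suc k) * ?h})"
    then obtain k where k: "k < Suc n" "real k * ?h < s" "s \<le> real (Suc k) * ?h" by auto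
    have "0 \<le> real k * ?h" by (rule mult_nonneg_nonneg[OF of_nat_0_le_iff less_imp_le[OF h]])
    moreover have "real (Suc k) * ?h \<le> real (Suc n) * ?h"
      using k h by (intro mult_right_mono) auto
    moreover have "real (Suc n) * ?h = t" by simp
    ultimately show "s \<in> {0<..t}" using k by auto
  next
    fix s assume s: "s \<in> {0<..t}"
    then obtain k where k: "s \<in> {real k * ?h<..real (Suc k) * ?h}" using grid_index[OF h, of s] by auto
    then have "real k * ?h < real (Suc n) * ?h" using s by simp
    then have "real k < real (Suc n)" using h mult_less_cancel_right_pos by blast
    then show "s \<in> (\<Union>k<Suc n. {real k * ?h<..real (Suc k) * ?h})" using k by auto
  }
qed

text \<open>The measure \<open>N\<close> stands for Lebesgue measure, for a counting measure or for a
  Stieltjes measure.\<close>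

lemma riemann_sums_tendsto:
  fixes N :: "real measure" and \<beta> f :: "real \<Rightarrow> real"
  assumes t: "t > 0" and N: "sets borel \<subseteq> sets N" "space N = UNIV"
    and \<beta>: "set_integrable N {0<..t} \<beta>"
    and c: "\<And>n k. k < Suc n \<Longrightarrow> \<bar>c n k\<bar> \<le> K"
    and \<phi>: "\<And>n k s. k < Suc n \<Longrightarrow> s \<in> cell t n k \<Longrightarrow> \<phi> n s = c n k"
    and lim: "\<And>s. 0 < s \<Longrightarrow> s \<le> t \<Longrightarrow> (\<lambda>n. \<phi> n s) \<longlonglongrightarrow> f s"
  shows "(\<lambda>n. \<Sum>k<Suc n. c n k * (LINT s:cell t n k|N. \<beta> s))
      \<longlonglongrightarrow> (LINT s:{0<..t}|N. f s * \<beta> s)"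
    and "set_integrable N {0<..t} (\<lambda>s. f s * \<beta> s)"
proof -
  define I where "I n k = cell t n k" for n k
  have h: "t / real (Suc n) > 0" for n using t by simp
  have I_sub: "I n k \<subseteq> {0<..t}" if "k < Suc n" for n k
    using cells_Union[OF t, of n] that unfolding I_def by blast
  have I_sets: "I n k \<in> sets N" for n k using N unfolding I_def by auto
  have \<beta>I: "set_integrable N (I n k) \<beta>" if "k < Suc n" for n k
    using \<beta> I_sets I_sub[OF that] by (rule set_integrable_subset)
  \<comment> \<open>The Riemann sum is the integral of this step function, so dominated convergence
    with the bound K \<bar>\<beta>\<bar> serves all choices of \<open>N\<close> at once.\<close>
  define g where "g n s = indicator {0<..t} s * (\<phi> n s * \<beta> s)" for n s
  have g_eq: "g n s = (\<Sum>k<Suc n. c n k * (indicator (I n k) s *\<^sub>R \<beta> s))" for n s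
  proof (cases "s \<in> {0<..t}")
    case True
    then obtain k where k: "k < Suc n" "s \<in> I n k"
      using cells_Union[OF t, of n] unfolding I_def by blast
    have "indicator (I n j) s = (if j = k then 1 else 0 :: real)" for j
      using cells_disjoint[OF h[of n], of j k] k unfolding I_def by (auto simp: indicator_def)
    then have "(\<Sum>j<Suc n. c n j * (indicator (I n j) s *\<^sub>R \<beta> s)) = (\<Sum>j<Suc n. if j = k then c n k * \<beta> s else 0)"
      by (intro sum.cong refl) auto
    also have "\<dots> = c n k * \<beta> s" using k by simp
    finally show ?thesis using True \<phi>[of k n s] k by (simp add: g_def I_def)
  next
    case False
    then have "s \<notin> I n k" if "k < Suc n" for k using I_sub[OF that] by blast
    then show ?thesis using False by (simp add: g_def)
  qed
  have g_int: "integrable N (g n)" for n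
    unfolding g_eq using \<beta>I by (intro Bochner_Integration.integrable_sum integrable_mult_right) (auto simp: set_integrable_def)
  have g_integral: "integral\<^sup>L N (g n) = (\<Sum>k<Suc n. c n k * (LINT s:I n k|N. \<beta> s))" for n
    unfolding g_eq using \<beta>I
    by (subst Bochner_Integration.integral_sum) (auto simp: set_integrable_def set_lebesgue_integral_def)
  define w where "w s = K * \<bar>indicator {0<..t} s *\<^sub>R \<beta> s\<bar>" for s
  have w: "integrable N w"
    using \<beta> unfolding w_def set_integrable_def by (intro integrable_mult_right integrable_abs) auto
  have g_lim: "(\<lambda>n. g n s) \<longlonglongrightarrow> indicator {0<..t} s * (f s * \<beta> s)" for s
    unfolding g_def using lim[of s] by (cases "s \<in> {0<..t}") (auto intro!: tendsto_intros)
  have meas: "(\<lambda>s. indicator {0<..t} s * (f s * \<beta> s)) \<in> borel_measurable N"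
    by (rule borel_measurable_LIMSEQ_real[OF g_lim]) (use g_int in auto)
  have dom: "norm (g n s) \<le> w s" for n s
  proof (cases "s \<in> {0<..t}")
    case True
    then obtain k where k: "k < Suc n" "s \<in> I n k"
      using cells_Union[OF t, of n] unfolding I_def by blast
    then have "\<bar>\<phi> n s\<bar> \<le> K" using \<phi>[of k n s] c[of k n] by (simp add: I_def)
    then show ?thesis using True by (simp add: g_def w_def abs_mult mult_right_mono)
  qed (simp add: g_def w_def)
  have "integrable N (\<lambda>s. indicator {0<..t} s * (f s * \<beta> s))"
    by (rule integrable_dominated_convergence[where s = g and w = w]) (use g_int g_lim dom meas w in auto)
  then show "set_integrable N {0<..t} (\<lambda>s. f s * \<beta> s)" by (simp add: set_integrable_def)
  have "(\<lambda>n. integral\<^sup>L N (g n)) \<longlonglongrightarrow> integral\<^sup>L N (\<lambda>s. indicator {0<..t} s * (f s * \<beta> s))"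
    by (rule integral_dominated_convergence[where s = g and w = w]) (use g_int g_lim dom meas w in auto)
  then show "(\<lambda>n. \<Sum>k<Suc n. c n k * (LINT s:cell t n k|N. \<beta> s))
      \<longlonglongrightarrow> (LINT s:{0<..t}|N. f s * \<beta> s)"
    unfolding g_integral I_def by (simp add: set_lebesgue_integral_def)
qed

lemma grid_point_bounds:
  assumes "t > 0" "k < Suc n"
  shows "0 \<le> grid t n k" "grid t n k \<le> t"
    "0 \<le> grid t n (Suc k)" "grid t n (Suc k) \<le> t"
    "grid t n k \<le> grid t n (Suc k)"
proof -
  have "real k * t \<le> real (Suc n) * t" "real (Suc k) * t \<le> real (Suc n) * t"
    using assms by (auto intro!: mult_right_mono)
  then show "grid t n k \<le> t" "grid t n (Suc k) \<le> t"
    by (simp_all add: field_simps del: of_nat_Suc)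
  show "grid t n k \<le> grid t n (Suc k)"
    using assms by (intro mult_right_mono) auto
qed (use assms in auto)

text \<open>The two end points of the cells give different limits when \<open>N\<close> has atoms:
  left end points see the left limit of \<open>u\<close>, right end points its value. This
  difference produces the product of jumps in \<open>product_formula\<close>.\<close>

lemma
  fixes N :: "real measure" and \<beta> u :: "real \<Rightarrow> real"
  assumes t: "t > 0" and N: "sets borel \<subseteq> sets N" "space N = UNIV"
    and \<beta>: "set_integrable N {0<..t} \<beta>" and u: "cadlag u"
  shows left_riemann_sums: "(\<lambda>n. \<Sum>k<Suc n. u (grid t n k) *
        (LINT s:cell t n k|N. \<beta> s))
      \<longlonglongrightarrow> (LINT s:{0<..t}|N. left_lim u s * \<beta> s)"
    and left_lim_integrable: "set_integrable N {0<..t} (\<lambda>s. left_lim u s * \<beta> s)"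
    and right_riemann_sums: "(\<lambda>n. \<Sum>k<Suc n. u (grid t n (Suc k)) *
        (LINT s:cell t n k|N. \<beta> s))
      \<longlonglongrightarrow> (LINT s:{0<..t}|N. u s * \<beta> s)"
    and cadlag_mult_integrable: "set_integrable N {0<..t} (\<lambda>s. u s * \<beta> s)"
proof -
  obtain K where K: "K > 0" "\<And>s. 0 \<le> s \<Longrightarrow> s \<le> t \<Longrightarrow> norm (u s) \<le> K"
    using cadlag_bounded[OF u] by blast
  have h: "t / real (Suc n) > 0" for n using t by simp
  have b: "\<bar>u (grid t n k)\<bar> \<le> K" "\<bar>u (grid t n (Suc k))\<bar> \<le> K" if "k < Suc n" for n k
    using K(2) grid_point_bounds[OF t that] by auto
  have l: "(\<lambda>n. u (lgrid (t / real (Suc n)) s)) \<longlonglongrightarrow> left_lim u s"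
    "(\<lambda>n. u (rgrid (t / real (Suc n)) s)) \<longlonglongrightarrow> u s" if "0 < s" "s \<le> t" for s
    using cadlag_lgrid[OF u that(1) t] cadlag_rgrid[OF u _ t, of s] that by auto
  note L = riemann_sums_tendsto[OF t N \<beta>, where c = "\<lambda>n k. u (grid t n k)"
      and \<phi> = "\<lambda>n s. u (lgrid (t / real (Suc n)) s)" and f = "left_lim u" and K = K]
  note R = riemann_sums_tendsto[OF t N \<beta>, where c = "\<lambda>n k. u (grid t n (Suc k))"
      and \<phi> = "\<lambda>n s. u (rgrid (t / real (Suc n)) s)" and f = u and K = K]
  show "(\<lambda>n. \<Sum>k<Suc n. u (grid t n k) *
        (LINT s:cell t n k|N. \<beta> s))
      \<longlonglongrightarrow> (LINT s:{0<..t}|N. left_lim u s * \<beta> s)"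
    by (rule L(1)[OF b(1)]) (simp_all only: grid_eq(1)[OF h] l(1))
  show "set_integrable N {0<..t} (\<lambda>s. left_lim u s * \<beta> s)"
    by (rule L(2)[OF b(1)]) (simp_all only: grid_eq(1)[OF h] l(1))
  show "(\<lambda>n. \<Sum>k<Suc n. u (grid t n (Suc k)) *
        (LINT s:cell t n k|N. \<beta> s))
      \<longlonglongrightarrow> (LINT s:{0<..t}|N. u s * \<beta> s)"
    by (rule R(1)[OF b(2)]) (simp_all only: grid_eq(2)[OF h] l(2))
  show "set_integrable N {0<..t} (\<lambda>s. u s * \<beta> s)"
    by (rule R(2)[OF b(2)]) (simp_all only: grid_eq(2)[OF h] l(2))
qed

lemma set_integral_Ioc_add:
  fixes N :: "real measure" and \<beta> :: "real \<Rightarrow> real"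
  assumes "sets borel \<subseteq> sets N" "set_integrable N {0<..t} \<beta>" "0 \<le> x" "x \<le> y" "y \<le> t"
  shows "(LINT s:{0<..y}|N. \<beta> s) - (LINT s:{0<..x}|N. \<beta> s) = (LINT s:{x<..y}|N. \<beta> s)"
proof -
  have "(LINT s:{0<..x} \<union> {x<..y}|N. \<beta> s) = (LINT s:{0<..x}|N. \<beta> s) + (LINT s:{x<..y}|N. \<beta> s)"
    by (rule set_integral_Un) (use assms in \<open>auto intro!: set_integrable_subset[OF assms(2)]\<close>)
  moreover have "{0<..x} \<union> {x<..y} = {0<..y}" using assms by auto
  ultimately show ?thesis by simp
qed

text \<open>Both sides are limits of the same left Riemann sums, because the increments of the integrator
  over the cells are \<open>\<Sum> p\<close> over the cells.\<close>

lemma LS_integral_pure_jump: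
  assumes t: "t > 0" and I: "has_LS_integral f F t I" and u: "cadlag u"
    and f: "\<And>s. s \<in> {0<..t} \<Longrightarrow> f s = left_lim u s"
    and p: "set_integrable (count_space UNIV) {0<..t} p"
    and F: "\<And>s. 0 \<le> s \<Longrightarrow> s \<le> t \<Longrightarrow> F s = (LINT r:{0<..s}|count_space UNIV. p r)"
  shows "I = (LINT r:{0<..t}|count_space UNIV. left_lim u r * p r)"
proof -
  obtain G H where GH: "mono G" "mono H" "\<And>s. continuous (at_right s) G" "\<And>s. continuous (at_right s) H"
    and FGH: "\<And>s. s \<in> {0..t} \<Longrightarrow> F s = G s - H s"
    and I: "I = (LINT s:{0<..t}|interval_measure G. f s) - (LINT s:{0<..t}|interval_measure H. f s)"
    using I unfolding has_LS_integral_def by blast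
  have one: "set_integrable (interval_measure X) {0<..t} (\<lambda>_. 1 :: real)"
    and Ioc: "x \<le> y \<Longrightarrow> (LINT s:{x<..y}|interval_measure X. 1) = X y - X x"
    if "mono X" "\<And>s. continuous (at_right s) X" for X x y
    using that t by (auto simp: set_integrable_def set_lebesgue_integral_def emeasure_interval_measure_Ioc
        measure_interval_measure_Ioc monoD integrable_indicator_iff)
  have lim: "(\<lambda>n. \<Sum>k<Suc n. u (grid t n k) *
        (X (grid t n (Suc k)) - X (grid t n k)))
      \<longlonglongrightarrow> (LINT s:{0<..t}|interval_measure X. f s)"
    if X: "mono X" "\<And>s. continuous (at_right s) X" for X
  proof -
    have "(LINT s:{0<..t}|interval_measure X. left_lim u s * 1) = (LINT s:{0<..t}|interval_measure X. f s)"
      by (intro set_lebesgue_integral_cong) (auto simp: f)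
    moreover have "(\<Sum>k<Suc n. u (grid t n k) *
        (LINT s:cell t n k|interval_measure X. 1)) =
        (\<Sum>k<Suc n. u (grid t n k) *
        (X (grid t n (Suc k)) - X (grid t n k)))" for n
      by (intro sum.cong refl arg_cong2[of _ _ _ _ "(*)"] Ioc X grid_point_bounds(5)[OF t]) auto
    ultimately show ?thesis
      using left_riemann_sums[OF t _ _ one[OF X] u] by simp
  qed
  have "(\<lambda>n. \<Sum>k<Suc n. u (grid t n k) *
        (F (grid t n (Suc k)) - F (grid t n k))) \<longlonglongrightarrow> I"
    unfolding I
  proof (rule Lim_transform_eventually[OF tendsto_diff[OF lim[OF GH(1,3)] lim[OF GH(2,4)]]], intro always_eventually allI)
    fix n
    show "(\<Sum>k<Suc n. u (grid t n k) * (G (grid t n (Suc k)) - G (grid t n k))) -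
          (\<Sum>k<Suc n. u (grid t n k) * (H (grid t n (Suc k)) - H (grid t n k))) =
          (\<Sum>k<Suc n. u (grid t n k) * (F (grid t n (Suc k)) - F (grid t n k)))"
      unfolding sum_subtractf[symmetric]
    proof (intro sum.cong refl)
      fix k assume "k \<in> {..<Suc n}"
      then have "k < Suc n" by simp
      note b = grid_point_bounds[OF t this]
      show "u (grid t n k) * (G (grid t n (Suc k)) - G (grid t n k)) -
          u (grid t n k) * (H (grid t n (Suc k)) - H (grid t n k)) =
          u (grid t n k) * (F (grid t n (Suc k)) - F (grid t n k))"
      proof -
        have e: "F (grid t n k) = G (grid t n k) - H (grid t n k)"
          "F (grid t n (Suc k)) = G (grid t n (Suc k)) - H (grid t n (Suc k))"
          using b by (auto intro!: FGH simp del: of_nat_Suc)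
        show ?thesis unfolding e right_diff_distrib by linarith
      qed
    qed
  qed
  moreover have "(\<Sum>k<Suc n. u (grid t n k) *
        (F (grid t n (Suc k)) - F (grid t n k))) =
      (\<Sum>k<Suc n. u (grid t n k) *
        (LINT s:cell t n k|count_space UNIV. p s))" for n
  proof (intro sum.cong refl arg_cong2[of _ _ _ _ "(*)"])
    fix k assume "k \<in> {..<Suc n}"
    then have "k < Suc n" by simp
    note b = grid_point_bounds[OF t this]
    show "F (grid t n (Suc k)) - F (grid t n k) =
        (LINT s:cell t n k|count_space UNIV. p s)"
      unfolding F[OF b(1,2)] F[OF b(3,4)] by (rule set_integral_Ioc_add[OF _ p b(1,5,4)]) auto
  qed
  ultimately have "(\<lambda>n. \<Sum>k<Suc n. u (grid t n k) *
        (LINT s:cell t n k|count_space UNIV. p s)) \<longlonglongrightarrow> I"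
    by simp
  moreover have "(\<lambda>n. \<Sum>k<Suc n. u (grid t n k) *
        (LINT s:cell t n k|count_space UNIV. p s))
      \<longlonglongrightarrow> (LINT r:{0<..t}|count_space UNIV. left_lim u r * p r)"
    by (rule left_riemann_sums[OF t _ _ p u]) auto
  ultimately show ?thesis by (rule LIMSEQ_unique)
qed

section \<open>Paths with drift and summable jumps, and integration by parts\<close>

lemma shrinking_integral:
  fixes N :: "real measure" and \<beta> :: "real \<Rightarrow> real"
  assumes t: "t > 0" and N: "sets borel \<subseteq> sets N"
    and \<beta>: "set_integrable N {0<..t} \<beta>" and s: "0 < s" "s \<le> t"
  shows "(\<lambda>n. LINT r:{lgrid (t / real (Suc n)) s<..s}|N. \<beta> r) \<longlonglongrightarrow> (LINT r:{s}|N. \<beta> r)"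
proof -
  have h: "t / real (Suc n) > 0" for n using t by simp
  have nn: "0 \<le> lgrid (t / real (Suc n)) s" for n using lgrid_nonneg[OF h s(1)] .
  have sub: "set_integrable N {lgrid (t / real (Suc n)) s<..s} \<beta>" for n
    using N s nn[of n] by (intro set_integrable_subset[OF \<beta>]) (auto simp: subset_eq)
  have sub': "set_integrable N {s} \<beta>"
    using N s by (intro set_integrable_subset[OF \<beta>]) auto
  show ?thesis
    unfolding set_lebesgue_integral_def
  proof (rule integral_dominated_convergence[where w = "\<lambda>r. \<bar>indicator {0<..t} r *\<^sub>R \<beta> r\<bar>"])
    show "integrable N (\<lambda>r. \<bar>indicator {0<..t} r *\<^sub>R \<beta> r\<bar>)"
      using \<beta> unfolding set_integrable_def by (rule integrable_abs)
    \<comment> \<open>The intervals shrink to the point \<open>s\<close>: a point below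
      \<open>s\<close> is eventually excluded, and \<open>s\<close> never is, because
      \<open>lgrid\<close> stays strictly below it. Only an atom at \<open>s\<close>
      survives.\<close>
    have lim: "(\<lambda>n. indicator {lgrid (t / real (Suc n)) s<..s} r *\<^sub>R \<beta> r) \<longlonglongrightarrow> indicator {s} r *\<^sub>R \<beta> r" for r
    proof (cases "r < s")
      case True
      have "filterlim (\<lambda>n. lgrid (t / real (Suc n)) s) (at_left s) sequentially" by (rule filterlim_lgrid[OF t])
      then have "(\<lambda>n. lgrid (t / real (Suc n)) s) \<longlonglongrightarrow> s" by (simp add: filterlim_at)
      then have "\<forall>\<^sub>F n in sequentially. r < lgrid (t / real (Suc n)) s" using True by (rule order_tendstoD)
      then have "\<forall>\<^sub>F n in sequentially. indicator {s} r *\<^sub>R \<beta> r = indicator {lgrid (t / real (Suc n)) s<..s} r *\<^sub>R \<beta> r"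
        by (rule eventually_mono) (use True in auto)
      then show ?thesis by (rule Lim_transform_eventually[OF tendsto_const])
    next
      case False
      then have eq: "indicator {lgrid (t / real (Suc n)) s<..s} r *\<^sub>R \<beta> r = indicator {s} r *\<^sub>R \<beta> r" for n
        using grid_bounds(1)[OF h[of n], of s] by (cases "r = s") (simp_all add: indicator_def)
      show ?thesis unfolding eq by (rule tendsto_const)
    qed
    then show "AE r in N. (\<lambda>n. indicator {lgrid (t / real (Suc n)) s<..s} r *\<^sub>R \<beta> r) \<longlonglongrightarrow> indicator {s} r *\<^sub>R \<beta> r"
      by simp
    show "AE r in N. norm (indicator {lgrid (t / real (Suc n)) s<..s} r *\<^sub>R \<beta> r) \<le> \<bar>indicator {0<..t} r *\<^sub>R \<beta> r\<bar>" for n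
      using s nn[of n] by (intro AE_I2) (simp add: indicator_def)
  qed (use sub sub' in \<open>auto simp: set_integrable_def\<close>)
qed

text \<open>A path with drift density \<open>a\<close> and jumps \<open>p\<close>. Integrability
  against the counting measure encodes absolute summability of the jumps, so drift and jumps fall
  under the same Riemann sum lemmas. That \<open>p\<close> is really the jump of \<open>u\<close> is
  a consequence.\<close>

locale jump_path =
  fixes u a p :: "real \<Rightarrow> real" and t :: real
  assumes t: "t > 0" and cadlag: "cadlag u"
    and a: "set_integrable lborel {0<..t} a" and p: "set_integrable (count_space UNIV) {0<..t} p"
    and increment: "\<And>y. 0 \<le> y \<Longrightarrow> y \<le> t \<Longrightarrow>
      u y = u 0 + (LINT r:{0<..y}|lborel. a r) + (LINT r:{0<..y}|count_space UNIV. p r)"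
begin

lemma increment': "0 \<le> x \<Longrightarrow> x \<le> y \<Longrightarrow> y \<le> t \<Longrightarrow>
    u y - u x = (LINT r:{x<..y}|lborel. a r) + (LINT r:{x<..y}|count_space UNIV. p r)"
  using increment[of x] increment[of y] set_integral_Ioc_add[OF _ a, of x y]
    set_integral_Ioc_add[OF _ p, of x y] by simp

text \<open>The increment over the cell part ending at \<open>s\<close> tends to the jump of
  \<open>u\<close> on one side and to the atom \<open>p s\<close> on the other, as the Lebesgue part
  dies out.\<close>

lemma left_lim_eq:
  assumes s: "0 < s" "s \<le> t"
  shows "u s = left_lim u s + p s"
proof -
  have h: "t / real (Suc n) > 0" for n using t by simp
  have "(\<lambda>n. (LINT r:{lgrid (t / real (Suc n)) s<..s}|lborel. a r) +
      (LINT r:{lgrid (t / real (Suc n)) s<..s}|count_space UNIV. p r))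
      \<longlonglongrightarrow> (LINT r:{s}|lborel. a r) + (LINT r:{s}|count_space UNIV. p r)"
    by (intro tendsto_add shrinking_integral[OF t _ a s] shrinking_integral[OF t _ p s]) auto
  also have "(LINT r:{s}|lborel. a r) = 0"
    unfolding set_lebesgue_integral_def
    by (rule integral_eq_zero_AE, rule AE_I'[of "{s}"]) (auto simp: indicator_def)
  also have "(LINT r:{s}|count_space UNIV. p r) = p s"
    by (cases "p s = 0") (simp_all add: set_lebesgue_integral_def
        lebesgue_integral_count_space_finite_support indicator_def if_distrib cong: if_cong)
  also have "(\<lambda>n. (LINT r:{lgrid (t / real (Suc n)) s<..s}|lborel. a r) +
      (LINT r:{lgrid (t / real (Suc n)) s<..s}|count_space UNIV. p r)) =
      (\<lambda>n. u s - u (lgrid (t / real (Suc n)) s))"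
    using lgrid_nonneg[OF h s(1)] grid_bounds(1)[OF h, of _ s] s
    by (intro ext increment'[symmetric]) (auto intro: less_imp_le)
  finally have "(\<lambda>n. u s - u (lgrid (t / real (Suc n)) s)) \<longlonglongrightarrow> p s" by simp
  moreover have "(\<lambda>n. u s - u (lgrid (t / real (Suc n)) s)) \<longlonglongrightarrow> u s - left_lim u s"
    by (intro tendsto_intros cadlag_lgrid cadlag s t)
  ultimately have "u s - left_lim u s = p s" by (rule LIMSEQ_unique[rotated])
  then show ?thesis by simp
qed

end

text \<open>The product telescopes over the grid, with \<open>u\<close> at left and \<open>v\<close>
  at right end points. In the jump sum the value of \<open>v\<close> is its left limit plus
  \<open>q\<close>, which gives the term p q; in the time integral the countably many jump times are
  negligible.\<close>

lemma product_formula: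
  assumes U: "jump_path u a p t" and V: "jump_path v b q t"
  shows "u t * v t - u 0 * v 0 =
    (LINT s:{0<..t}|lborel. left_lim u s * b s + left_lim v s * a s) +
    (LINT s:{0<..t}|count_space UNIV. left_lim u s * q s + left_lim v s * p s + p s * q s)"
proof -
  interpret U: jump_path u a p t by fact
  interpret V: jump_path v b q t by fact
  note t = U.t
  have v_jump: "v s = left_lim v s + q s" if "s \<in> {0<..t}" for s
    using V.left_lim_eq that by simp
  let ?h = "\<lambda>n. t / real (Suc n)"
  have tel: "u t * v t - u 0 * v 0 =
    (\<Sum>k<Suc n. u (grid t n k) * (v (grid t n (Suc k)) - v (grid t n k))) +
    (\<Sum>k<Suc n. v (grid t n (Suc k)) * (u (grid t n (Suc k)) - u (grid t n k)))" for n
  proof -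
    have "u t * v t - u 0 * v 0 = (\<Sum>k<Suc n. u (grid t n (Suc k)) * v (grid t n (Suc k)) - u (grid t n k) * v (grid t n k))"
      by (subst sum_lessThan_telescope) simp
    also have "\<dots> = (\<Sum>k<Suc n. u (grid t n k) * (v (grid t n (Suc k)) - v (grid t n k)) +
        v (grid t n (Suc k)) * (u (grid t n (Suc k)) - u (grid t n k)))"
      by (intro sum.cong refl) (simp add: algebra_simps del: of_nat_Suc)
    finally show ?thesis by (simp only: sum.distrib)
  qed
  let ?I = "\<lambda>n k. cell t n k"
  have eq1: "(\<Sum>k<Suc n. u (grid t n k) * (v (grid t n (Suc k)) - v (grid t n k))) =
      (\<Sum>k<Suc n. u (grid t n k) * (LINT s:?I n k|lborel. b s)) +
      (\<Sum>k<Suc n. u (grid t n k) * (LINT s:?I n k|count_space UNIV. q s))" for n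
    unfolding sum.distrib[symmetric] distrib_left[symmetric]
    using grid_point_bounds[OF t, of _ n]
    by (intro sum.cong refl arg_cong2[of _ _ _ _ "(*)"] V.increment') auto
  have eq2: "(\<Sum>k<Suc n. v (grid t n (Suc k)) * (u (grid t n (Suc k)) - u (grid t n k))) =
      (\<Sum>k<Suc n. v (grid t n (Suc k)) * (LINT s:?I n k|lborel. a s)) +
      (\<Sum>k<Suc n. v (grid t n (Suc k)) * (LINT s:?I n k|count_space UNIV. p s))" for n
    unfolding sum.distrib[symmetric] distrib_left[symmetric]
    using grid_point_bounds[OF t, of _ n]
    by (intro sum.cong refl arg_cong2[of _ _ _ _ "(*)"] U.increment') auto
  let ?L = "\<lambda>n. (\<Sum>k<Suc n. u (grid t n k) * (LINT s:?I n k|lborel. b s)) +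
      (\<Sum>k<Suc n. u (grid t n k) * (LINT s:?I n k|count_space UNIV. q s)) +
      ((\<Sum>k<Suc n. v (grid t n (Suc k)) * (LINT s:?I n k|lborel. a s)) +
      (\<Sum>k<Suc n. v (grid t n (Suc k)) * (LINT s:?I n k|count_space UNIV. p s)))"
  have "?L \<longlonglongrightarrow> (LINT s:{0<..t}|lborel. left_lim u s * b s) + (LINT s:{0<..t}|count_space UNIV. left_lim u s * q s) +
      ((LINT s:{0<..t}|lborel. v s * a s) + (LINT s:{0<..t}|count_space UNIV. v s * p s))"
    by (intro tendsto_add left_riemann_sums right_riemann_sums t U.a U.p V.a V.p U.cadlag V.cadlag) auto
  moreover have "?L = (\<lambda>n. u t * v t - u 0 * v 0)"
  proof (rule ext)
    fix n
    show "?L n = u t * v t - u 0 * v 0" unfolding tel[of n] eq1 eq2 by (rule refl)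
  qed
  ultimately have "u t * v t - u 0 * v 0 =
      (LINT s:{0<..t}|lborel. left_lim u s * b s) + (LINT s:{0<..t}|count_space UNIV. left_lim u s * q s) +
      ((LINT s:{0<..t}|lborel. v s * a s) + (LINT s:{0<..t}|count_space UNIV. v s * p s))"
    using LIMSEQ_unique[OF tendsto_const] by fastforce
  moreover have "(LINT s:{0<..t}|lborel. v s * a s) = (LINT s:{0<..t}|lborel. left_lim v s * a s)"
    unfolding set_lebesgue_integral_def
  proof (rule integral_cong_AE)
    have "{s\<in>{0<..t}. left_lim v s \<noteq> v s} \<in> null_sets lborel"
      by (rule countable_imp_null_set_lborel[OF countable_jumps[OF V.cadlag]])
    then show "AE s in lborel. indicator {0<..t} s *\<^sub>R (v s * a s) = indicator {0<..t} s *\<^sub>R (left_lim v s * a s)"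
      by (rule AE_I') (auto simp: indicator_def)
  qed (use cadlag_mult_integrable[OF t _ _ U.a V.cadlag] left_lim_integrable[OF t _ _ U.a V.cadlag] in
      \<open>auto simp: set_integrable_def dest: borel_measurable_integrable\<close>)
  moreover have "(LINT s:{0<..t}|count_space UNIV. v s * p s) =
      (LINT s:{0<..t}|count_space UNIV. left_lim v s * p s + p s * q s)"
    by (intro set_lebesgue_integral_cong) (auto simp: v_jump algebra_simps)
  moreover have i1: "set_integrable (count_space UNIV) {0<..t} (\<lambda>s. left_lim v s * p s)"
    by (rule left_lim_integrable[OF t _ _ U.p V.cadlag]) auto
  moreover have i2: "set_integrable (count_space UNIV) {0<..t} (\<lambda>s. p s * q s)"
  proof -
    have "set_integrable (count_space UNIV) {0<..t} (\<lambda>s. v s * p s - left_lim v s * p s)"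
      by (intro set_integral_diff(1) i1 cadlag_mult_integrable[OF t _ _ U.p V.cadlag]) auto
    then show ?thesis
      by (rule set_integrable_cong[THEN iffD1, rotated -1]) (auto simp: v_jump algebra_simps)
  qed
  moreover have i3: "set_integrable (count_space UNIV) {0<..t} (\<lambda>s. left_lim u s * q s)"
    by (rule left_lim_integrable[OF t _ _ V.p U.cadlag]) auto
  moreover have i4: "set_integrable lborel {0<..t} (\<lambda>s. left_lim u s * b s)"
    by (rule left_lim_integrable[OF t _ _ V.a U.cadlag]) auto
  moreover have i5: "set_integrable lborel {0<..t} (\<lambda>s. left_lim v s * a s)"
    by (rule left_lim_integrable[OF t _ _ U.a V.cadlag]) auto
  ultimately show ?thesis
    by (simp add: set_integral_add)
qed

section \<open>Jump sums of a Levy process\<close>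

text \<open>Fatou's lemma gives the lower bound and domination by the limit gives the upper one; an
  infinite integral of \<open>g\<close> is covered.\<close>

lemma nn_integral_tendsto_below:
  fixes f :: "nat \<Rightarrow> 'a \<Rightarrow> ennreal"
  assumes [measurable]: "\<And>n. f n \<in> borel_measurable M" "g \<in> borel_measurable M"
    and le: "\<And>n. AE x in M. f n x \<le> g x" and lim: "AE x in M. (\<lambda>n. f n x) \<longlonglongrightarrow> g x"
  shows "(\<lambda>n. \<integral>\<^sup>+x. f n x \<partial>M) \<longlonglongrightarrow> (\<integral>\<^sup>+x. g x \<partial>M)"
proof -
  have "(\<integral>\<^sup>+x. g x \<partial>M) = (\<integral>\<^sup>+x. liminf (\<lambda>n. f n x) \<partial>M)"
    using lim by (intro nn_integral_cong_AE) (auto simp: lim_imp_Liminf)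
  also have "\<dots> \<le> liminf (\<lambda>n. \<integral>\<^sup>+x. f n x \<partial>M)" by (rule nn_integral_liminf) simp
  finally have 1: "(\<integral>\<^sup>+x. g x \<partial>M) \<le> liminf (\<lambda>n. \<integral>\<^sup>+x. f n x \<partial>M)" .
  have 2: "limsup (\<lambda>n. \<integral>\<^sup>+x. f n x \<partial>M) \<le> (\<integral>\<^sup>+x. g x \<partial>M)"
    by (intro Limsup_bounded always_eventually allI nn_integral_mono_AE le)
  have 3: "liminf (\<lambda>n. \<integral>\<^sup>+x. f n x \<partial>M) \<le> limsup (\<lambda>n. \<integral>\<^sup>+x. f n x \<partial>M)"
    by (rule Liminf_le_Limsup) simp
  show ?thesis
    using 1 2 3 by (subst tendsto_iff_Liminf_eq_Limsup) (auto intro: antisym)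
qed

lemma indicator_cells:
  assumes "t > 0"
  shows "(\<Sum>k<Suc n. indicator (cell t n k) s)
    = (indicator {0<..t} s :: 'b::{comm_monoid_add,zero_neq_one})"
proof -
  have "disjoint_family_on (\<lambda>k. cell t n k) {..<Suc n}"
    unfolding disjoint_family_on_def using cells_disjoint[of "t / real (Suc n)"] assms by simp
  from indicator_UN_disjoint[OF finite_lessThan this, of s] show ?thesis
    unfolding cells_Union[OF assms] by (rule sym)
qed

lemma exp_quotient_le:
  fixes x :: real
  shows "real (Suc m) * (1 - exp (- x / real (Suc m))) \<le> x"
proof -
  have "1 + (- x / real (Suc m)) \<le> exp (- x / real (Suc m))" by (rule exp_ge_add_one_self)
  then have "1 - exp (- x / real (Suc m)) \<le> x / real (Suc m)" by simp
  then have "real (Suc m) * (1 - exp (- x / real (Suc m))) \<le> real (Suc m) * (x / real (Suc m))"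
    by (intro mult_left_mono) auto
  then show ?thesis by simp
qed

lemma exp_quotient_tendsto:
  fixes x :: real
  shows "(\<lambda>m. real (Suc m) * (1 - exp (- x / real (Suc m)))) \<longlonglongrightarrow> x"
proof -
  have "((\<lambda>y. exp (- x * y)) has_real_derivative - x) (at 0)"
    by (auto intro!: derivative_eq_intros)
  then have "((\<lambda>y. (exp (- x * y) - 1) / y) \<longlongrightarrow> - x) (at 0)"
    by (simp add: has_field_derivative_iff)
  moreover have "filterlim (\<lambda>m. 1 / real (Suc m)) (at 0) sequentially"
    using mesh_limit[of 1] by (simp add: filterlim_at)
  ultimately have "(\<lambda>m. (exp (- x * (1 / real (Suc m))) - 1) / (1 / real (Suc m))) \<longlonglongrightarrow> - x"
    by (rule filterlim_compose)
  from tendsto_minus[OF this] show ?thesis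
    by (simp add: algebra_simps del: of_nat_Suc)
qed

locale levy_setting =
  fixes M :: "'a measure" and F :: "real \<Rightarrow> 'a measure" and L :: "real \<Rightarrow> 'a \<Rightarrow> real^'d"
  assumes usual: "usual_conditions M F" and levy: "levy_process M F L"
begin

sublocale prob_space M
  using usual unfolding usual_conditions_def by (rule conjunct1)

lemmas usual_parts = conjunct2[OF usual[unfolded usual_conditions_def]]

lemma subalg: "t \<ge> 0 \<Longrightarrow> subalgebra M (F t)"
  using conjunct1[OF usual_parts] by blast

lemma F_mono: "0 \<le> s \<Longrightarrow> s \<le> t \<Longrightarrow> sets (F s) \<subseteq> sets (F t)"
  using conjunct1[OF conjunct2[OF usual_parts]] by blast

lemma space_F: "t \<ge> 0 \<Longrightarrow> space (F t) = space M"
  using subalg by (simp add: subalgebra_def)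

lemma sets_F: "t \<ge> 0 \<Longrightarrow> A \<in> sets (F t) \<Longrightarrow> A \<in> sets M"
  using subalg by (auto simp: subalgebra_def)

lemma measurable_F_M: "t \<ge> 0 \<Longrightarrow> f \<in> measurable (F t) N \<Longrightarrow> f \<in> measurable M N"
  using measurable_from_subalg[OF subalg] by blast

lemma measurable_F_mono:
  assumes "0 \<le> s" "s \<le> t" "f \<in> measurable (F s) N"
  shows "f \<in> measurable (F t) N"
  by (rule measurable_from_subalg[OF _ assms(3)])
    (use assms F_mono[of s t] space_F[of s] space_F[of t] in \<open>auto simp: subalgebra_def\<close>)

lemma null_subset_sets: "N \<in> null_sets M \<Longrightarrow> S \<subseteq> N \<Longrightarrow> S \<in> sets M"
  using conjunct2[OF conjunct2[OF conjunct2[OF usual_parts]]] sets_F[of 0 S] by blast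

text \<open>Completeness, which is part of the usual conditions, makes jump sums and other path
  functionals measurable: they are known only as almost sure limits.\<close>

lemma measurable_AE_eq:
  assumes f: "f \<in> measurable M N" and eq: "AE x in M. f x = g x" and sp: "\<And>x. x \<in> space M \<Longrightarrow> g x \<in> space N"
  shows "g \<in> measurable M N"
proof (rule measurableI)
  fix A assume A: "A \<in> sets N"
  obtain E where E: "{x \<in> space M. \<not> f x = g x} \<subseteq> E" "E \<in> null_sets M"
    using eq by (auto elim!: AE_E intro: that)
  have "g -` A \<inter> space M = (f -` A \<inter> space M - E) \<union> (g -` A \<inter> space M \<inter> E)"
    using E(1) by auto
  also have "\<dots> \<in> sets M"
    using measurable_sets[OF f A] E(2) null_subset_sets[OF E(2), of "g -` A \<inter> space M \<inter> E"] by auto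
  finally show "g -` A \<inter> space M \<in> sets M" .
qed fact

lemma measurable_AE_lim:
  fixes f :: "nat \<Rightarrow> 'a \<Rightarrow> 'b::{banach, second_countable_topology}"
  assumes [measurable]: "\<And>n. f n \<in> borel_measurable M" and lim: "AE x in M. (\<lambda>n. f n x) \<longlonglongrightarrow> g x"
  shows "g \<in> borel_measurable M"
proof (rule measurable_AE_eq)
  show "(\<lambda>x. lim (\<lambda>n. f n x)) \<in> borel_measurable M" by measurable
  show "AE x in M. lim (\<lambda>n. f n x) = g x" using lim by (auto simp: limI)
qed simp

lemma L_measurable: "t \<ge> 0 \<Longrightarrow> L t \<in> borel_measurable (F t)"
  using levy by (simp add: levy_process_def adapted_def)

lemma L_measurable_M: "t \<ge> 0 \<Longrightarrow> L t \<in> borel_measurable M"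
  using L_measurable measurable_F_M by blast

lemma L_paths: "AE \<omega> in M. cadlag (\<lambda>t. L t \<omega>)" "AE \<omega> in M. L 0 \<omega> = 0"
  using levy by (auto simp: levy_process_def)

text \<open>Both families of events are stable under intersection, so independence passes to the
  generated sigma-algebras and from there to functions of the past and of the increment.\<close>

lemma indep_increment:
  fixes Z :: "'a \<Rightarrow> real" and w :: "real^'d \<Rightarrow> real"
  assumes s: "0 \<le> s" "s \<le> t" and Z: "Z \<in> borel_measurable (F s)" and w: "w \<in> borel_measurable borel"
  shows "indep_var borel Z borel (\<lambda>\<omega>. w (L t \<omega> - L s \<omega>))"
proof -
  let ?D = "\<lambda>\<omega>. L t \<omega> - L s \<omega>"
  let ?B = "{?D -` S \<inter> space M | S. S \<in> sets borel}"
  have D: "?D \<in> borel_measurable M" using s by (intro borel_measurable_diff L_measurable_M) auto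
  have ind: "indep_set (sets (F s)) ?B"
    using levy s by (simp add: levy_process_def)
  have ind': "indep_set (sigma_sets (space M) (sets (F s))) (sigma_sets (space M) ?B)"
  proof (rule indep_set_sigma_sets[OF ind])
    show "Int_stable (sets (F s))" by (rule sets.Int_stable)
    show "Int_stable ?B"
    proof (rule Int_stableI, clarify)
      fix S T :: "(real^'d) set" assume "S \<in> sets borel" "T \<in> sets borel"
      then show "\<exists>U. (?D -` S \<inter> space M) \<inter> (?D -` T \<inter> space M) = ?D -` U \<inter> space M \<and> U \<in> sets borel"
        by (intro exI[of _ "S \<inter> T"]) auto
    qed
  qed
  have sub: "sigma_sets (space M) {Z -` A \<inter> space M | A. A \<in> sets borel} \<subseteq> sigma_sets (space M) (sets (F s))"
    using measurable_sets[OF Z] space_F[OF s(1)] by (intro sigma_sets_mono') auto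
  have sub': "sigma_sets (space M) {(\<lambda>\<omega>. w (?D \<omega>)) -` A \<inter> space M | A. A \<in> sets borel} \<subseteq> sigma_sets (space M) ?B"
  proof (intro sigma_sets_mono', clarify)
    fix A :: "real set" assume A: "A \<in> sets borel"
    have "w -` A \<in> sets borel" using measurable_sets[OF w A] by simp
    then show "\<exists>S. (\<lambda>\<omega>. w (?D \<omega>)) -` A \<inter> space M = ?D -` S \<inter> space M \<and> S \<in> sets borel"
      by (intro exI[of _ "w -` A"]) auto
  qed
  have "indep_set (sigma_sets (space M) {Z -` A \<inter> space M | A. A \<in> sets borel})
      (sigma_sets (space M) {(\<lambda>\<omega>. w (?D \<omega>)) -` A \<inter> space M | A. A \<in> sets borel})"
    unfolding indep_set_def
    by (rule indep_sets_mono_sets[OF ind'[unfolded indep_set_def]]) (use sub sub' in \<open>simp split: bool.splits\<close>)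
  then show ?thesis
    using measurable_F_M[OF s(1) Z] measurable_compose[OF D w] by (simp add: indep_var_eq)
qed

lemma integral_increment:
  fixes Z :: "'a \<Rightarrow> real" and w :: "real^'d \<Rightarrow> real"
  assumes s: "0 \<le> s" "s \<le> t" and Z: "Z \<in> borel_measurable (F s)" "\<And>\<omega>. \<bar>Z \<omega>\<bar> \<le> 1"
    and w: "w \<in> borel_measurable borel" "\<And>x. \<bar>w x\<bar> \<le> 1"
  shows "(LINT \<omega>|M. Z \<omega> * w (L t \<omega> - L s \<omega>)) = (LINT \<omega>|M. Z \<omega>) * (LINT \<omega>|M. w (L (t - s) \<omega>))"
proof -
  have D: "(\<lambda>\<omega>. L t \<omega> - L s \<omega>) \<in> borel_measurable M" using s by (intro borel_measurable_diff L_measurable_M) auto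
  have "indep_var borel Z borel (\<lambda>\<omega>. w (L t \<omega> - L s \<omega>))"
    by (rule indep_increment[OF s Z(1) w(1)])
  moreover have "integrable M Z"
    using Z measurable_F_M[OF s(1) Z(1)] by (intro integrable_const_bound[of _ 1]) auto
  moreover have "integrable M (\<lambda>\<omega>. w (L t \<omega> - L s \<omega>))"
    using w D by (intro integrable_const_bound[of _ 1]) auto
  ultimately have "(LINT \<omega>|M. Z \<omega> * w (L t \<omega> - L s \<omega>)) = (LINT \<omega>|M. Z \<omega>) * (LINT \<omega>|M. w (L t \<omega> - L s \<omega>))"
    by (rule indep_var_lebesgue_integral)
  also have "(LINT \<omega>|M. w (L t \<omega> - L s \<omega>)) = (LINT x|distr M borel (\<lambda>\<omega>. L t \<omega> - L s \<omega>). w x)"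
    using w D by (subst integral_distr) auto
  also have "distr M borel (\<lambda>\<omega>. L t \<omega> - L s \<omega>) = distr M borel (L (t - s))"
  proof -
    have "\<forall>s\<ge>0. \<forall>h\<ge>0. distr M borel (\<lambda>\<omega>. L (s + h) \<omega> - L s \<omega>) = distr M borel (L h)"
      using levy by (simp add: levy_process_def)
    from this[rule_format, of s "t - s"] show ?thesis using s by simp
  qed
  also have "(LINT x|distr M borel (L (t - s)). w x) = (LINT \<omega>|M. w (L (t - s) \<omega>))"
    using w s L_measurable_M[of "t - s"] by (subst integral_distr) auto
  finally show ?thesis .
qed

section \<open>Laplace transforms of sums over increments and over jumps\<close>

definition increment_sum :: "(real^'d \<Rightarrow> real) \<Rightarrow> real \<Rightarrow> real \<Rightarrow> nat \<Rightarrow> 'a \<Rightarrow> real"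
  where "increment_sum g s h m \<omega> = (\<Sum>k<m. g (L (s + real (Suc k) * h) \<omega> - L (s + real k * h) \<omega>))"

lemma increment_sum_measurable:
  assumes "0 \<le> s" "0 \<le> h" and [measurable]: "g \<in> borel_measurable borel"
  shows "increment_sum g s h m \<in> borel_measurable (F (s + real m * h))"
proof -
  have "(\<lambda>\<omega>. g (L (s + real (Suc k) * h) \<omega> - L (s + real k * h) \<omega>)) \<in> borel_measurable (F (s + real m * h))"
    if "k < m" for k
  proof -
    have "real (Suc k) * h \<le> real m * h" "real k * h \<le> real m * h"
      using that assms by (auto intro!: mult_right_mono)
    then have [measurable]: "L (s + real (Suc k) * h) \<in> borel_measurable (F (s + real m * h))"
      "L (s + real k * h) \<in> borel_measurable (F (s + real m * h))"
      using assms by (auto intro!: measurable_F_mono[OF _ _ L_measurable] simp del: of_nat_Suc)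
    show ?thesis by measurable
  qed
  then show ?thesis unfolding increment_sum_def[abs_def] by (intro borel_measurable_sum) auto
qed

text \<open>The last increment is independent of the past up to its left end point and distributed
  like \<open>L h\<close>, so each induction step splits off one factor. Apart from
  \<open>prob A\<close>, nothing on the right depends on \<open>s\<close>.\<close>

lemma Laplace_increment_sum:
  assumes s: "0 \<le> s" and h: "0 \<le> h" and g: "g \<in> borel_measurable borel" "\<And>x. g x \<ge> 0"
    and l: "l \<ge> 0" and A: "A \<in> sets (F s)"
  shows "(LINT \<omega>|M. indicator A \<omega> * exp (- l * increment_sum g s h m \<omega>)) =
    prob A * (LINT \<omega>|M. exp (- l * g (L h \<omega>))) ^ m"
proof (induction m)
  case 0
  then show ?case using sets_F[OF s A] by (simp add: increment_sum_def)
next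
  case (Suc m)
  let ?t = "s + real m * h" and ?u = "s + real (Suc m) * h"
  let ?Z = "\<lambda>\<omega>. indicator A \<omega> * exp (- l * increment_sum g s h m \<omega>)"
  let ?w = "\<lambda>x. exp (- l * g x)"
  have t: "0 \<le> ?t" "?t \<le> ?u" "s \<le> ?t" using s h by (auto simp: algebra_simps)
  have "A \<in> sets (F ?t)" using F_mono[OF s t(3)] A by auto
  then have Z: "?Z \<in> borel_measurable (F ?t)"
    using increment_sum_measurable[OF s h g(1), of m] by measurable
  have nn: "0 \<le> increment_sum g s h m \<omega>" for \<omega>
    unfolding increment_sum_def by (intro sum_nonneg g)
  have "(LINT \<omega>|M. indicator A \<omega> * exp (- l * increment_sum g s h (Suc m) \<omega>)) =
      (LINT \<omega>|M. ?Z \<omega> * ?w (L ?u \<omega> - L ?t \<omega>))"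
    by (intro Bochner_Integration.integral_cong refl)
      (simp add: increment_sum_def exp_add[symmetric] algebra_simps)
  also have "\<dots> = (LINT \<omega>|M. ?Z \<omega>) * (LINT \<omega>|M. ?w (L (?u - ?t) \<omega>))"
    by (rule integral_increment[OF t(1,2) Z]) (use g l nn in \<open>auto simp: indicator_def\<close>)
  also have "?u - ?t = h" by (simp add: algebra_simps)
  finally show ?case using Suc by simp
qed

text \<open>Extended nonnegative values allow divergent sums, so that finiteness can be derived
  afterwards from expectations.\<close>

definition jump_sum :: "(real^'d \<Rightarrow> ennreal) \<Rightarrow> real \<Rightarrow> real \<Rightarrow> 'a \<Rightarrow> ennreal"
  where "jump_sum f s u \<omega> = (\<integral>\<^sup>+r\<in>{s<..s + u}. f (jump (\<lambda>t. L t \<omega>) r) \<partial>count_space UNIV)"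

abbreviation jump_sum_real :: "(real^'d \<Rightarrow> real) \<Rightarrow> real \<Rightarrow> real \<Rightarrow> 'a \<Rightarrow> ennreal"
  where "jump_sum_real g \<equiv> jump_sum (\<lambda>x. ennreal (g x))"

text \<open>Because \<open>g\<close> vanishes near 0, only the finitely many jumps in
  \<open>D\<close> contribute, and the sum over all times is a finite real sum. The path is shifted
  by \<open>s\<close> to bring the window to (0, u].\<close>

lemma jump_sum_limit:
  assumes s: "0 \<le> s" and u: "0 < u" and e: "e > 0"
    and g: "continuous_on UNIV g" "\<And>x. norm x \<le> e \<Longrightarrow> g x = 0" "\<And>x. g x \<ge> 0"
    and c: "cadlag (\<lambda>t. L t \<omega>)"
  shows "(\<lambda>n. increment_sum g s (u / real (Suc n)) (Suc n) \<omega>) \<longlonglongrightarrow> enn2real (jump_sum_real g s u \<omega>)"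
    and "jump_sum_real g s u \<omega> < \<infinity>"
proof -
  let ?f = "\<lambda>t. L t \<omega>" and ?f' = "\<lambda>t. L (s + t) \<omega>"
  have jump: "jump ?f' r = jump ?f (s + r)" if "r > 0" for r
    using left_lim_shift[OF c s that] by (simp add: jump_def)
  obtain D where D: "finite D" "D \<subseteq> {0<..u}" "\<forall>r\<in>{0<..u} - D. g (jump ?f' r) = 0"
    "(\<lambda>n. \<Sum>k<Suc n. g (?f' (grid u n (Suc k)) - ?f' (grid u n k)))
      \<longlonglongrightarrow> (\<Sum>r\<in>D. g (jump ?f' r))"
    by (rule sum_increments_tendsto_jumps[OF cadlag_shift[OF c s] u e g(1,2)])
  have z: "g (jump ?f r) = 0" if "r \<in> {s<..s + u}" "r \<notin> (+) s ` D" for r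
  proof -
    have "r - s \<in> {0<..u} - D" using that by force
    from D(3)[rule_format, OF this] jump[of "r - s"] that show ?thesis by simp
  qed
  have "jump_sum_real g s u \<omega> =
      (\<Sum>r\<in>(+) s ` D. ennreal (g (jump ?f r)) * indicator {s<..s + u} r)"
    unfolding jump_sum_def using D z
    by (intro nn_integral_count_space') (auto simp: indicator_def)
  also have "\<dots> = (\<Sum>r\<in>D. ennreal (g (jump ?f (s + r))))"
    using D(2) by (subst sum.reindex) (auto simp: subset_eq intro!: sum.cong)
  also have "\<dots> = (\<Sum>r\<in>D. ennreal (g (jump ?f' r)))"
    using D(2) jump by (intro sum.cong) auto
  also have "\<dots> = ennreal (\<Sum>r\<in>D. g (jump ?f' r))" by (rule sum_ennreal) (simp add: g)
  finally have J: "jump_sum_real g s u \<omega> = ennreal (\<Sum>r\<in>D. g (jump ?f' r))" .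
  then show "jump_sum_real g s u \<omega> < \<infinity>" by simp
  show "(\<lambda>n. increment_sum g s (u / real (Suc n)) (Suc n) \<omega>) \<longlonglongrightarrow> enn2real (jump_sum_real g s u \<omega>)"
    using D(4) unfolding J by (simp add: increment_sum_def sum_nonneg g(3) del: of_nat_Suc sum.lessThan_Suc)
qed

context
  fixes g :: "real^'d \<Rightarrow> real" and e :: real
  assumes e: "e > 0" and g: "continuous_on UNIV g" "\<And>x. norm x \<le> e \<Longrightarrow> g x = 0" "\<And>x. g x \<ge> 0"
begin

private abbreviation "J s u \<omega> \<equiv> enn2real (jump_sum_real g s u \<omega>)"

private lemma g_measurable [measurable]: "g \<in> borel_measurable borel"
  using borel_measurable_continuous_onI[OF g(1)] .

private lemma increment_sum_M [measurable]:
  "0 \<le> s \<Longrightarrow> 0 \<le> h \<Longrightarrow> increment_sum g s h m \<in> borel_measurable M"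
  using measurable_F_M[OF _ increment_sum_measurable[of s h g m]] by simp

private lemma AE_J_lim:
  "0 \<le> s \<Longrightarrow> 0 < u \<Longrightarrow> AE \<omega> in M. (\<lambda>n. increment_sum g s (u / real (Suc n)) (Suc n) \<omega>) \<longlonglongrightarrow> J s u \<omega>"
  using L_paths(1) by eventually_elim (rule jump_sum_limit(1)[OF _ _ e g])

private lemma J_measurable: "0 \<le> s \<Longrightarrow> 0 < u \<Longrightarrow> J s u \<in> borel_measurable M"
  by (rule measurable_AE_lim[OF _ AE_J_lim]) auto

private lemma AE_J: "0 \<le> s \<Longrightarrow> 0 < u \<Longrightarrow> AE \<omega> in M. jump_sum_real g s u \<omega> = ennreal (J s u \<omega>)"
  using L_paths(1) by eventually_elim (use jump_sum_limit(2)[OF _ _ e g] in auto)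

private lemma jump_sum_measurable0:
  "0 \<le> s \<Longrightarrow> 0 < u \<Longrightarrow> jump_sum_real g s u \<in> borel_measurable M"
  by (rule measurable_AE_eq[of "\<lambda>\<omega>. ennreal (J s u \<omega>)"]) (use J_measurable[of s u] AE_J[of s u] in auto)

text \<open>The numbers \<open>?c n\<close> depend neither on \<open>s\<close> nor on
  \<open>A\<close>; the choice s = 0 with the whole space identifies their limit.\<close>

private lemma Laplace_jump_sum:
  assumes s: "0 \<le> s" and u: "0 < u" and l: "l \<ge> 0" and A: "A \<in> sets (F s)"
  shows "(LINT \<omega>|M. indicator A \<omega> * exp (- l * J s u \<omega>)) = prob A * (LINT \<omega>|M. exp (- l * J 0 u \<omega>))"
proof -
  let ?c = "\<lambda>n. (LINT \<omega>|M. exp (- l * g (L (u / real (Suc n)) \<omega>))) ^ Suc n"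
  have *: "(\<lambda>n. prob A * ?c n) \<longlonglongrightarrow> (LINT \<omega>|M. indicator A \<omega> * exp (- l * J s u \<omega>))"
    if s: "0 \<le> s" and A: "A \<in> sets (F s)" for s A
  proof -
    have [measurable]: "A \<in> sets M" using sets_F[OF s A] .
    note [measurable] = J_measurable[OF s u]
    have nn: "0 \<le> increment_sum g s h m \<omega>" for h m \<omega>
      unfolding increment_sum_def by (intro sum_nonneg g)
    have "(\<lambda>n. LINT \<omega>|M. indicator A \<omega> * exp (- l * increment_sum g s (u / real (Suc n)) (Suc n) \<omega>))
        \<longlonglongrightarrow> (LINT \<omega>|M. indicator A \<omega> * exp (- l * J s u \<omega>))"
    proof (rule integral_dominated_convergence[where w = "\<lambda>_. 1"])
      show "AE \<omega> in M. (\<lambda>n. indicator A \<omega> * exp (- l * increment_sum g s (u / real (Suc n)) (Suc n) \<omega>))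
          \<longlonglongrightarrow> indicator A \<omega> * exp (- l * J s u \<omega>)"
        using AE_J_lim[OF s u] by eventually_elim (intro tendsto_intros)
      show "AE \<omega> in M. norm (indicator A \<omega> * exp (- l * increment_sum g s (u / real (Suc n)) (Suc n) \<omega>)) \<le> 1" for n
        using l nn by (auto simp: indicator_def)
    qed (use s u in auto)
    then show ?thesis
      using u by (subst (asm) Laplace_increment_sum[OF s _ _ g(3) l A]) auto
  qed
  have top: "space M \<in> sets (F 0)" using sets.top[of "F 0"] space_F[of 0] by simp
  have "(LINT \<omega>|M. indicator (space M) \<omega> * exp (- l * J 0 u \<omega>)) = (LINT \<omega>|M. exp (- l * J 0 u \<omega>))"
    by (intro Bochner_Integration.integral_cong) auto
  then have "(\<lambda>n. ?c n) \<longlonglongrightarrow> (LINT \<omega>|M. exp (- l * J 0 u \<omega>))"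
    using *[OF _ top] by (simp add: prob_space)
  then have "(\<lambda>n. prob A * ?c n) \<longlonglongrightarrow> prob A * (LINT \<omega>|M. exp (- l * J 0 u \<omega>))"
    by (rule tendsto_mult_left)
  with *[OF s A] show ?thesis by (rule LIMSEQ_unique)
qed

text \<open>\<open>m (1 - exp (- x / m))\<close> increases to \<open>x\<close>, so that Laplace transforms determine expectations.\<close>

private lemma nn_integral_jump_sum0:
  assumes s: "0 \<le> s" and u: "0 < u" and A: "A \<in> sets (F s)"
  shows "(\<integral>\<^sup>+\<omega>. indicator A \<omega> * jump_sum_real g s u \<omega> \<partial>M) =
    emeasure M A * (\<integral>\<^sup>+\<omega>. jump_sum_real g 0 u \<omega> \<partial>M)"
proof -
  let ?T = "\<lambda>m x. real (Suc m) * (1 - exp (- x / real (Suc m)))"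
  have T_nn: "?T m x \<ge> 0" if "x \<ge> 0" for m x using that by simp
  note [measurable] = J_measurable[OF _ u, of 0, simplified]
  have *: "(\<lambda>m. ennreal (prob A * (LINT \<omega>|M. ?T m (J 0 u \<omega>)))) \<longlonglongrightarrow> (\<integral>\<^sup>+\<omega>. indicator A \<omega> * jump_sum_real g s u \<omega> \<partial>M)"
    if s: "0 \<le> s" and A: "A \<in> sets (F s)" for s A
  proof -
    have [measurable]: "A \<in> sets M" using sets_F[OF s A] .
    note [measurable] = J_measurable[OF s u]
    have "(\<lambda>m. \<integral>\<^sup>+\<omega>. ennreal (indicator A \<omega> * ?T m (J s u \<omega>)) \<partial>M) \<longlonglongrightarrow> (\<integral>\<^sup>+\<omega>. ennreal (indicator A \<omega> * J s u \<omega>) \<partial>M)"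
    proof (rule nn_integral_tendsto_below)
      show "AE x in M. ennreal (indicat_real A x * ?T m (J s u x)) \<le> ennreal (indicat_real A x * J s u x)" for m
        by (intro AE_I2 ennreal_leI mult_left_mono exp_quotient_le) auto
      show "AE x in M. (\<lambda>m. ennreal (indicat_real A x * ?T m (J s u x))) \<longlonglongrightarrow> ennreal (indicat_real A x * J s u x)"
        by (intro AE_I2 tendsto_ennrealI tendsto_mult_left exp_quotient_tendsto)
    qed measurable
    also have "(\<integral>\<^sup>+\<omega>. ennreal (indicator A \<omega> * J s u \<omega>) \<partial>M) = (\<integral>\<^sup>+\<omega>. indicator A \<omega> * jump_sum_real g s u \<omega> \<partial>M)"
      using AE_J[OF s u] by (intro nn_integral_cong_AE) (auto simp: indicator_def)
    also have "(\<lambda>m. \<integral>\<^sup>+\<omega>. ennreal (indicator A \<omega> * ?T m (J s u \<omega>)) \<partial>M) = (\<lambda>m. ennreal (prob A * (LINT \<omega>|M. ?T m (J 0 u \<omega>))))"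
    proof
      fix m
      let ?l = "1 / real (Suc m)"
      have "(\<integral>\<^sup>+\<omega>. ennreal (indicator A \<omega> * ?T m (J s u \<omega>)) \<partial>M) = ennreal (LINT \<omega>|M. indicator A \<omega> * ?T m (J s u \<omega>))"
      proof (intro nn_integral_eq_integral AE_I2)
        show "integrable M (\<lambda>\<omega>. indicator A \<omega> * ?T m (J s u \<omega>))"
          by (intro integrable_const_bound[of _ "real (Suc m)"]) (auto simp: indicator_def abs_mult intro!: AE_I2)
      qed (use T_nn in \<open>auto simp: indicator_def\<close>)
      also have "(LINT \<omega>|M. indicator A \<omega> * ?T m (J s u \<omega>)) =
          (LINT \<omega>|M. real (Suc m) * (indicator A \<omega> - indicator A \<omega> * exp (- ?l * J s u \<omega>)))"
        by (intro Bochner_Integration.integral_cong) (auto simp: algebra_simps)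
      also have "\<dots> = real (Suc m) * (prob A - (LINT \<omega>|M. indicator A \<omega> * exp (- ?l * J s u \<omega>)))"
      proof -
        have "integrable M (\<lambda>\<omega>. indicator A \<omega> * exp (- ?l * J s u \<omega>))"
          by (intro integrable_const_bound[of _ 1]) (auto simp: indicator_def)
        moreover have "integrable M (indicat_real A)"
          by (intro integrable_const_bound[of _ 1]) (auto simp: indicator_def)
        ultimately show ?thesis
          by (subst integral_mult_right_zero, subst Bochner_Integration.integral_diff) auto
      qed
      also have "\<dots> = prob A * (real (Suc m) * (1 - (LINT \<omega>|M. exp (- ?l * J 0 u \<omega>))))"
        using Laplace_jump_sum[OF s u _ A, of ?l] by (simp add: algebra_simps)
      also have "real (Suc m) * (1 - (LINT \<omega>|M. exp (- ?l * J 0 u \<omega>))) = (LINT \<omega>|M. ?T m (J 0 u \<omega>))"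
      proof -
        have "integrable M (\<lambda>\<omega>. exp (- ?l * J 0 u \<omega>))"
          by (intro integrable_const_bound[of _ 1]) auto
        then have "(LINT \<omega>|M. real (Suc m) * (1 - exp (- ?l * J 0 u \<omega>))) = real (Suc m) * (1 - (LINT \<omega>|M. exp (- ?l * J 0 u \<omega>)))"
          by (subst integral_mult_right_zero, subst Bochner_Integration.integral_diff) (auto simp: prob_space)
        then show ?thesis by (simp add: mult.commute)
      qed
      finally show "(\<integral>\<^sup>+\<omega>. ennreal (indicator A \<omega> * ?T m (J s u \<omega>)) \<partial>M) = ennreal (prob A * (LINT \<omega>|M. ?T m (J 0 u \<omega>)))" .
    qed
    finally show ?thesis .
  qed
  have top: "space M \<in> sets (F 0)" using sets.top[of "F 0"] space_F[of 0] by simp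
  have "(\<integral>\<^sup>+\<omega>. indicator (space M) \<omega> * jump_sum_real g 0 u \<omega> \<partial>M) = (\<integral>\<^sup>+\<omega>. jump_sum_real g 0 u \<omega> \<partial>M)"
    by (intro nn_integral_cong) auto
  then have "(\<lambda>m. ennreal (LINT \<omega>|M. ?T m (J 0 u \<omega>))) \<longlonglongrightarrow> (\<integral>\<^sup>+\<omega>. jump_sum_real g 0 u \<omega> \<partial>M)"
    using *[OF _ top] by (simp add: prob_space)
  then have "(\<lambda>m. ennreal (prob A) * ennreal (LINT \<omega>|M. ?T m (J 0 u \<omega>))) \<longlonglongrightarrow>
      ennreal (prob A) * (\<integral>\<^sup>+\<omega>. jump_sum_real g 0 u \<omega> \<partial>M)"
    by (intro ennreal_tendsto_cmult) auto
  moreover have "(\<lambda>m. ennreal (prob A) * ennreal (LINT \<omega>|M. ?T m (J 0 u \<omega>))) = (\<lambda>m. ennreal (prob A * (LINT \<omega>|M. ?T m (J 0 u \<omega>))))"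
    by (rule ext) (intro ennreal_mult[symmetric] integral_nonneg_AE AE_I2 T_nn, auto)
  ultimately show ?thesis
    using LIMSEQ_unique[OF *[OF s A]] by (simp add: emeasure_eq_measure)
qed

lemmas jump_sum_vanishing = jump_sum_measurable0 nn_integral_jump_sum0

end

end

section \<open>Expected jump sums and the Levy measure\<close>

text \<open>For y > 0 the sum is the largest multiple of 1 / (n + 1) strictly below
  \<open>y\<close>, capped at \<open>N\<close> steps; hence \<open>c\<close> is a ceiling minus one.
  The strict inequality makes the level sets of a continuous function open.\<close>

lemma layer_sum_bounds:
  fixes y :: real
  assumes "y \<ge> 0"
  shows "(\<Sum>j=1..N. 1 / real (Suc n) * indicator {real j / real (Suc n)<..} y) \<le> y"
    and "y * real (Suc n) \<le> real N \<Longrightarrow> y - 1 / real (Suc n) \<le> (\<Sum>j=1..N. 1 / real (Suc n) * indicator {real j / real (Suc n)<..} y)"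
proof -
  define k where "k = real (Suc n)"
  have k: "k > 0" by (simp add: k_def)
  define c where "c = nat (\<lceil>y * k\<rceil> - 1)"
  have "{j \<in> {1..N}. real j / k < y} = {1..min N c}"
  proof (intro set_eqI)
    fix j
    have "real j / k < y \<longleftrightarrow> of_int (int j) < y * k" using k by (simp add: field_simps)
    also have "\<dots> \<longleftrightarrow> int j < \<lceil>y * k\<rceil>" by (simp add: less_ceiling_iff)
    finally show "j \<in> {j \<in> {1..N}. real j / k < y} \<longleftrightarrow> j \<in> {1..min N c}" by (auto simp: c_def)
  qed
  moreover have "(\<Sum>j=1..N. 1 / k * indicator {real j / k<..} y) = (\<Sum>j\<in>{j \<in> {1..N}. real j / k < y}. 1 / k)"
    by (subst sum.inter_filter) (auto intro!: sum.cong)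
  ultimately have eq: "(\<Sum>j=1..N. 1 / k * indicator {real j / k<..} y) = real (min N c) / k"
    by simp
  have yk: "0 \<le> y * k" using k assms by simp
  have "real c \<le> y * k" using yk unfolding c_def by linarith
  then have "real (min N c) \<le> y * k" by linarith
  then show "(\<Sum>j=1..N. 1 / real (Suc n) * indicator {real j / real (Suc n)<..} y) \<le> y"
    using eq k unfolding k_def[symmetric] by (simp add: pos_divide_le_eq)
  show "y - 1 / real (Suc n) \<le> (\<Sum>j=1..N. 1 / real (Suc n) * indicator {real j / real (Suc n)<..} y)"
    if "y * real (Suc n) \<le> real N"
  proof -
    have "y * k - 1 \<le> real c" unfolding c_def by linarith
    then have "y * k - 1 \<le> real (min N c)" using that unfolding k_def[symmetric] by linarith
    then have "(y * k - 1) / k \<le> real (min N c) / k" using k by (intro divide_right_mono) auto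
    then show ?thesis using eq k unfolding k_def[symmetric] by (simp add: diff_divide_distrib)
  qed
qed

text \<open>With \<open>Suc n * Suc n\<close> levels of width 1 / (n + 1) the cap is the height n +
  1, which eventually exceeds \<open>y\<close>.\<close>

lemma layer_sum_tendsto:
  fixes y :: real
  assumes "y \<ge> 0"
  shows "(\<lambda>n. \<Sum>j=1..Suc n * Suc n. 1 / real (Suc n) * indicator {real j / real (Suc n)<..} y) \<longlonglongrightarrow> y"
proof (rule tendsto_sandwich[of "\<lambda>n. y - 1 / real (Suc n)" _ _ "\<lambda>_. y"])
  obtain m where m: "y \<le> real m" using real_arch_simple by blast
  show "\<forall>\<^sub>F n in sequentially. y - 1 / real (Suc n) \<le> (\<Sum>j=1..Suc n * Suc n. 1 / real (Suc n) * indicator {real j / real (Suc n)<..} y)"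
    using eventually_ge_at_top[of m]
  proof (rule eventually_mono)
    fix n assume "m \<le> n"
    then have "y \<le> real (Suc n)" using m by simp
    then have "y * real (Suc n) \<le> real (Suc n) * real (Suc n)" by (intro mult_right_mono) auto
    then show "y - 1 / real (Suc n) \<le> (\<Sum>j=1..Suc n * Suc n. 1 / real (Suc n) * indicator {real j / real (Suc n)<..} y)"
      by (intro layer_sum_bounds(2)[OF assms]) (simp only: of_nat_mult)
  qed
  show "\<forall>\<^sub>F n in sequentially. (\<Sum>j=1..Suc n * Suc n. 1 / real (Suc n) * indicator {real j / real (Suc n)<..} y) \<le> y"
    by (intro always_eventually allI layer_sum_bounds(1) assms)
  show "(\<lambda>n. y - 1 / real (Suc n)) \<longlonglongrightarrow> y"
    using tendsto_diff[OF tendsto_const mesh_limit[of 1], of y] by simp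
qed simp

context levy_setting
begin

lemma measurable_AE_lim_ennreal:
  fixes f :: "nat \<Rightarrow> 'a \<Rightarrow> ennreal"
  assumes [measurable]: "\<And>n. f n \<in> borel_measurable M" and lim: "AE x in M. (\<lambda>n. f n x) \<longlonglongrightarrow> g x"
  shows "g \<in> borel_measurable M"
proof (rule measurable_AE_eq)
  show "(\<lambda>x. liminf (\<lambda>n. f n x)) \<in> borel_measurable M" by measurable
  show "AE x in M. liminf (\<lambda>n. f n x) = g x" using lim by (auto simp: lim_imp_Liminf)
qed simp

lemma jump_sum_mono: "(\<And>x. f x \<le> g x) \<Longrightarrow> jump_sum f s u \<omega> \<le> jump_sum g s u \<omega>"
  unfolding jump_sum_def by (intro nn_integral_mono mult_right_mono) auto

lemma jump_sum_tendsto: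
  assumes "\<And>n x. f n x \<le> g x" "\<And>x. (\<lambda>n. f n x) \<longlonglongrightarrow> g x"
  shows "(\<lambda>n. jump_sum (f n) s u \<omega>) \<longlonglongrightarrow> jump_sum g s u \<omega>"
  unfolding jump_sum_def
  by (intro nn_integral_tendsto_below AE_I2 mult_right_mono)
    (auto simp: assms indicator_def split: if_splits)

lemma jump_sum_sum:
  "finite I \<Longrightarrow> jump_sum (\<lambda>x. \<Sum>i\<in>I. c i * f i x) s u \<omega> = (\<Sum>i\<in>I. c i * jump_sum (f i) s u \<omega>)"
  unfolding jump_sum_def
  by (simp add: sum_distrib_right nn_integral_sum nn_integral_cmult mult.assoc)

lemma jump_sum_cells:
  assumes "u > 0"
  shows "(\<Sum>k<Suc n. jump_sum f (grid u n k) (u / real (Suc n)) \<omega>) = jump_sum f 0 u \<omega>"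
proof -
  have eq: "grid u n k + u / real (Suc n) = grid u n (Suc k)" for k
    by (simp add: algebra_simps add_divide_distrib)
  have "(\<Sum>k<Suc n. jump_sum f (grid u n k) (u / real (Suc n)) \<omega>) =
    (\<integral>\<^sup>+r. (\<Sum>k<Suc n. f (jump (\<lambda>t. L t \<omega>) r) *
       indicator (cell u n k) r) \<partial>count_space UNIV)"
    unfolding jump_sum_def eq by (subst nn_integral_sum) auto
  also have "\<dots> = jump_sum f 0 u \<omega>"
    unfolding jump_sum_def sum_distrib_left[symmetric] indicator_cells[OF assms] by simp
  finally show ?thesis .
qed

text \<open>Continuity is used for limits along partitions. The value 0 at the origin makes times
  without a jump contribute nothing, and makes small truncations vanish near the origin.\<close>

definition jump_function :: "(real^'d \<Rightarrow> real) \<Rightarrow> bool"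
  where "jump_function g \<longleftrightarrow> continuous_on UNIV g \<and> (\<forall>x. g x \<ge> 0) \<and> g 0 = 0"

text \<open>Lowering \<open>g\<close> by 1 / (m + 1) and cutting at 0 removes a neighbourhood of the
  origin, by continuity there. Results for functions vanishing near 0 thus extend by passage to the
  limit from below.\<close>

lemma jump_function_truncation:
  assumes g: "jump_function g"
  defines "f \<equiv> \<lambda>m x. max 0 (g x - 1 / real (Suc m))"
  shows "\<exists>e>0. \<forall>x. norm x \<le> e \<longrightarrow> f m x = 0" "continuous_on UNIV (f m)" "f m x \<ge> 0"
    "f m x \<le> g x" "(\<lambda>m. f m x) \<longlonglongrightarrow> g x"
proof -
  have c: "continuous_on UNIV g" and nn: "\<And>x. g x \<ge> 0" and z: "g 0 = 0"
    using g by (auto simp: jump_function_def)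
  have "1 / real (Suc m) > 0" by simp
  then obtain d where d: "d > 0" "\<And>x. dist x 0 < d \<Longrightarrow> dist (g x) (g 0) < 1 / real (Suc m)"
    using c unfolding continuous_on_iff by (metis UNIV_I)
  have "f m x = 0" if "norm x \<le> d / 2" for x
    using d(2)[of x] d(1) nn[of x] that by (simp add: z f_def dist_real_def del: of_nat_Suc)
  then show "\<exists>e>0. \<forall>x. norm x \<le> e \<longrightarrow> f m x = 0" using d(1) by (intro exI[of _ "d / 2"]) auto
  show "continuous_on UNIV (f m)" unfolding f_def by (intro continuous_intros c)
  show "f m x \<ge> 0" "f m x \<le> g x" using nn by (auto simp: f_def)
  have "(\<lambda>m. max 0 (g x - 1 / real (Suc m))) \<longlonglongrightarrow> max 0 (g x - 0)"
    by (intro tendsto_max tendsto_diff tendsto_const mesh_limit)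
  then show "(\<lambda>m. f m x) \<longlonglongrightarrow> g x" using nn[of x] by (simp add: f_def)
qed

lemma
  assumes g: "jump_function g" and s: "0 \<le> s" and u: "0 < u"
  shows jump_sum_measurable: "jump_sum_real g s u \<in> borel_measurable M"
    and nn_integral_indicator_jump_sum: "A \<in> sets (F s) \<Longrightarrow>
      (\<integral>\<^sup>+\<omega>. indicator A \<omega> * jump_sum_real g s u \<omega> \<partial>M) =
      emeasure M A * (\<integral>\<^sup>+\<omega>. jump_sum_real g 0 u \<omega> \<partial>M)"
proof -
  define f where "f m x = max 0 (g x - 1 / real (Suc m))" for m x
  note f = jump_function_truncation[OF g, folded f_def]
  have lim: "(\<lambda>m. jump_sum_real (f m) s u \<omega>) \<longlonglongrightarrow> jump_sum_real g s u \<omega>" for s \<omega>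
    by (rule jump_sum_tendsto) (auto intro!: ennreal_leI tendsto_ennrealI f(4,5))
  have meas_m [measurable]: "jump_sum_real (f m) s u \<in> borel_measurable M" if "0 \<le> s" for m s
  proof -
    obtain e where e: "e > 0" "\<And>x. norm x \<le> e \<Longrightarrow> f m x = 0" using f(1) by blast
    show ?thesis by (rule jump_sum_vanishing(1)[OF e(1) f(2) e(2) f(3) that u])
  qed
  have meas: "jump_sum_real g s u \<in> borel_measurable M" if "0 \<le> s" for s
    by (rule measurable_AE_lim_ennreal[OF meas_m[OF that]]) (auto intro!: lim)
  show "jump_sum_real g s u \<in> borel_measurable M" by (rule meas[OF s])
  note [measurable] = meas[OF s] meas[of 0, simplified] meas_m[OF s] meas_m[of 0, simplified]
  assume A: "A \<in> sets (F s)"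
  have [measurable]: "A \<in> sets M" using sets_F[OF s A] .
  have "(\<lambda>m. \<integral>\<^sup>+\<omega>. indicator A \<omega> * jump_sum_real (f m) s u \<omega> \<partial>M) \<longlonglongrightarrow>
      (\<integral>\<^sup>+\<omega>. indicator A \<omega> * jump_sum_real g s u \<omega> \<partial>M)"
  proof (rule nn_integral_tendsto_below)
    show "AE \<omega> in M. indicator A \<omega> * jump_sum_real (f n) s u \<omega> \<le> indicator A \<omega> * jump_sum_real g s u \<omega>" for n
      by (intro AE_I2 mult_left_mono jump_sum_mono ennreal_leI f(4)) auto
    show "AE \<omega> in M. (\<lambda>n. indicator A \<omega> * jump_sum_real (f n) s u \<omega>) \<longlonglongrightarrow> indicator A \<omega> * jump_sum_real g s u \<omega>"
      using lim by (intro AE_I2) (auto simp: indicator_def)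
  qed measurable
  moreover have "(\<integral>\<^sup>+\<omega>. indicator A \<omega> * jump_sum_real (f m) s u \<omega> \<partial>M) =
      emeasure M A * (\<integral>\<^sup>+\<omega>. jump_sum_real (f m) 0 u \<omega> \<partial>M)" for m
  proof -
    obtain e where e: "e > 0" "\<And>x. norm x \<le> e \<Longrightarrow> f m x = 0" using f(1) by blast
    show ?thesis by (rule jump_sum_vanishing(2)[OF e(1) f(2) e(2) f(3) s u A])
  qed
  moreover have "(\<lambda>m. emeasure M A * (\<integral>\<^sup>+\<omega>. jump_sum_real (f m) 0 u \<omega> \<partial>M)) \<longlonglongrightarrow>
      emeasure M A * (\<integral>\<^sup>+\<omega>. jump_sum_real g 0 u \<omega> \<partial>M)"
    by (intro ennreal_tendsto_cmult nn_integral_tendsto_below AE_I2 jump_sum_mono ennreal_leI f(4) lim)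
      (auto simp: emeasure_eq_measure)
  ultimately show "(\<integral>\<^sup>+\<omega>. indicator A \<omega> * jump_sum_real g s u \<omega> \<partial>M) =
      emeasure M A * (\<integral>\<^sup>+\<omega>. jump_sum_real g 0 u \<omega> \<partial>M)"
    using LIMSEQ_unique by simp
qed

lemma nn_integral_mult_jump_sum:
  assumes g: "jump_function g" and s: "0 \<le> s" and u: "0 < u"
    and Z: "Z \<in> borel_measurable (F s)"
  shows "(\<integral>\<^sup>+\<omega>. Z \<omega> * jump_sum_real g s u \<omega> \<partial>M) =
      (\<integral>\<^sup>+\<omega>. Z \<omega> \<partial>M) * (\<integral>\<^sup>+\<omega>. jump_sum_real g 0 u \<omega> \<partial>M)"
  using Z
proof (induction rule: borel_measurable_induct)
  note [measurable] = jump_sum_measurable[OF g s u]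
  note M = measurable_F_M[OF s]
  {
    case (cong f h)
    then show ?case using space_F[OF s]
      by (metis (mono_tags, lifting) nn_integral_cong)
  next
    case (set A)
    then show ?case using nn_integral_indicator_jump_sum[OF g s u] sets_F[OF s] by simp
  next
    case (mult f c)
    note [measurable] = M[OF mult(2)]
    show ?case using mult(4) by (simp add: mult.assoc nn_integral_cmult)
  next
    case (add f h)
    note [measurable] = M[OF add.hyps(1)] M[OF add.hyps(3)]
    show ?case using add.IH by (simp add: distrib_right nn_integral_add)
  next
    case (seq U)
    note [measurable] = M[OF seq.hyps(1)]
    have "(\<integral>\<^sup>+\<omega>. (SUP i. U i) \<omega> * jump_sum_real g s u \<omega> \<partial>M) =
        (\<integral>\<^sup>+\<omega>. (SUP i. U i \<omega> * jump_sum_real g s u \<omega>) \<partial>M)"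
      by (simp add: SUP_mult_right_ennreal image_comp)
    also have "\<dots> = (SUP i. \<integral>\<^sup>+\<omega>. U i \<omega> * jump_sum_real g s u \<omega> \<partial>M)"
      using seq.hyps by (intro nn_integral_monotone_convergence_SUP)
        (auto simp: incseq_def le_fun_def intro!: mult_right_mono)
    also have "\<dots> = (SUP i. (\<integral>\<^sup>+\<omega>. U i \<omega> \<partial>M)) * (\<integral>\<^sup>+\<omega>. jump_sum_real g 0 u \<omega> \<partial>M)"
      by (simp add: seq.IH SUP_mult_right_ennreal)
    also have "(SUP i. (\<integral>\<^sup>+\<omega>. U i \<omega> \<partial>M)) = (\<integral>\<^sup>+\<omega>. (SUP i. U i) \<omega> \<partial>M)"
      using seq.hyps by (simp add: nn_integral_monotone_convergence_SUP image_comp)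
    finally show ?case .
  }
qed

text \<open>The n + 1 cells of the unit interval have equal expected jump sums, by the stationarity
  already proved, and these add up to the expectation over the whole interval.\<close>

lemma nn_integral_jump_sum_scaling:
  assumes g: "jump_function g"
  shows "(\<integral>\<^sup>+\<omega>. jump_sum_real g 0 (1 / real (Suc n)) \<omega> \<partial>M) =
    ennreal (1 / real (Suc n)) * (\<integral>\<^sup>+\<omega>. jump_sum_real g 0 1 \<omega> \<partial>M)"
proof -
  let ?h = "1 / real (Suc n)" and ?J = "jump_sum_real g"
  have h: "?h > 0" by simp
  have top: "space M \<in> sets (F s)" if "s \<ge> 0" for s using sets.top[of "F s"] space_F[OF that] by simp
  have eq: "(\<integral>\<^sup>+\<omega>. ?J s ?h \<omega> \<partial>M) = (\<integral>\<^sup>+\<omega>. ?J 0 ?h \<omega> \<partial>M)" if "s \<ge> 0" for s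
  proof -
    have "(\<integral>\<^sup>+\<omega>. ?J s ?h \<omega> \<partial>M) = (\<integral>\<^sup>+\<omega>. indicator (space M) \<omega> * ?J s ?h \<omega> \<partial>M)"
      by (intro nn_integral_cong) auto
    then show ?thesis using nn_integral_indicator_jump_sum[OF g that h top[OF that]] by (simp add: emeasure_space_1)
  qed
  have "(\<integral>\<^sup>+\<omega>. ?J 0 1 \<omega> \<partial>M) = (\<integral>\<^sup>+\<omega>. (\<Sum>k<Suc n. ?J (real k * ?h) ?h \<omega>) \<partial>M)"
    by (simp only: jump_sum_cells[OF zero_less_one])
  also have "\<dots> = (\<Sum>k<Suc n. \<integral>\<^sup>+\<omega>. ?J (real k * ?h) ?h \<omega> \<partial>M)"
    by (intro nn_integral_sum jump_sum_measurable g) auto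
  also have "\<dots> = (\<Sum>k<Suc n. \<integral>\<^sup>+\<omega>. ?J 0 ?h \<omega> \<partial>M)" by (intro sum.cong refl eq) auto
  also have "\<dots> = ennreal (real (Suc n)) * (\<integral>\<^sup>+\<omega>. ?J 0 ?h \<omega> \<partial>M)"
    by (simp add: ennreal_of_nat_eq_real_of_nat)
  finally have "ennreal ?h * (\<integral>\<^sup>+\<omega>. ?J 0 1 \<omega> \<partial>M) = ennreal ?h * ennreal (real (Suc n)) * (\<integral>\<^sup>+\<omega>. ?J 0 ?h \<omega> \<partial>M)"
    by (simp add: mult.assoc)
  also have "ennreal ?h * ennreal (real (Suc n)) = 1"
    by (subst ennreal_mult[symmetric]) auto
  finally show ?thesis by simp
qed

end

section \<open>Expected jump sums as integrals against the Levy measure\<close>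

locale levy_measure_setting = levy_setting M F L
  for M :: "'a measure" and F and L :: "real \<Rightarrow> 'a \<Rightarrow> real^'d" +
  fixes \<nu> :: "(real^'d) measure"
  assumes levy_measure: "is_levy_measure M L \<nu>"
begin

lemma sets_levy_measure [measurable_cong]: "sets \<nu> = sets borel"
  using levy_measure by (simp add: is_levy_measure_def)

lemma emeasure_levy_measure:
  assumes "S \<in> sets borel" "0 \<notin> S"
  shows "emeasure \<nu> S = (\<integral>\<^sup>+\<omega>. jump_sum (indicator S) 0 1 \<omega> \<partial>M)"
proof -
  have "emeasure \<nu> S = (\<integral>\<^sup>+\<omega>. emeasure (count_space UNIV)
      {s\<in>{0<..1}. jump (\<lambda>t. L t \<omega>) s \<noteq> 0 \<and> jump (\<lambda>t. L t \<omega>) s \<in> S} \<partial>M)"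
    using levy_measure assms by (simp add: is_levy_measure_def)
  also have "\<dots> = (\<integral>\<^sup>+\<omega>. jump_sum (indicator S) 0 1 \<omega> \<partial>M)"
  proof (rule nn_integral_cong)
    fix \<omega>
    have "indicator S (jump (\<lambda>t. L t \<omega>) r) * indicator {0<..0 + 1} r =
        (indicator {s\<in>{0<..1}. jump (\<lambda>t. L t \<omega>) s \<noteq> 0 \<and> jump (\<lambda>t. L t \<omega>) s \<in> S} r :: ennreal)" for r
      using assms(2) by (auto simp: indicator_def)
    then show "emeasure (count_space UNIV)
      {s\<in>{0<..1}. jump (\<lambda>t. L t \<omega>) s \<noteq> 0 \<and> jump (\<lambda>t. L t \<omega>) s \<in> S} = jump_sum (indicator S) 0 1 \<omega>"
      by (simp add: jump_sum_def)
  qed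
  finally show ?thesis .
qed

text \<open>Indicators of \<open>{g > c}\<close> are limits of continuous functions; the layer cake formula then
  recovers \<open>g\<close>. Only open sets occur, so the counting variables of general Borel sets need not be
  measurable for this argument.\<close>

lemma level_set_measurable:
  assumes g: "jump_function g" and c: "c > 0"
  shows "jump_sum (indicator {x. g x > c}) 0 1 \<in> borel_measurable M"
proof -
  \<comment> \<open>Ramps of slope \<open>m\<close> above the level \<open>c\<close>. Since c > 0
    they are zero at the origin, as \<open>jump_function\<close> demands.\<close>
  define f where "f m x = min 1 (real m * max 0 (g x - c))" for m x
  have gp: "continuous_on UNIV g" "g 0 = 0" using g by (auto simp: jump_function_def)
  have "jump_function (f m)" for m
    unfolding jump_function_def f_def using c gp by (auto intro!: continuous_intros)
  then have meas: "jump_sum_real (f m) 0 1 \<in> borel_measurable M" for m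
    by (intro jump_sum_measurable) auto
  have lim: "(\<lambda>m. ennreal (f m x)) \<longlonglongrightarrow> indicator {x. g x > c} x" for x
  proof (cases "g x > c")
    case True
    obtain m where m: "1 / (g x - c) \<le> real m" using real_arch_simple by blast
    have "\<forall>\<^sub>F n in sequentially. 1 = ennreal (f n x)"
      using eventually_ge_at_top[of m]
    proof (rule eventually_mono)
      fix n assume "m \<le> n"
      then have "1 / (g x - c) \<le> real n" using m by simp
      then have "1 \<le> real n * (g x - c)" using True by (simp add: field_simps)
      then show "1 = ennreal (f n x)" using True by (simp add: f_def max_def)
    qed
    then have "(\<lambda>m. ennreal (f m x)) \<longlonglongrightarrow> 1" by (rule Lim_transform_eventually[OF tendsto_const])
    then show ?thesis using True by simp
  next
    case False
    then have "f m x = 0" for m by (simp add: f_def max_def)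
    then show ?thesis using False by simp
  qed
  have le: "ennreal (f m x) \<le> indicator {x. g x > c} x" for m x
    by (cases "g x > c") (auto simp: f_def max_def intro!: ennreal_le_1[THEN iffD2])
  show ?thesis
    by (rule measurable_AE_lim_ennreal[OF meas]) (rule AE_I2, rule jump_sum_tendsto[OF le lim])
qed

lemma nn_integral_jump_sum:
  assumes g: "jump_function g"
  shows "(\<integral>\<^sup>+\<omega>. jump_sum_real g 0 1 \<omega> \<partial>M) = (\<integral>\<^sup>+x. ennreal (g x) \<partial>\<nu>)"
proof -
  have gp: "continuous_on UNIV g" "\<And>x. g x \<ge> 0" "g 0 = 0" using g by (auto simp: jump_function_def)
  have [measurable]: "g \<in> borel_measurable borel" by (rule borel_measurable_continuous_onI[OF gp(1)])
  define U where "U n j = {x. g x > real j / real (Suc n)}" for n j :: nat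
  have U [measurable]: "U n j \<in> sets borel" for n j unfolding U_def by measurable
  define f where "f n x = (\<Sum>j=1..Suc n * Suc n. ennreal (1 / real (Suc n)) * indicator (U n j) x)" for n x
  have f_eq: "f n x = ennreal (\<Sum>j=1..Suc n * Suc n. 1 / real (Suc n) * indicator {real j / real (Suc n)<..} (g x))" for n x
  proof -
    have "f n x = (\<Sum>j=1..Suc n * Suc n. ennreal (1 / real (Suc n) * indicator {real j / real (Suc n)<..} (g x)))"
      unfolding f_def U_def by (intro sum.cong refl) (auto simp: indicator_def)
    then show ?thesis by (simp only: sum_ennreal[OF mult_nonneg_nonneg] zero_le_divide_1_iff of_nat_0_le_iff indicator_pos_le)
  qed
  have le: "f n x \<le> ennreal (g x)" for n x unfolding f_eq by (intro ennreal_leI layer_sum_bounds(1) gp)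
  have lim: "(\<lambda>n. f n x) \<longlonglongrightarrow> ennreal (g x)" for x
    unfolding f_eq by (intro tendsto_ennrealI layer_sum_tendsto gp)
  have level: "jump_sum (indicator (U n j)) 0 1 \<in> borel_measurable M" if "j \<in> {1..Suc n * Suc n}" for n j
    unfolding U_def by (rule level_set_measurable[OF g]) (use that in auto)
  have J: "jump_sum (f n) 0 1 \<omega> = (\<Sum>j=1..Suc n * Suc n. ennreal (1 / real (Suc n)) * jump_sum (indicator (U n j)) 0 1 \<omega>)" for n \<omega>
    unfolding f_def[abs_def] by (rule jump_sum_sum) simp
  have Jm: "jump_sum (f n) 0 1 \<in> borel_measurable M" for n
    unfolding J by (intro borel_measurable_sum borel_measurable_times_ennreal level) auto
  have "(\<integral>\<^sup>+\<omega>. jump_sum (f n) 0 1 \<omega> \<partial>M) = (\<integral>\<^sup>+x. f n x \<partial>\<nu>)" for n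
  proof -
    have "(\<integral>\<^sup>+\<omega>. jump_sum (f n) 0 1 \<omega> \<partial>M) = (\<Sum>j=1..Suc n * Suc n. \<integral>\<^sup>+\<omega>. ennreal (1 / real (Suc n)) * jump_sum (indicator (U n j)) 0 1 \<omega> \<partial>M)"
      unfolding J by (intro nn_integral_sum borel_measurable_times_ennreal level) auto
    also have "\<dots> = (\<Sum>j=1..Suc n * Suc n. ennreal (1 / real (Suc n)) * emeasure \<nu> (U n j))"
    proof (intro sum.cong refl)
      fix j assume j: "j \<in> {1..Suc n * Suc n}"
      have 0: "0 \<notin> U n j" by (simp add: U_def gp not_less)
      then show "(\<integral>\<^sup>+\<omega>. ennreal (1 / real (Suc n)) * jump_sum (indicator (U n j)) 0 1 \<omega> \<partial>M) = ennreal (1 / real (Suc n)) * emeasure \<nu> (U n j)"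
        by (simp only: nn_integral_cmult level[OF j] emeasure_levy_measure[OF U 0])
    qed
    also have "\<dots> = (\<integral>\<^sup>+x. f n x \<partial>\<nu>)"
      unfolding f_def using U by (subst nn_integral_sum) (auto simp: sets_levy_measure nn_integral_cmult_indicator)
    finally show ?thesis .
  qed
  moreover have "(\<lambda>n. \<integral>\<^sup>+\<omega>. jump_sum (f n) 0 1 \<omega> \<partial>M) \<longlonglongrightarrow> (\<integral>\<^sup>+\<omega>. jump_sum_real g 0 1 \<omega> \<partial>M)"
    by (intro nn_integral_tendsto_below AE_I2 Jm jump_sum_measurable g jump_sum_mono jump_sum_tendsto le lim) auto
  moreover have "(\<lambda>n. \<integral>\<^sup>+x. f n x \<partial>\<nu>) \<longlonglongrightarrow> (\<integral>\<^sup>+x. ennreal (g x) \<partial>\<nu>)"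
    by (intro nn_integral_tendsto_below AE_I2 le lim) (auto simp: f_def)
  ultimately show ?thesis using LIMSEQ_unique by simp
qed

end

section \<open>The compensation formula\<close>

lemma left_lim_compose2:
  fixes u :: "real \<Rightarrow> real"
  assumes "cadlag u" "continuous_on UNIV g" "s \<in> {0<..1}"
  shows "left_lim (\<lambda>t. g (u t) :: real) s = g (left_lim u s)"
  using cadlag_compose(2)[OF assms(1,2), of s] assms(3) by simp

lemma left_lim_nonneg:
  fixes u :: "real \<Rightarrow> real"
  assumes "cadlag u" "\<And>t. t \<ge> 0 \<Longrightarrow> u t \<ge> 0" "s > 0"
  shows "left_lim u s \<ge> 0"
proof (rule tendsto_lowerbound[OF cadlag_left_lim[OF assms(1,3)]])
  show "\<forall>\<^sub>F x in at_left s. 0 \<le> u x"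
    using eventually_at_left_real[OF assms(3)] by eventually_elim (auto intro!: assms(2))
qed simp

lemma cell_length:
  assumes "t > 0"
  shows "(LINT s:cell t n k|lborel. 1) = t / real (Suc n)"
proof -
  have "grid t n k \<le> grid t n (Suc k)"
    using assms by (intro mult_right_mono) auto
  moreover have "grid t n (Suc k) - grid t n k = t / real (Suc n)"
    by (simp only: left_diff_distrib[symmetric]) simp
  ultimately show ?thesis
    by (simp add: set_lebesgue_integral_def del: of_nat_Suc)
qed

lemma cell_subset:
  assumes "t > 0" "k < Suc n"
  shows "cell t n k \<subseteq> {0<..t}"
  using cells_Union[OF assms(1), of n] assms(2) by blast

context levy_setting
begin

text \<open>The left limit makes the integrand predictable. \<open>U\<close> may jump together with
  \<open>L\<close>, and with the values of \<open>U\<close> in its place the compensation formula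
  could fail.\<close>

definition jump_integral :: "(real \<Rightarrow> 'a \<Rightarrow> real) \<Rightarrow> (real^'d \<Rightarrow> real) \<Rightarrow> 'a \<Rightarrow> ennreal"
  where "jump_integral U g \<omega> =
    (\<integral>\<^sup>+r\<in>{0<..1}. ennreal (left_lim (\<lambda>t. U t \<omega>) r * g (jump (\<lambda>t. L t \<omega>) r)) \<partial>count_space UNIV)"

definition time_integral :: "(real \<Rightarrow> 'a \<Rightarrow> real) \<Rightarrow> 'a \<Rightarrow> ennreal"
  where "time_integral U \<omega> = (\<integral>\<^sup>+r\<in>{0<..1}. ennreal (left_lim (\<lambda>t. U t \<omega>) r) \<partial>lborel)"

lemma lborel_left_lim_integrable:
  assumes "cadlag u"
  shows "set_integrable lborel {0<..1} (left_lim u :: real \<Rightarrow> real)"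
  using left_lim_integrable[OF zero_less_one _ _ _ assms, of lborel "\<lambda>_. 1"]
  by (simp add: set_integrable_def integrable_indicator_iff)

lemma left_lim_borel_measurable:
  assumes "cadlag u"
  shows "(\<lambda>r. indicator {0<..1} r * left_lim u r :: real) \<in> borel_measurable borel"
  using lborel_left_lim_integrable[OF assms]
  by (auto simp: set_integrable_def dest: borel_measurable_integrable)

lemma set_nn_integral_eq_ennreal:
  fixes f :: "real \<Rightarrow> real"
  assumes "set_integrable N A f" "\<And>x. x \<in> A \<Longrightarrow> f x \<ge> 0"
  shows "(\<integral>\<^sup>+x\<in>A. ennreal (f x) \<partial>N) = ennreal (LINT x:A|N. f x)"
proof -
  have "(\<integral>\<^sup>+x\<in>A. ennreal (f x) \<partial>N) = (\<integral>\<^sup>+x. ennreal (indicator A x * f x) \<partial>N)"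
    by (intro nn_integral_cong) (auto simp: indicator_def)
  also have "\<dots> = ennreal (LINT x:A|N. f x)"
    using assms by (subst nn_integral_eq_integral)
      (auto simp: set_integrable_def set_lebesgue_integral_def indicator_def intro!: AE_I2)
  finally show ?thesis .
qed

lemma time_integral_eq:
  assumes "cadlag (\<lambda>t. U t \<omega>)" "\<And>t. t \<ge> 0 \<Longrightarrow> U t \<omega> \<ge> 0"
  shows "time_integral U \<omega> = ennreal (LINT r:{0<..1}|lborel. left_lim (\<lambda>t. U t \<omega>) r)"
  unfolding time_integral_def
  by (rule set_nn_integral_eq_ennreal[OF lborel_left_lim_integrable[OF assms(1)]])
    (use left_lim_nonneg[OF assms] in auto)

lemma count_space_set_integrable:
  fixes f :: "real \<Rightarrow> real"
  assumes "(\<integral>\<^sup>+r\<in>A. ennreal \<bar>f r\<bar> \<partial>count_space UNIV) < \<infinity>"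
  shows "set_integrable (count_space UNIV) A f"
  unfolding set_integrable_def
proof (rule integrableI_bounded)
  have "(\<integral>\<^sup>+r. ennreal (norm (indicator A r *\<^sub>R f r)) \<partial>count_space UNIV) = (\<integral>\<^sup>+r\<in>A. ennreal \<bar>f r\<bar> \<partial>count_space UNIV)"
    by (intro nn_integral_cong) (auto simp: indicator_def)
  then show "(\<integral>\<^sup>+r. ennreal (norm (indicator A r *\<^sub>R f r)) \<partial>count_space UNIV) < \<infinity>" using assms by simp
qed simp

definition nonneg_process :: "(real \<Rightarrow> 'a \<Rightarrow> real) \<Rightarrow> bool"
  where "nonneg_process U \<longleftrightarrow> adapted F U \<and> (AE \<omega> in M. cadlag (\<lambda>t. U t \<omega>)) \<and> (\<forall>t\<ge>0. \<forall>\<omega>. U t \<omega> \<ge> 0)"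

text \<open>Predictable Riemann sums: the value of \<open>U\<close> at the left end of a cell
  belongs to the past, so \<open>nn_integral_mult_jump_sum\<close> factorises each summand of
  \<open>Z\<close>, and \<open>nn_integral_jump_sum_scaling\<close> replaces the jump factor by the
  cell length times \<open>?G\<close>. The bound \<open>K\<close> provides the dominating function
  \<open>K\<close> times the total jump sum, which is integrable by \<open>fin\<close>.\<close>

lemma
  assumes U: "nonneg_process U" and K: "\<And>t \<omega>. t \<ge> 0 \<Longrightarrow> U t \<omega> \<le> K"
    and g: "jump_function g" and fin: "(\<integral>\<^sup>+\<omega>. jump_sum_real g 0 1 \<omega> \<partial>M) < \<infinity>"
  shows compensation_bounded: "(\<integral>\<^sup>+\<omega>. jump_integral U g \<omega> \<partial>M) =
      (\<integral>\<^sup>+\<omega>. jump_sum_real g 0 1 \<omega> \<partial>M) * (\<integral>\<^sup>+\<omega>. time_integral U \<omega> \<partial>M)"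
    and jump_integral_measurable_bounded: "jump_integral U g \<in> borel_measurable M"
    and time_integral_measurable_bounded: "time_integral U \<in> borel_measurable M"
proof -
  let ?J = "jump_sum_real g"
  let ?G = "\<integral>\<^sup>+\<omega>. ?J 0 1 \<omega> \<partial>M"
  let ?h = "\<lambda>n. 1 / real (Suc n)"
  have Up: "adapted F U" "AE \<omega> in M. cadlag (\<lambda>t. U t \<omega>)" "\<And>t \<omega>. t \<ge> 0 \<Longrightarrow> U t \<omega> \<ge> 0"
    using U by (auto simp: nonneg_process_def)
  have gp: "\<And>x. g x \<ge> 0" using g by (auto simp: jump_function_def)
  have UF: "U t \<in> borel_measurable (F t)" and UM [measurable]: "U t \<in> borel_measurable M" if "t \<ge> 0" for t
    using Up(1) that measurable_F_M[OF that] by (auto simp: adapted_def)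
  have JM [measurable]: "?J s u \<in> borel_measurable M" if "s \<ge> 0" "u > 0" for s u
    by (rule jump_sum_measurable[OF g that])
  define Z where "Z n \<omega> = (\<Sum>k<Suc n. ennreal (U (grid 1 n k) \<omega>) * ?J (grid 1 n k) (?h n) \<omega>)" for n \<omega>
  define R where "R n \<omega> = (\<Sum>k<Suc n. ennreal (U (grid 1 n k) \<omega>) * ennreal (?h n))" for n \<omega>
  have ZM [measurable]: "Z n \<in> borel_measurable M" and RM [measurable]: "R n \<in> borel_measurable M" for n
    unfolding Z_def[abs_def] R_def[abs_def] by (auto intro!: borel_measurable_sum borel_measurable_times_ennreal
        measurable_compose[OF UM measurable_ennreal] JM)
  have fin_AE: "AE \<omega> in M. ?J 0 1 \<omega> \<noteq> \<infinity>"
    using fin by (intro nn_integral_noteq_infinite JM) auto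
  have Z_lim: "AE \<omega> in M. (\<lambda>n. Z n \<omega>) \<longlonglongrightarrow> jump_integral U g \<omega>"
    using fin_AE Up(2)
  proof eventually_elim
    fix \<omega> assume J: "?J 0 1 \<omega> \<noteq> \<infinity>" and c: "cadlag (\<lambda>t. U t \<omega>)"
    define \<beta> where "\<beta> r = g (jump (\<lambda>t. L t \<omega>) r)" for r
    have \<beta>: "set_integrable (count_space UNIV) {0<..1} \<beta>"
      using J gp by (intro count_space_set_integrable) (simp add: \<beta>_def jump_sum_def top.not_eq_extremum)
    note lr = left_riemann_sums[OF zero_less_one _ _ \<beta> c] left_lim_integrable[OF zero_less_one _ _ \<beta> c]
    have J_cell: "?J (grid 1 n k) (?h n) \<omega> = ennreal (LINT r:cell 1 n k|count_space UNIV. \<beta> r)"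
      if "k < Suc n" for k n
    proof -
      have e: "grid 1 n k + ?h n = grid 1 n (Suc k)" by (simp add: algebra_simps add_divide_distrib)
      have sub: "set_integrable (count_space UNIV) (cell 1 n k) \<beta>"
        by (rule set_integrable_subset[OF \<beta> _ cell_subset[OF zero_less_one that]]) simp
      show ?thesis
        unfolding jump_sum_def e \<beta>_def[symmetric]
        by (rule set_nn_integral_eq_ennreal[OF sub]) (simp add: \<beta>_def gp)
    qed
    have "Z n \<omega> = ennreal (\<Sum>k<Suc n. U (grid 1 n k) \<omega> * (LINT r:cell 1 n k|count_space UNIV. \<beta> r))" for n
    proof -
      have nn: "0 \<le> (LINT r:cell 1 n k|count_space UNIV. \<beta> r)" for k
        unfolding set_lebesgue_integral_def by (intro Bochner_Integration.integral_nonneg) (auto simp: \<beta>_def gp)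
      have "Z n \<omega> = (\<Sum>k<Suc n. ennreal (U (grid 1 n k) \<omega> * (LINT r:cell 1 n k|count_space UNIV. \<beta> r)))"
        unfolding Z_def by (intro sum.cong refl) (simp only: J_cell lessThan_iff ennreal_mult[OF Up(3) nn]
            mult_nonneg_nonneg of_nat_0_le_iff zero_le_divide_1_iff)
      also have "\<dots> = ennreal (\<Sum>k<Suc n. U (grid 1 n k) \<omega> * (LINT r:cell 1 n k|count_space UNIV. \<beta> r))"
        by (intro sum_ennreal mult_nonneg_nonneg nn Up(3)) auto
      finally show ?thesis .
    qed
    moreover have "jump_integral U g \<omega> = ennreal (LINT r:{0<..1}|count_space UNIV. left_lim (\<lambda>t. U t \<omega>) r * \<beta> r)"
      unfolding jump_integral_def \<beta>_def[symmetric]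
      by (rule set_nn_integral_eq_ennreal[OF lr(2)]) (use left_lim_nonneg[OF c Up(3)] gp in \<open>auto simp: \<beta>_def\<close>)
    ultimately show "(\<lambda>n. Z n \<omega>) \<longlonglongrightarrow> jump_integral U g \<omega>"
      using tendsto_ennrealI[OF lr(1)] by simp
  qed
  have R_lim: "AE \<omega> in M. (\<lambda>n. R n \<omega>) \<longlonglongrightarrow> time_integral U \<omega>"
    using Up(2)
  proof eventually_elim
    fix \<omega> assume c: "cadlag (\<lambda>t. U t \<omega>)"
    have one: "set_integrable lborel {0<..1::real} (\<lambda>_. 1 :: real)"
      by (simp add: set_integrable_def integrable_indicator_iff)
    have "(\<lambda>n. \<Sum>k<Suc n. U (grid 1 n k) \<omega> * (LINT r:cell 1 n k|lborel. 1))
        \<longlonglongrightarrow> (LINT r:{0<..1}|lborel. left_lim (\<lambda>t. U t \<omega>) r * 1)"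
      by (rule left_riemann_sums[OF zero_less_one _ _ one c]) auto
    then have "(\<lambda>n. \<Sum>k<Suc n. U (grid 1 n k) \<omega> * ?h n) \<longlonglongrightarrow> (LINT r:{0<..1}|lborel. left_lim (\<lambda>t. U t \<omega>) r)"
      unfolding cell_length[OF zero_less_one] by simp
    moreover have "R n \<omega> = ennreal (\<Sum>k<Suc n. U (grid 1 n k) \<omega> * ?h n)" for n
    proof -
      have "R n \<omega> = (\<Sum>k<Suc n. ennreal (U (grid 1 n k) \<omega> * ?h n))"
        unfolding R_def by (intro sum.cong refl ennreal_mult[symmetric] Up(3)) auto
      also have "\<dots> = ennreal (\<Sum>k<Suc n. U (grid 1 n k) \<omega> * ?h n)"
        by (intro sum_ennreal mult_nonneg_nonneg Up(3)) auto
      finally show ?thesis .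
    qed
    moreover have "time_integral U \<omega> = ennreal (LINT r:{0<..1}|lborel. left_lim (\<lambda>t. U t \<omega>) r)"
      by (rule time_integral_eq[where U = U, OF c]) (rule Up(3))
    ultimately show "(\<lambda>n. R n \<omega>) \<longlonglongrightarrow> time_integral U \<omega>"
      using tendsto_ennrealI by simp
  qed
  show SM [measurable]: "jump_integral U g \<in> borel_measurable M"
    by (rule measurable_AE_lim_ennreal[OF ZM Z_lim])
  show TM [measurable]: "time_integral U \<in> borel_measurable M"
    by (rule measurable_AE_lim_ennreal[OF RM R_lim])
  have Z_le: "Z n \<omega> \<le> ennreal K * ?J 0 1 \<omega>" for n \<omega>
  proof -
    have "Z n \<omega> \<le> (\<Sum>k<Suc n. ennreal K * ?J (grid 1 n k) (?h n) \<omega>)"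
      unfolding Z_def by (intro sum_mono mult_right_mono ennreal_leI K) auto
    also have "\<dots> = ennreal K * ?J 0 1 \<omega>"
      by (simp only: sum_distrib_left[symmetric] jump_sum_cells[OF zero_less_one])
    finally show ?thesis .
  qed
  have R_le: "R n \<omega> \<le> ennreal K" for n \<omega>
  proof -
    have "R n \<omega> \<le> (\<Sum>k<Suc n. ennreal K * ennreal (?h n))"
      unfolding R_def by (intro sum_mono mult_right_mono ennreal_leI K) auto
    also have "\<dots> = ennreal K * (ennreal (real (Suc n)) * ennreal (?h n))"
      by (simp add: mult_ac ennreal_of_nat_eq_real_of_nat)
    also have "ennreal (real (Suc n)) * ennreal (?h n) = 1" by (subst ennreal_mult[symmetric]) auto
    finally show ?thesis by simp
  qed
  have lim1: "(\<lambda>n. \<integral>\<^sup>+\<omega>. Z n \<omega> \<partial>M) \<longlonglongrightarrow> (\<integral>\<^sup>+\<omega>. jump_integral U g \<omega> \<partial>M)"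
    using Z_lim fin by (intro nn_integral_dominated_convergence[where w = "\<lambda>\<omega>. ennreal K * ?J 0 1 \<omega>"])
      (auto simp: Z_le nn_integral_cmult JM ennreal_mult_less_top)
  have lim2: "(\<lambda>n. \<integral>\<^sup>+\<omega>. R n \<omega> \<partial>M) \<longlonglongrightarrow> (\<integral>\<^sup>+\<omega>. time_integral U \<omega> \<partial>M)"
    using R_lim by (intro nn_integral_dominated_convergence[where w = "\<lambda>\<omega>. ennreal K"])
      (auto simp: R_le emeasure_space_1)
  have "(\<integral>\<^sup>+\<omega>. Z n \<omega> \<partial>M) = ?G * (\<integral>\<^sup>+\<omega>. R n \<omega> \<partial>M)" for n
  proof -
    have k: "0 \<le> grid 1 n k" for k by simp
    have "(\<integral>\<^sup>+\<omega>. Z n \<omega> \<partial>M) = (\<Sum>k<Suc n. \<integral>\<^sup>+\<omega>. ennreal (U (grid 1 n k) \<omega>) * ?J (grid 1 n k) (?h n) \<omega> \<partial>M)"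
      unfolding Z_def by (intro nn_integral_sum borel_measurable_times_ennreal measurable_compose[OF UM measurable_ennreal] JM) auto
    also have "\<dots> = (\<Sum>k<Suc n. (\<integral>\<^sup>+\<omega>. ennreal (U (grid 1 n k) \<omega>) \<partial>M) * (ennreal (?h n) * ?G))"
    proof (intro sum.cong refl)
      fix k
      have "(\<integral>\<^sup>+\<omega>. ennreal (U (grid 1 n k) \<omega>) * ?J (grid 1 n k) (?h n) \<omega> \<partial>M) =
          (\<integral>\<^sup>+\<omega>. ennreal (U (grid 1 n k) \<omega>) \<partial>M) * (\<integral>\<^sup>+\<omega>. ?J 0 (?h n) \<omega> \<partial>M)"
        by (rule nn_integral_mult_jump_sum[OF g k _ measurable_compose[OF UF[OF k] measurable_ennreal]]) simp
      then show "(\<integral>\<^sup>+\<omega>. ennreal (U (grid 1 n k) \<omega>) * ?J (grid 1 n k) (?h n) \<omega> \<partial>M) =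
          (\<integral>\<^sup>+\<omega>. ennreal (U (grid 1 n k) \<omega>) \<partial>M) * (ennreal (?h n) * ?G)"
        by (simp only: nn_integral_jump_sum_scaling[OF g])
    qed
    also have "\<dots> = ?G * (\<Sum>k<Suc n. (\<integral>\<^sup>+\<omega>. ennreal (U (grid 1 n k) \<omega>) \<partial>M) * ennreal (?h n))"
      by (simp only: sum_distrib_left mult_ac)
    also have "(\<Sum>k<Suc n. (\<integral>\<^sup>+\<omega>. ennreal (U (grid 1 n k) \<omega>) \<partial>M) * ennreal (?h n)) = (\<integral>\<^sup>+\<omega>. R n \<omega> \<partial>M)"
    proof -
      have m: "(\<lambda>\<omega>. ennreal (U (grid 1 n k) \<omega>)) \<in> borel_measurable M" for k
        by (rule measurable_compose[OF UM[OF k] measurable_ennreal])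
      have "(\<integral>\<^sup>+\<omega>. R n \<omega> \<partial>M) = (\<Sum>k<Suc n. \<integral>\<^sup>+\<omega>. ennreal (U (grid 1 n k) \<omega>) * ennreal (?h n) \<partial>M)"
        unfolding R_def by (intro nn_integral_sum borel_measurable_times_ennreal m) auto
      also have "\<dots> = (\<Sum>k<Suc n. (\<integral>\<^sup>+\<omega>. ennreal (U (grid 1 n k) \<omega>) \<partial>M) * ennreal (?h n))"
        by (intro sum.cong refl nn_integral_multc m)
      finally show ?thesis by simp
    qed
    finally show ?thesis .
  qed
  with lim1 have "(\<lambda>n. ?G * (\<integral>\<^sup>+\<omega>. R n \<omega> \<partial>M)) \<longlonglongrightarrow> (\<integral>\<^sup>+\<omega>. jump_integral U g \<omega> \<partial>M)" by simp
  moreover have "(\<lambda>n. ?G * (\<integral>\<^sup>+\<omega>. R n \<omega> \<partial>M)) \<longlonglongrightarrow> ?G * (\<integral>\<^sup>+\<omega>. time_integral U \<omega> \<partial>M)"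
    using fin by (intro ennreal_tendsto_cmult lim2) (auto simp: less_top)
  ultimately show "(\<integral>\<^sup>+\<omega>. jump_integral U g \<omega> \<partial>M) = ?G * (\<integral>\<^sup>+\<omega>. time_integral U \<omega> \<partial>M)"
    by (rule LIMSEQ_unique)
qed

text \<open>The truncations of \<open>U\<close> at height n are bounded, and being continuous
  functions of \<open>U\<close> they commute with left limits. Both sides then converge from
  below.\<close>

lemma
  assumes U: "nonneg_process U" and g: "jump_function g"
    and fin: "(\<integral>\<^sup>+\<omega>. jump_sum_real g 0 1 \<omega> \<partial>M) < \<infinity>"
  shows compensation: "(\<integral>\<^sup>+\<omega>. jump_integral U g \<omega> \<partial>M) =
      (\<integral>\<^sup>+\<omega>. jump_sum_real g 0 1 \<omega> \<partial>M) * (\<integral>\<^sup>+\<omega>. time_integral U \<omega> \<partial>M)"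
    and jump_integral_measurable: "jump_integral U g \<in> borel_measurable M"
    and time_integral_measurable: "time_integral U \<in> borel_measurable M"
proof -
  let ?G = "\<integral>\<^sup>+\<omega>. jump_sum_real g 0 1 \<omega> \<partial>M"
  have Up: "adapted F U" "AE \<omega> in M. cadlag (\<lambda>t. U t \<omega>)" "\<And>t \<omega>. t \<ge> 0 \<Longrightarrow> U t \<omega> \<ge> 0"
    using U by (auto simp: nonneg_process_def)
  have gp: "\<And>x. g x \<ge> 0" using g by (auto simp: jump_function_def)
  define W where "W n t \<omega> = min (real n) (U t \<omega>)" for n t \<omega>
  have W: "nonneg_process (W n)" for n
    unfolding nonneg_process_def
  proof (intro conjI)
    show "adapted F (W n)" using Up(1) unfolding adapted_def W_def by (auto intro!: borel_measurable_min)
    show "AE \<omega> in M. cadlag (\<lambda>t. W n t \<omega>)"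
      using Up(2)
    proof eventually_elim
      fix \<omega> assume c: "cadlag (\<lambda>t. U t \<omega>)"
      show "cadlag (\<lambda>t. W n t \<omega>)"
        unfolding W_def by (rule cadlag_compose(1)[OF c, of "min (real n)"]) (intro continuous_intros)
    qed
    show "\<forall>t\<ge>0. \<forall>\<omega>. 0 \<le> W n t \<omega>" using Up(3) by (simp add: W_def)
  qed
  have Wle: "W n t \<omega> \<le> real n" for n t \<omega> by (simp add: W_def)
  note B = compensation_bounded[OF W Wle g fin] jump_integral_measurable_bounded[OF W Wle g fin]
    time_integral_measurable_bounded[OF W Wle g fin]
  have Wl: "left_lim (\<lambda>t. W n t \<omega>) r = min (real n) (left_lim (\<lambda>t. U t \<omega>) r)"
    if "cadlag (\<lambda>t. U t \<omega>)" "r \<in> {0<..1}" for n \<omega> r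
    unfolding W_def by (rule left_lim_compose2[OF that(1) _ that(2)]) (intro continuous_intros)
  have min_lim: "(\<lambda>n. min (real n) x) \<longlonglongrightarrow> x" for x
  proof -
    obtain m where "x \<le> real m" using real_arch_simple by blast
    then have "\<forall>\<^sub>F n in sequentially. x = min (real n) x"
      by (intro eventually_mono[OF eventually_ge_at_top[of m]]) (simp add: min_def)
    then show ?thesis by (rule Lim_transform_eventually[OF tendsto_const])
  qed
  have S: "AE \<omega> in M. (\<forall>n. jump_integral (W n) g \<omega> \<le> jump_integral U g \<omega>) \<and> (\<lambda>n. jump_integral (W n) g \<omega>) \<longlonglongrightarrow> jump_integral U g \<omega>"
    using Up(2)
  proof eventually_elim
    fix \<omega> assume c: "cadlag (\<lambda>t. U t \<omega>)"
    let ?f = "\<lambda>n r. ennreal (left_lim (\<lambda>t. W n t \<omega>) r * g (jump (\<lambda>t. L t \<omega>) r)) * indicator {0<..1} r"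
    let ?g = "\<lambda>r. ennreal (left_lim (\<lambda>t. U t \<omega>) r * g (jump (\<lambda>t. L t \<omega>) r)) * indicator {0<..1} r"
    have le: "?f n r \<le> ?g r" for n r
      using Wl[OF c] gp by (auto simp: indicator_def intro!: ennreal_leI mult_right_mono)
    have lim: "(\<lambda>n. ?f n r) \<longlonglongrightarrow> ?g r" for r
      by (cases "r \<in> {0<..1}") (auto simp: Wl[OF c] intro!: tendsto_ennrealI tendsto_mult_right min_lim)
    show "(\<forall>n. jump_integral (W n) g \<omega> \<le> jump_integral U g \<omega>) \<and> (\<lambda>n. jump_integral (W n) g \<omega>) \<longlonglongrightarrow> jump_integral U g \<omega>"
      unfolding jump_integral_def
      by (intro conjI allI nn_integral_mono nn_integral_tendsto_below AE_I2 le lim) auto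
  qed
  have T: "AE \<omega> in M. (\<forall>n. time_integral (W n) \<omega> \<le> time_integral U \<omega>) \<and> (\<lambda>n. time_integral (W n) \<omega>) \<longlonglongrightarrow> time_integral U \<omega>"
    using Up(2)
  proof eventually_elim
    fix \<omega> assume c: "cadlag (\<lambda>t. U t \<omega>)"
    let ?f = "\<lambda>n r. ennreal (left_lim (\<lambda>t. W n t \<omega>) r) * indicator {0<..1} r"
    let ?g = "\<lambda>r. ennreal (left_lim (\<lambda>t. U t \<omega>) r) * indicator {0<..1} r"
    have le: "?f n r \<le> ?g r" for n r
      using Wl[OF c] by (auto simp: indicator_def intro!: ennreal_leI)
    have lim: "(\<lambda>n. ?f n r) \<longlonglongrightarrow> ?g r" for r
      by (cases "r \<in> {0<..1}") (auto simp: Wl[OF c] intro!: tendsto_ennrealI min_lim)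
    have eq: "?f n = (\<lambda>r. ennreal (min (real n) (indicator {0<..1} r * left_lim (\<lambda>t. U t \<omega>) r)))"
        "?g = (\<lambda>r. ennreal (indicator {0<..1} r * left_lim (\<lambda>t. U t \<omega>) r))" for n
      by (auto simp: fun_eq_iff indicator_def Wl[OF c])
    have "?f n \<in> borel_measurable lborel" "?g \<in> borel_measurable lborel" for n
      unfolding eq using left_lim_borel_measurable[OF c] by auto
    then show "(\<forall>n. time_integral (W n) \<omega> \<le> time_integral U \<omega>) \<and> (\<lambda>n. time_integral (W n) \<omega>) \<longlonglongrightarrow> time_integral U \<omega>"
      unfolding time_integral_def
      by (intro conjI allI nn_integral_mono nn_integral_tendsto_below AE_I2 le lim) auto
  qed
  show SM: "jump_integral U g \<in> borel_measurable M"
    by (rule measurable_AE_lim_ennreal[OF B(2)]) (use S in auto)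
  show TM: "time_integral U \<in> borel_measurable M"
    by (rule measurable_AE_lim_ennreal[OF B(3)]) (use T in auto)
  have "(\<lambda>n. \<integral>\<^sup>+\<omega>. jump_integral (W n) g \<omega> \<partial>M) \<longlonglongrightarrow> (\<integral>\<^sup>+\<omega>. jump_integral U g \<omega> \<partial>M)"
    by (rule nn_integral_tendsto_below[OF B(2) SM]) (use S in auto)
  moreover have "(\<lambda>n. ?G * (\<integral>\<^sup>+\<omega>. time_integral (W n) \<omega> \<partial>M)) \<longlonglongrightarrow> ?G * (\<integral>\<^sup>+\<omega>. time_integral U \<omega> \<partial>M)"
  proof (rule ennreal_tendsto_cmult)
    show "?G < top" using fin by simp
    show "(\<lambda>n. \<integral>\<^sup>+\<omega>. time_integral (W n) \<omega> \<partial>M) \<longlonglongrightarrow> (\<integral>\<^sup>+\<omega>. time_integral U \<omega> \<partial>M)"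
      by (rule nn_integral_tendsto_below[OF B(3) TM]) (use T in auto)
  qed
  ultimately show "(\<integral>\<^sup>+\<omega>. jump_integral U g \<omega> \<partial>M) = ?G * (\<integral>\<^sup>+\<omega>. time_integral U \<omega> \<partial>M)"
    unfolding B(1) by (rule LIMSEQ_unique)
qed

end

section \<open>Real-valued expectations and time integrals of cadlag processes\<close>

lemma cell_index_exists:
  assumes "r \<in> {0<..1}"
  obtains k where "k < Suc n" "r \<in> cell 1 n k"
  using cells_Union[OF zero_less_one, of n] assms by blast

context levy_setting
begin

lemma integral_from_ennreal:
  assumes S: "S \<in> borel_measurable M" "(\<integral>\<^sup>+\<omega>. S \<omega> \<partial>M) < \<infinity>"
    and s: "AE \<omega> in M. S \<omega> = ennreal (s \<omega>) \<and> s \<omega> \<ge> 0"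
  shows "integrable M s" "ennreal (LINT \<omega>|M. s \<omega>) = (\<integral>\<^sup>+\<omega>. S \<omega> \<partial>M)"
proof -
  have [measurable]: "s \<in> borel_measurable M"
    by (rule measurable_AE_eq[of "\<lambda>\<omega>. enn2real (S \<omega>)"]) (use S s in auto)
  have eq: "(\<integral>\<^sup>+\<omega>. ennreal (s \<omega>) \<partial>M) = (\<integral>\<^sup>+\<omega>. S \<omega> \<partial>M)"
    using s by (intro nn_integral_cong_AE) auto
  show int: "integrable M s"
    by (rule integrableI_nonneg) (use s S eq in auto)
  show "ennreal (LINT \<omega>|M. s \<omega>) = (\<integral>\<^sup>+\<omega>. S \<omega> \<partial>M)"
    using nn_integral_eq_integral[OF int] s eq by auto
qed

abbreviation jump_real :: "(real \<Rightarrow> 'a \<Rightarrow> real) \<Rightarrow> (real^'d \<Rightarrow> real) \<Rightarrow> 'a \<Rightarrow> real"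
  where "jump_real U g \<omega> \<equiv>
    (LINT r:{0<..1}|count_space UNIV. left_lim (\<lambda>t. U t \<omega>) r * g (jump (\<lambda>t. L t \<omega>) r))"

abbreviation time_real :: "(real \<Rightarrow> 'a \<Rightarrow> real) \<Rightarrow> 'a \<Rightarrow> real"
  where "time_real U \<omega> \<equiv> (LINT r:{0<..1}|lborel. left_lim (\<lambda>t. U t \<omega>) r)"

definition cadlag_process :: "(real \<Rightarrow> 'a \<Rightarrow> real) \<Rightarrow> bool"
  where "cadlag_process U \<longleftrightarrow> adapted F U \<and> (AE \<omega> in M. cadlag (\<lambda>t. U t \<omega>))"

lemma cadlag_process_compose:
  assumes "cadlag_process U" "continuous_on UNIV f"
  shows "cadlag_process (\<lambda>t \<omega>. f (U t \<omega>))"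
  unfolding cadlag_process_def adapted_def
proof (intro conjI allI impI)
  show "(\<lambda>\<omega>. f (U t \<omega>)) \<in> borel_measurable (F t)" if "t \<ge> 0" for t
    using assms that unfolding cadlag_process_def adapted_def
    by (intro measurable_compose[OF _ borel_measurable_continuous_onI[OF assms(2)]]) auto
  have "AE \<omega> in M. cadlag (\<lambda>t. U t \<omega>)" using assms by (simp add: cadlag_process_def)
  then show "AE \<omega> in M. cadlag (\<lambda>t. f (U t \<omega>))"
    by eventually_elim (rule cadlag_compose(1)[OF _ assms(2)])
qed

lemma nonneg_process_compose:
  assumes "cadlag_process U" "continuous_on UNIV f" "\<And>x. f x \<ge> 0"
  shows "nonneg_process (\<lambda>t \<omega>. f (U t \<omega>))"
  using cadlag_process_compose[OF assms(1,2)] assms(3) by (simp add: nonneg_process_def cadlag_process_def)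

text \<open>Right-continuity gives a jointly measurable version of the process; since the paths have
  countably many jumps, replacing left limits by values does not change the time integrals.\<close>

lemma
  assumes U: "cadlag_process U"
    and K: "\<And>r. r \<in> {0<..1} \<Longrightarrow> (\<integral>\<^sup>+\<omega>. ennreal \<bar>U r \<omega>\<bar> \<partial>M) \<le> ennreal K"
  shows time_integral_abs_finite: "(\<integral>\<^sup>+\<omega>. time_integral (\<lambda>t \<omega>. \<bar>U t \<omega>\<bar>) \<omega> \<partial>M) < \<infinity>"
    and time_integral_expectation: "(\<And>r. r \<in> {0<..1} \<Longrightarrow> (LINT \<omega>|M. U r \<omega>) = m) \<Longrightarrow>
      (LINT \<omega>|M. (time_real U \<omega>)) = m"
proof -
  interpret pair_sigma_finite lborel M ..
  have path: "AE \<omega> in M. cadlag (\<lambda>t. U t \<omega>)" using U by (simp add: cadlag_process_def)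
  have UM [measurable]: "U t \<in> borel_measurable M" if "t \<ge> 0" for t
    using U that measurable_F_M[OF that] by (auto simp: cadlag_process_def adapted_def)
  let ?h = "\<lambda>n. 1 / real (Suc n)"
  let ?I = "\<lambda>n k. cell 1 n k"
  \<comment> \<open>The process frozen at right end points of the cells is a finite sum of products,
    hence jointly measurable. Right end points recover the values of \<open>U\<close>, for which the
    hypotheses on expectations are stated.\<close>
  define X where "X n z = (\<Sum>k<Suc n. indicator (?I n k) (fst z) * U (grid 1 n (Suc k)) (snd z))" for n z
  have [measurable]: "X n \<in> borel_measurable (lborel \<Otimes>\<^sub>M M)" for n
    unfolding X_def[abs_def]
  proof (intro borel_measurable_sum borel_measurable_times)
    fix k
    show "(\<lambda>z. indicator (?I n k) (fst z) :: real) \<in> borel_measurable (lborel \<Otimes>\<^sub>M M)"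
      by (rule measurable_compose[OF measurable_fst]) auto
    show "(\<lambda>z. U (grid 1 n (Suc k)) (snd z)) \<in> borel_measurable (lborel \<Otimes>\<^sub>M M)"
      by (rule measurable_compose[OF measurable_snd]) (auto intro: UM simp del: of_nat_Suc)
  qed
  \<comment> \<open>\<open>lim\<close> is total and its measurability does not depend on
    convergence, so \<open>Y\<close> is jointly measurable also across the paths that are not
    cadlag.\<close>
  define Y where "Y z = indicator {0<..1} (fst z) * lim (\<lambda>n. X n z)" for z
  have [measurable]: "(\<lambda>z. lim (\<lambda>n. X n z)) \<in> borel_measurable (lborel \<Otimes>\<^sub>M M)" by measurable
  have [measurable]: "Y \<in> borel_measurable (lborel \<Otimes>\<^sub>M M)"
    unfolding Y_def[abs_def]
    by (intro borel_measurable_times measurable_compose[OF measurable_fst]) auto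
  have X_eq: "X n (r, \<omega>) = U (rgrid (?h n) r) \<omega>" if r: "r \<in> {0<..1}" for n r \<omega>
  proof -
    obtain k where k: "k < Suc n" "r \<in> ?I n k" using cell_index_exists[OF r] by blast
    have h: "?h n > 0" by simp
    have ind: "indicator (?I n j) r = (if j = k then 1 else 0 :: real)" for j
      using cells_disjoint[OF h, of j k] k by (auto simp: indicator_def)
    have "X n (r, \<omega>) = (\<Sum>j<Suc n. if j = k then U (grid 1 n (Suc k)) \<omega> else 0)"
      unfolding X_def fst_conv snd_conv ind by (intro sum.cong refl) auto
    also have "\<dots> = U (grid 1 n (Suc k)) \<omega>" using k by simp
    finally show ?thesis using grid_eq(2)[OF h k(2)] by simp
  qed
  have Y_eq: "Y (r, \<omega>) = indicator {0<..1} r * U r \<omega>" if c: "cadlag (\<lambda>t. U t \<omega>)" for r \<omega>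
  proof (cases "r \<in> {0<..1}")
    case True
    have "(\<lambda>n. U (rgrid (?h n) r) \<omega>) \<longlonglongrightarrow> U r \<omega>"
      by (rule cadlag_rgrid[OF c _ zero_less_one]) (use True in auto)
    then have "lim (\<lambda>n. X n (r, \<omega>)) = U r \<omega>" unfolding X_eq[OF True] by (rule limI)
    then show ?thesis by (simp add: Y_def)
  qed (simp add: Y_def)
  have Y_ll: "AE r in lborel. indicator {0<..1} r * left_lim (\<lambda>t. U t \<omega>) r = Y (r, \<omega>)"
    if c: "cadlag (\<lambda>t. U t \<omega>)" for \<omega>
  proof (rule AE_I')
    show "{s\<in>{0<..1}. left_lim (\<lambda>t. U t \<omega>) s \<noteq> U s \<omega>} \<in> null_sets lborel"
      by (rule countable_imp_null_set_lborel[OF countable_jumps[OF c]])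
  qed (auto simp: Y_eq[OF c] indicator_def)
  have Y_AE: "AE \<omega> in M. Y (r, \<omega>) = indicator {0<..1} r * U r \<omega>" for r
    using path by eventually_elim (rule Y_eq)
  have nn: "(\<integral>\<^sup>+\<omega>. \<integral>\<^sup>+r. ennreal \<bar>Y (r, \<omega>)\<bar> \<partial>lborel \<partial>M) \<le> ennreal K"
  proof -
    have "(\<integral>\<^sup>+\<omega>. \<integral>\<^sup>+r. ennreal \<bar>Y (r, \<omega>)\<bar> \<partial>lborel \<partial>M) = (\<integral>\<^sup>+r. \<integral>\<^sup>+\<omega>. ennreal \<bar>Y (r, \<omega>)\<bar> \<partial>M \<partial>lborel)"
      by (rule Fubini) measurable
    also have "\<dots> \<le> (\<integral>\<^sup>+r. ennreal K * indicator {0<..1::real} r \<partial>lborel)"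
    proof (rule nn_integral_mono)
      fix r :: real
      have "(\<integral>\<^sup>+\<omega>. ennreal \<bar>Y (r, \<omega>)\<bar> \<partial>M) = (\<integral>\<^sup>+\<omega>. indicator {0<..1} r * ennreal \<bar>U r \<omega>\<bar> \<partial>M)"
        using Y_AE[of r] by (intro nn_integral_cong_AE) (auto simp: indicator_def)
      also have "\<dots> \<le> ennreal K * indicator {0<..1} r"
        using K[of r] by (auto simp: indicator_def)
      finally show "(\<integral>\<^sup>+\<omega>. ennreal \<bar>Y (r, \<omega>)\<bar> \<partial>M) \<le> ennreal K * indicator {0<..1} r" .
    qed
    also have "\<dots> = ennreal K" by (simp add: nn_integral_cmult_indicator)
    finally show ?thesis .
  qed
  have "(\<integral>\<^sup>+\<omega>. time_integral (\<lambda>t \<omega>. \<bar>U t \<omega>\<bar>) \<omega> \<partial>M) = (\<integral>\<^sup>+\<omega>. \<integral>\<^sup>+r. ennreal \<bar>Y (r, \<omega>)\<bar> \<partial>lborel \<partial>M)"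
  proof (rule nn_integral_cong_AE)
    show "AE \<omega> in M. time_integral (\<lambda>t \<omega>. \<bar>U t \<omega>\<bar>) \<omega> = (\<integral>\<^sup>+r. ennreal \<bar>Y (r, \<omega>)\<bar> \<partial>lborel)"
      using path
    proof eventually_elim
      fix \<omega> assume c: "cadlag (\<lambda>t. U t \<omega>)"
      have l: "left_lim (\<lambda>t. \<bar>U t \<omega>\<bar>) r = \<bar>left_lim (\<lambda>t. U t \<omega>) r\<bar>" if "r \<in> {0<..1}" for r
        by (rule left_lim_compose2[OF c _ that]) (intro continuous_intros)
      show "time_integral (\<lambda>t \<omega>. \<bar>U t \<omega>\<bar>) \<omega> = (\<integral>\<^sup>+r. ennreal \<bar>Y (r, \<omega>)\<bar> \<partial>lborel)"
        unfolding time_integral_def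
        by (rule nn_integral_cong_AE, rule eventually_mono[OF Y_ll[OF c]])
          (auto simp: indicator_def l split: if_splits)
    qed
  qed
  then show "(\<integral>\<^sup>+\<omega>. time_integral (\<lambda>t \<omega>. \<bar>U t \<omega>\<bar>) \<omega> \<partial>M) < \<infinity>"
    using nn by (simp add: order_le_less_trans)
  have Y_int: "integrable (lborel \<Otimes>\<^sub>M M) (\<lambda>(r, \<omega>). Y (r, \<omega>))"
  proof (rule integrableI_bounded)
    have "(\<integral>\<^sup>+z. ennreal (norm (case z of (r, \<omega>) \<Rightarrow> Y (r, \<omega>))) \<partial>(lborel \<Otimes>\<^sub>M M)) = (\<integral>\<^sup>+z. ennreal \<bar>Y z\<bar> \<partial>(lborel \<Otimes>\<^sub>M M))"
      by (intro nn_integral_cong) auto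
    also have "\<dots> = (\<integral>\<^sup>+\<omega>. \<integral>\<^sup>+r. ennreal \<bar>Y (r, \<omega>)\<bar> \<partial>lborel \<partial>M)"
      by (rule nn_integral_snd[symmetric]) measurable
    finally show "(\<integral>\<^sup>+z. ennreal (norm (case z of (r, \<omega>) \<Rightarrow> Y (r, \<omega>))) \<partial>(lborel \<Otimes>\<^sub>M M)) < \<infinity>"
      using nn by (simp add: order_le_less_trans)
  qed simp
  show "(LINT \<omega>|M. (time_real U \<omega>)) = m"
    if m: "\<And>r. r \<in> {0<..1} \<Longrightarrow> (LINT \<omega>|M. U r \<omega>) = m"
  proof -
    have Ysec: "(\<lambda>r. Y (r, \<omega>)) \<in> borel_measurable lborel" if "\<omega> \<in> space M" for \<omega>
      by (rule measurable_compose[OF measurable_Pair2'[OF that]]) measurable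
    have s: "AE \<omega> in M. (time_real U \<omega>) = (LINT r|lborel. Y (r, \<omega>))"
      using path AE_space
    proof eventually_elim
      fix \<omega> assume c: "cadlag (\<lambda>t. U t \<omega>)" and sp: "\<omega> \<in> space M"
      show "(time_real U \<omega>) = (LINT r|lborel. Y (r, \<omega>))"
        unfolding set_lebesgue_integral_def
        by (rule integral_cong_AE)
          (use left_lim_borel_measurable[OF c] Y_ll[OF c] Ysec[OF sp] in auto)
    qed
    have "(LINT \<omega>|M. (time_real U \<omega>)) = (LINT \<omega>|M. LINT r|lborel. Y (r, \<omega>))"
    proof (rule integral_cong_AE[OF _ _ s])
      show m: "(\<lambda>\<omega>. LINT r|lborel. Y (r, \<omega>)) \<in> borel_measurable M"
        by (rule borel_measurable_integrable, rule integrable_snd[OF Y_int, simplified])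
      show "(time_real U) \<in> borel_measurable M"
        by (rule measurable_AE_eq[OF m]) (use s in auto)
    qed
    also have "\<dots> = (LINT r|lborel. LINT \<omega>|M. Y (r, \<omega>))"
      using Fubini_integral[OF Y_int] .
    also have "\<dots> = (LINT r|lborel. indicator {0<..1::real} r * m)"
    proof (intro Bochner_Integration.integral_cong refl)
      fix r :: real
      have "(LINT \<omega>|M. Y (r, \<omega>)) = (LINT \<omega>|M. indicator {0<..1} r * U r \<omega>)"
      proof (cases "r \<in> {0<..1}")
        case True
        show ?thesis
        proof (rule integral_cong_AE[OF _ _ Y_AE])
          show m: "(\<lambda>\<omega>. indicator {0<..1} r * U r \<omega>) \<in> borel_measurable M" using True UM[of r] by auto
          show "(\<lambda>\<omega>. Y (r, \<omega>)) \<in> borel_measurable M"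
            by (rule measurable_AE_eq[OF m]) (use Y_AE[of r] in auto)
        qed
      qed (simp add: Y_def)
      also have "\<dots> = indicator {0<..1} r * m" using m[of r] by (auto simp: indicator_def)
      finally show "(LINT \<omega>|M. Y (r, \<omega>)) = indicator {0<..1} r * m" .
    qed
    also have "\<dots> = m" by simp
    finally show ?thesis .
  qed
qed

end

section \<open>The compensation formula for signed integrands\<close>

context levy_measure_setting
begin

text \<open>A finite expectation of the jump integral forces absolute convergence of the jump series
  almost surely, and on those paths the extended and the real integrals agree.\<close>

lemma compensation_nonneg:
  assumes U: "nonneg_process U" and g: "jump_function g" and int: "integrable \<nu> g"
    and T: "(\<integral>\<^sup>+\<omega>. time_integral U \<omega> \<partial>M) < \<infinity>"
  shows "AE \<omega> in M. set_integrable (count_space UNIV) {0<..1}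
      (\<lambda>r. left_lim (\<lambda>t. U t \<omega>) r * g (jump (\<lambda>t. L t \<omega>) r))"
    and "integrable M (jump_real U g)"
    and "integrable M (time_real U)"
    and "(LINT \<omega>|M. jump_real U g \<omega>) =
      (LINT x|\<nu>. g x) * (LINT \<omega>|M. (time_real U \<omega>))"
proof -
  have gp: "\<And>x. g x \<ge> 0" using g by (auto simp: jump_function_def)
  have Up: "AE \<omega> in M. cadlag (\<lambda>t. U t \<omega>)" "\<And>t \<omega>. t \<ge> 0 \<Longrightarrow> U t \<omega> \<ge> 0"
    using U by (auto simp: nonneg_process_def)
  have G: "(\<integral>\<^sup>+\<omega>. jump_sum_real g 0 1 \<omega> \<partial>M) = ennreal (LINT x|\<nu>. g x)"
    unfolding nn_integral_jump_sum[OF g] by (rule nn_integral_eq_integral[OF int]) (simp add: gp)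
  then have fin: "(\<integral>\<^sup>+\<omega>. jump_sum_real g 0 1 \<omega> \<partial>M) < \<infinity>" by simp
  note C = compensation[OF U g fin] jump_integral_measurable[OF U g fin] time_integral_measurable[OF U g fin]
  have S: "(\<integral>\<^sup>+\<omega>. jump_integral U g \<omega> \<partial>M) < \<infinity>"
    unfolding C(1) using fin T by (simp add: ennreal_mult_less_top)
  have "AE \<omega> in M. jump_integral U g \<omega> \<noteq> \<infinity>"
    by (rule nn_integral_noteq_infinite[OF C(2)]) (use S in auto)
  then have *: "AE \<omega> in M. set_integrable (count_space UNIV) {0<..1}
      (\<lambda>r. left_lim (\<lambda>t. U t \<omega>) r * g (jump (\<lambda>t. L t \<omega>) r)) \<and>
      (jump_integral U g \<omega> = ennreal (jump_real U g \<omega>) \<and>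
      (jump_real U g \<omega>) \<ge> 0) \<and>
      (time_integral U \<omega> = ennreal (time_real U \<omega>) \<and>
      (time_real U \<omega>) \<ge> 0)"
    using Up(1)
  proof eventually_elim
    fix \<omega> assume f: "jump_integral U g \<omega> \<noteq> \<infinity>" and c: "cadlag (\<lambda>t. U t \<omega>)"
    have l: "left_lim (\<lambda>t. U t \<omega>) r \<ge> 0" if "r \<in> {0<..1}" for r
      by (rule left_lim_nonneg[OF c Up(2)]) (use that in auto)
    have "(\<integral>\<^sup>+r\<in>{0<..1}. ennreal \<bar>left_lim (\<lambda>t. U t \<omega>) r * g (jump (\<lambda>t. L t \<omega>) r)\<bar> \<partial>count_space UNIV) = jump_integral U g \<omega>"
      unfolding jump_integral_def using l gp by (intro nn_integral_cong) (auto simp: indicator_def)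
    then have i: "set_integrable (count_space UNIV) {0<..1} (\<lambda>r. left_lim (\<lambda>t. U t \<omega>) r * g (jump (\<lambda>t. L t \<omega>) r))"
      using f by (intro count_space_set_integrable) (simp add: less_top)
    moreover have "jump_integral U g \<omega> = ennreal (jump_real U g \<omega>)"
      unfolding jump_integral_def by (rule set_nn_integral_eq_ennreal[OF i]) (use l gp in auto)
    moreover have "time_integral U \<omega> = ennreal (time_real U \<omega>)"
      by (rule time_integral_eq[where U = U, OF c]) (rule Up(2))
    moreover have "(jump_real U g \<omega>) \<ge> 0"
      "(time_real U \<omega>) \<ge> 0"
      unfolding set_lebesgue_integral_def using l gp
      by (auto intro!: Bochner_Integration.integral_nonneg simp: indicator_def)
    ultimately show "set_integrable (count_space UNIV) {0<..1}
        (\<lambda>r. left_lim (\<lambda>t. U t \<omega>) r * g (jump (\<lambda>t. L t \<omega>) r)) \<and>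
      (jump_integral U g \<omega> = ennreal (jump_real U g \<omega>) \<and>
      (jump_real U g \<omega>) \<ge> 0) \<and>
      (time_integral U \<omega> = ennreal (time_real U \<omega>) \<and>
      (time_real U \<omega>) \<ge> 0)"
      by blast
  qed
  then show "AE \<omega> in M. set_integrable (count_space UNIV) {0<..1}
      (\<lambda>r. left_lim (\<lambda>t. U t \<omega>) r * g (jump (\<lambda>t. L t \<omega>) r))"
    by eventually_elim blast
  have a1: "AE \<omega> in M. jump_integral U g \<omega> = ennreal (jump_real U g \<omega>) \<and>
      (jump_real U g \<omega>) \<ge> 0"
    using * by eventually_elim blast
  have a2: "AE \<omega> in M. time_integral U \<omega> = ennreal (time_real U \<omega>) \<and>
      (time_real U \<omega>) \<ge> 0"
    using * by eventually_elim blast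
  note I = integral_from_ennreal[OF C(2) S a1]
  note J = integral_from_ennreal[OF C(3) T a2]
  show "integrable M (jump_real U g)"
    by (rule I(1))
  show "integrable M (time_real U)"
    by (rule J(1))
  have p: "0 \<le> (LINT x|\<nu>. g x)" by (intro Bochner_Integration.integral_nonneg gp)
  have p': "0 \<le> (LINT \<omega>|M. (time_real U \<omega>))"
    by (intro integral_nonneg_AE) (use a2 in \<open>eventually_elim, blast\<close>)
  have p'': "0 \<le> (LINT \<omega>|M. jump_real U g \<omega>)"
    by (intro integral_nonneg_AE) (use a1 in \<open>eventually_elim, blast\<close>)
  have "ennreal (LINT \<omega>|M. jump_real U g \<omega>) =
      ennreal ((LINT x|\<nu>. g x) * (LINT \<omega>|M. (time_real U \<omega>)))"
    unfolding I(2) C(1) G J(2)[symmetric] by (rule ennreal_mult[symmetric, OF p p'])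
  then show "(LINT \<omega>|M. jump_real U g \<omega>) =
      (LINT x|\<nu>. g x) * (LINT \<omega>|M. (time_real U \<omega>))"
    using p p' p'' by simp
qed

text \<open>Positive and negative parts of \<open>U\<close> and of \<open>g\<close> give four
  nonnegative pairs. Taking parts is continuous and fixes 0, so it commutes with left limits of
  \<open>U\<close> and keeps the parts of \<open>g\<close> jump functions.\<close>

lemma
  assumes U: "cadlag_process U" and T: "(\<integral>\<^sup>+\<omega>. time_integral (\<lambda>t \<omega>. \<bar>U t \<omega>\<bar>) \<omega> \<partial>M) < \<infinity>"
    and g: "continuous_on UNIV g" "g 0 = 0" "integrable \<nu> g"
  shows compensation_set_integrable: "AE \<omega> in M. set_integrable (count_space UNIV) {0<..1}
      (\<lambda>r. left_lim (\<lambda>t. U t \<omega>) r * g (jump (\<lambda>t. L t \<omega>) r))"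
    and compensation_integrable:
      "integrable M (jump_real U g)"
    and compensation_time_integrable: "integrable M (time_real U)"
    and compensation_formula:
      "(LINT \<omega>|M. jump_real U g \<omega>) =
      (LINT x|\<nu>. g x) * (LINT \<omega>|M. (time_real U \<omega>))"
proof -
  have path: "AE \<omega> in M. cadlag (\<lambda>t. U t \<omega>)" using U by (simp add: cadlag_process_def)
  define p n :: "real \<Rightarrow> real" where "p x = max 0 x" and "n x = max 0 (- x)" for x
  have pn_cont: "continuous_on UNIV p" "continuous_on UNIV n"
    unfolding p_def n_def by (intro continuous_intros)+
  have pn: "p x \<ge> 0" "n x \<ge> 0" "p x - n x = x" "p x \<le> \<bar>x\<bar>" "n x \<le> \<bar>x\<bar>" for x
    by (auto simp: p_def n_def)
  define Us where "Us q t \<omega> = q (U t \<omega>)" for q :: "real \<Rightarrow> real" and t \<omega>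
  define gs where "gs q x = q (g x)" for q :: "real \<Rightarrow> real" and x
  have main: "nonneg_process (Us q) \<and> jump_function (gs q') \<and> integrable \<nu> (gs q') \<and>
      (\<integral>\<^sup>+\<omega>. time_integral (Us q) \<omega> \<partial>M) < \<infinity>"
    if q: "q \<in> {p, n}" and q': "q' \<in> {p, n}" for q q'
  proof (intro conjI)
    have qc: "continuous_on UNIV q" "\<And>x. q x \<ge> 0" "\<And>x. q x \<le> \<bar>x\<bar>" using q pn_cont pn by auto
    have qc': "continuous_on UNIV q'" "\<And>x. q' x \<ge> 0" "\<And>x. q' x \<le> \<bar>x\<bar>" using q' pn_cont pn by auto
    show "nonneg_process (Us q)" unfolding Us_def by (rule nonneg_process_compose[OF U qc(1,2)])
    have gc: "continuous_on UNIV (gs q')"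
      unfolding gs_def using continuous_on_compose[OF g(1), of q'] qc'(1) by (simp add: o_def continuous_on_subset)
    have "q' 0 = 0" using qc'(2,3)[of 0] by simp
    then show "jump_function (gs q')"
      using gc qc'(2) g(2) by (simp add: jump_function_def) (simp add: gs_def)
    show "integrable \<nu> (gs q')"
    proof (rule Bochner_Integration.integrable_bound[OF g(3)])
      show "gs q' \<in> borel_measurable \<nu>"
        using borel_measurable_continuous_onI[OF gc] by (simp add: measurable_cong_sets[OF sets_levy_measure])
    qed (use qc' in \<open>auto simp: gs_def\<close>)
    have "(\<integral>\<^sup>+\<omega>. time_integral (Us q) \<omega> \<partial>M) \<le> (\<integral>\<^sup>+\<omega>. time_integral (\<lambda>t \<omega>. \<bar>U t \<omega>\<bar>) \<omega> \<partial>M)"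
    proof (rule nn_integral_mono_AE, use path in eventually_elim)
      fix \<omega> assume c: "cadlag (\<lambda>t. U t \<omega>)"
      have "left_lim (\<lambda>t. Us q t \<omega>) r = q (left_lim (\<lambda>t. U t \<omega>) r)"
        "left_lim (\<lambda>t. \<bar>U t \<omega>\<bar>) r = \<bar>left_lim (\<lambda>t. U t \<omega>) r\<bar>" if "r \<in> {0<..1}" for r
        unfolding Us_def using that
        by (auto intro!: left_lim_compose2[OF c] qc(1) continuous_intros)
      then show "time_integral (Us q) \<omega> \<le> time_integral (\<lambda>t \<omega>. \<bar>U t \<omega>\<bar>) \<omega>"
        unfolding time_integral_def using qc(3)
        by (intro nn_integral_mono) (auto simp: indicator_def intro!: ennreal_leI)
    qed
    then show "(\<integral>\<^sup>+\<omega>. time_integral (Us q) \<omega> \<partial>M) < \<infinity>" using T by (rule order_le_less_trans)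
  qed
  have C: "AE \<omega> in M. set_integrable (count_space UNIV) {0<..1} (\<lambda>r. left_lim (\<lambda>t. Us q t \<omega>) r * gs q' (jump (\<lambda>t. L t \<omega>) r))"
    "integrable M (\<lambda>\<omega>. LINT r:{0<..1}|count_space UNIV. left_lim (\<lambda>t. Us q t \<omega>) r * gs q' (jump (\<lambda>t. L t \<omega>) r))"
    "integrable M (\<lambda>\<omega>. LINT r:{0<..1}|lborel. left_lim (\<lambda>t. Us q t \<omega>) r)"
    "(LINT \<omega>|M. (LINT r:{0<..1}|count_space UNIV. left_lim (\<lambda>t. Us q t \<omega>) r * gs q' (jump (\<lambda>t. L t \<omega>) r))) =
      (LINT x|\<nu>. gs q' x) * (LINT \<omega>|M. (LINT r:{0<..1}|lborel. left_lim (\<lambda>t. Us q t \<omega>) r))"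
    and gi: "integrable \<nu> (gs q')"
    if "q \<in> {p, n}" "q' \<in> {p, n}" for q q'
    using compensation_nonneg[of "Us q" "gs q'"] main[OF that] by auto
  have in_pn: "p \<in> {p, n}" "n \<in> {p, n}" by auto
  let ?S = "\<lambda>q q' \<omega>. LINT r:{0<..1}|count_space UNIV. left_lim (\<lambda>t. Us q t \<omega>) r * gs q' (jump (\<lambda>t. L t \<omega>) r)"
  let ?T = "\<lambda>q \<omega>. LINT r:{0<..1}|lborel. left_lim (\<lambda>t. Us q t \<omega>) r"
  let ?s = "\<lambda>\<omega>. LINT r:{0<..1}|count_space UNIV. left_lim (\<lambda>t. U t \<omega>) r * g (jump (\<lambda>t. L t \<omega>) r)"
  let ?t = "\<lambda>\<omega>. LINT r:{0<..1}|lborel. left_lim (\<lambda>t. U t \<omega>) r"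
  have dec: "AE \<omega> in M. set_integrable (count_space UNIV) {0<..1}
      (\<lambda>r. left_lim (\<lambda>t. U t \<omega>) r * g (jump (\<lambda>t. L t \<omega>) r)) \<and>
      ?S p p \<omega> - ?S p n \<omega> - ?S n p \<omega> + ?S n n \<omega> = ?s \<omega> \<and> ?T p \<omega> - ?T n \<omega> = ?t \<omega>"
    using path C(1)[OF in_pn(1,1)] C(1)[OF in_pn(1,2)] C(1)[OF in_pn(2,1)] C(1)[OF in_pn(2,2)]
  proof eventually_elim
    case (elim \<omega>)
    note c = elim(1)
    have i: "set_integrable (count_space UNIV) {0<..1} (\<lambda>r. left_lim (\<lambda>t. Us q t \<omega>) r * gs q' (jump (\<lambda>t. L t \<omega>) r))"
      if "q \<in> {p, n}" "q' \<in> {p, n}" for q q' using elim that by auto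
    have l: "left_lim (\<lambda>t. Us q t \<omega>) r = q (left_lim (\<lambda>t. U t \<omega>) r)" if "r \<in> {0<..1}" "q \<in> {p, n}" for r q
      unfolding Us_def using that pn_cont by (intro left_lim_compose2[OF c]) auto
    have ll: "left_lim (\<lambda>t. U t \<omega>) r = left_lim (\<lambda>t. Us p t \<omega>) r - left_lim (\<lambda>t. Us n t \<omega>) r" if "r \<in> {0<..1}" for r
      using l[OF that, of p] l[OF that, of n] pn(3) by simp
    have gg: "g x = gs p x - gs n x" for x by (simp add: gs_def pn)
    let ?f = "\<lambda>q q' r. left_lim (\<lambda>t. Us q t \<omega>) r * gs q' (jump (\<lambda>t. L t \<omega>) r)"
    have sum: "?f p p r - ?f p n r - ?f n p r + ?f n n r = left_lim (\<lambda>t. U t \<omega>) r * g (jump (\<lambda>t. L t \<omega>) r)"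
      if "r \<in> {0<..1}" for r
      unfolding gg ll[OF that] by (simp add: algebra_simps)
    have i_sum: "set_integrable (count_space UNIV) {0<..1} (\<lambda>r. ?f p p r - ?f p n r - ?f n p r + ?f n n r)"
      by (intro set_integral_add set_integral_diff i) auto
    have "set_integrable (count_space UNIV) {0<..1} (\<lambda>r. left_lim (\<lambda>t. U t \<omega>) r * g (jump (\<lambda>t. L t \<omega>) r))"
      by (rule set_integrable_cong[THEN iffD1, OF refl refl _ i_sum]) (rule sum)
    moreover have "?S p p \<omega> - ?S p n \<omega> - ?S n p \<omega> + ?S n n \<omega> = ?s \<omega>"
    proof -
      have "?s \<omega> = (LINT r:{0<..1}|count_space UNIV. ?f p p r - ?f p n r - ?f n p r + ?f n n r)"
        using sum by (intro set_lebesgue_integral_cong) auto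
      also have "\<dots> = ?S p p \<omega> - ?S p n \<omega> - ?S n p \<omega> + ?S n n \<omega>"
        using i[of p p] i[of p n] i[of n p] i[of n n] by (simp add: set_integral_add set_integral_diff)
      finally show ?thesis by simp
    qed
    moreover have "?T p \<omega> - ?T n \<omega> = ?t \<omega>"
    proof -
      have il: "set_integrable lborel {0<..1} (left_lim (\<lambda>t. Us q t \<omega>))" if "q \<in> {p, n}" for q
        unfolding Us_def using that pn_cont by (intro lborel_left_lim_integrable cadlag_compose(1)[OF c]) auto
      have "?t \<omega> = (LINT r:{0<..1}|lborel. left_lim (\<lambda>t. Us p t \<omega>) r - left_lim (\<lambda>t. Us n t \<omega>) r)"
        using ll by (intro set_lebesgue_integral_cong) auto
      also have "\<dots> = ?T p \<omega> - ?T n \<omega>" using il[of p] il[of n] by (simp add: set_integral_diff)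
      finally show ?thesis by simp
    qed
    ultimately show ?case by blast
  qed
  then show "AE \<omega> in M. set_integrable (count_space UNIV) {0<..1}
      (\<lambda>r. left_lim (\<lambda>t. U t \<omega>) r * g (jump (\<lambda>t. L t \<omega>) r))"
    by eventually_elim blast
  have Si: "integrable M (\<lambda>\<omega>. ?S p p \<omega> - ?S p n \<omega> - ?S n p \<omega> + ?S n n \<omega>)"
    by (intro Bochner_Integration.integrable_add Bochner_Integration.integrable_diff C(2)) auto
  have Ti: "integrable M (\<lambda>\<omega>. ?T p \<omega> - ?T n \<omega>)"
    by (intro Bochner_Integration.integrable_diff C(3)[of _ p]) auto
  have d1: "AE \<omega> in M. ?S p p \<omega> - ?S p n \<omega> - ?S n p \<omega> + ?S n n \<omega> = ?s \<omega>"
    and d2: "AE \<omega> in M. ?T p \<omega> - ?T n \<omega> = ?t \<omega>"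
    using dec by (eventually_elim, blast)+
  have sm: "?s \<in> borel_measurable M" by (rule measurable_AE_eq[OF borel_measurable_integrable[OF Si] d1]) simp
  have tm: "?t \<in> borel_measurable M" by (rule measurable_AE_eq[OF borel_measurable_integrable[OF Ti] d2]) simp
  show "integrable M ?s" using integrable_cong_AE[OF borel_measurable_integrable[OF Si] sm d1] Si by blast
  show "integrable M ?t" using integrable_cong_AE[OF borel_measurable_integrable[OF Ti] tm d2] Ti by blast
  have s: "(LINT \<omega>|M. ?s \<omega>) = (LINT \<omega>|M. ?S p p \<omega> - ?S p n \<omega> - ?S n p \<omega> + ?S n n \<omega>)"
    by (rule integral_cong_AE[OF borel_measurable_integrable[OF Si] sm d1, symmetric])
  have t: "(LINT \<omega>|M. ?t \<omega>) = (LINT \<omega>|M. ?T p \<omega> - ?T n \<omega>)"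
    by (rule integral_cong_AE[OF borel_measurable_integrable[OF Ti] tm d2, symmetric])
  have gint: "(LINT x|\<nu>. g x) = (LINT x|\<nu>. gs p x) - (LINT x|\<nu>. gs n x)"
    using gi[of p p] gi[of p n] by (subst Bochner_Integration.integral_diff[symmetric]) (auto simp: gs_def pn)
  show "(LINT \<omega>|M. ?s \<omega>) = (LINT x|\<nu>. g x) * (LINT \<omega>|M. ?t \<omega>)"
    unfolding s t gint using C(2)[of p p] C(2)[of p n] C(2)[of n p] C(2)[of n n] C(3)[of p p] C(3)[of n p]
    by (simp add: C(4) algebra_simps)
qed

end

section \<open>Moment equations of the volatility process\<close>

lemma integrable_vecI:
  fixes f :: "'a \<Rightarrow> 'b::euclidean_space^'n"
  assumes "\<And>i. integrable M (\<lambda>x. f x $ i)"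
  shows "integrable M f"
proof -
  have bl: "bounded_linear (axis i :: 'b \<Rightarrow> 'b^'n)" for i
    by (rule linear_conv_bounded_linear[THEN iffD1]) (auto intro!: linearI simp: axis_def vec_eq_iff)
  have eq: "f = (\<lambda>x. \<Sum>i\<in>UNIV. axis i (f x $ i))"
    by (simp add: fun_eq_iff vec_eq_iff axis_def if_distrib cong: if_cong)
  show ?thesis
    by (subst eq) (intro Bochner_Integration.integrable_sum integrable_bounded_linear[OF bl] assms)
qed

lemma integral_nth:
  fixes f :: "'a \<Rightarrow> 'b::euclidean_space^'n"
  assumes "integrable M f"
  shows "(LINT x|M. f x) $ i = (LINT x|M. f x $ i)" "integrable M (\<lambda>x. f x $ i)"
  using integral_bounded_linear[OF bounded_linear_vec_nth assms, of i]
    integrable_bounded_linear[OF bounded_linear_vec_nth assms, of i] by simp_all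

lemma Icc_integral_eq_Ioc:
  fixes f :: "real \<Rightarrow> real"
  assumes "set_integrable lborel {0<..t} f" "t \<ge> 0"
  shows "set_integrable lborel {0..t} f" "(LINT s:{0..t}|lborel. f s) = (LINT s:{0<..t}|lborel. f s)"
proof -
  have eq: "indicator {0..t} s *\<^sub>R f s = indicator {0<..t} s *\<^sub>R f s + indicator {0} s * f 0" for s
    using assms(2) by (auto simp: indicator_def)
  have i: "integrable lborel (\<lambda>s::real. indicator {0} s * f 0)" by simp
  show "set_integrable lborel {0..t} f"
    unfolding set_integrable_def eq using assms(1) i
    by (intro Bochner_Integration.integrable_add) (auto simp: set_integrable_def)
  show "(LINT s:{0..t}|lborel. f s) = (LINT s:{0<..t}|lborel. f s)"
    unfolding set_lebesgue_integral_def eq using assms(1) i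
    by (subst Bochner_Integration.integral_add) (auto simp: set_integrable_def)
qed

lemma outer_nth: "outer x y $ i $ j = x $ i * y $ j"
  by (simp add: outer_def)

lemma stack_nth: "stack X $ (i, j) = X $ j $ i"
  by (simp add: stack_def)

lemma continuous_on_vec_nth2: "continuous_on S f \<Longrightarrow> continuous_on S (\<lambda>x. f x $ i $ j)"
  by (intro continuous_on_component)

lemma continuous_on_matrix_mult:
  fixes f :: "'a::topological_space \<Rightarrow> real^'n^'m" and g :: "'a \<Rightarrow> real^'k^'n"
  assumes "continuous_on S f" "continuous_on S g"
  shows "continuous_on S (\<lambda>x. f x ** g x)"
  unfolding matrix_matrix_mult_def
  by (intro continuous_on_vec_lambda continuous_intros assms continuous_on_vec_nth2)

definition psd_part :: "real^'n^'n \<Rightarrow> real^'n^'n"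
  where "psd_part y = closest_point {V. psd V} y"

lemma psd_psd_part: "psd (psd_part y)"
  using closest_point_in_set[OF closed_psd, of y] psd_zero by (auto simp: psd_part_def)

lemma psd_part_id: "psd y \<Longrightarrow> psd_part y = y"
  unfolding psd_part_def by (intro closest_point_self) simp

lemma continuous_on_psd_part: "continuous_on UNIV psd_part"
  unfolding psd_part_def
  by (intro continuous_on_closest_point convex_psd closed_psd) (use psd_zero in auto)

text \<open>The infinite sum takes a default value when it does not converge, so all entries are
  required to be summable before a component is taken out of the matrix-valued sum. The closed
  interval may be replaced by the half-open one because the convention for \<open>left_lim\<close>
  at 0 gives no jump there.\<close>

lemma disc_quad_var_component:
  fixes l :: "real \<Rightarrow> real^'d"
  assumes int: "\<And>k l'. set_integrable (count_space UNIV) {0<..1} (\<lambda>r. jump l r $ k * jump l r $ l')"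
    and t: "0 \<le> t" "t \<le> 1"
  shows "disc_quad_var l t $ k $ k' = (LINT r:{0<..t}|count_space UNIV. jump l r $ k * jump l r $ k')"
proof -
  have j0: "jump l 0 = 0" by (simp add: jump_def left_lim_def)
  have int': "set_integrable (count_space UNIV) {0..t} (\<lambda>r. jump l r $ k * jump l r $ l')" for k l'
  proof -
    have "set_integrable (count_space UNIV) {0<..t} (\<lambda>r. jump l r $ k * jump l r $ l')"
      by (rule set_integrable_subset[OF int]) (use t in auto)
    then show ?thesis
      unfolding set_integrable_def
      by (rule Bochner_Integration.integrable_cong[THEN iffD1, rotated -1]) (auto simp: indicator_def j0)
  qed
  have "set_integrable (count_space UNIV) {0..t} (\<lambda>r. outer (jump l r) (jump l r))"
    unfolding set_integrable_def
    by (intro integrable_vecI) (use int' in \<open>simp add: set_integrable_def outer_nth\<close>)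
  then have s: "(\<lambda>r. outer (jump l r) (jump l r)) summable_on {0..t}"
    using abs_summable_equivalent abs_summable_summable abs_summable_on_altdef by blast
  have bl: "bounded_linear (\<lambda>X :: real^'d^'d. X $ k $ k')"
    by (intro bounded_linear_compose[OF bounded_linear_vec_nth bounded_linear_vec_nth])
  have "disc_quad_var l t $ k $ k' = (\<Sum>\<^sub>\<infinity>r\<in>{0..t}. outer (jump l r) (jump l r) $ k $ k')"
    unfolding disc_quad_var_def
    using infsum_bounded_linear_strong[OF _ bl, of "\<lambda>r. outer (jump l r) (jump l r)" "{0..t}"]
      s summable_on_bounded_linear[OF bl s] by simp
  also have "\<dots> = infsetsum (\<lambda>r. jump l r $ k * jump l r $ k') {0..t}"
    unfolding outer_nth using int'[of k k']
    by (intro infsetsum_infsum[symmetric]) (simp add: abs_summable_on_altdef)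
  also have "\<dots> = (LINT r:{0..t}|count_space UNIV. jump l r $ k * jump l r $ k')"
    by (rule infsetsum_altdef)
  also have "\<dots> = (LINT r:{0<..t}|count_space UNIV. jump l r $ k * jump l r $ k')"
    unfolding set_lebesgue_integral_def
    by (intro Bochner_Integration.integral_cong) (auto simp: indicator_def j0)
  finally show ?thesis .
qed

locale mucogarch_setting = levy_measure_setting M F L \<nu>
  for M :: "'a measure" and F and L :: "real \<Rightarrow> 'a \<Rightarrow> real^'d" and \<nu> +
  fixes Y :: "real \<Rightarrow> 'a \<Rightarrow> real^'d^'d" and A B C :: "real^'d^'d" and \<sigma> \<rho> :: real
  assumes pos_def: "pos_def C" and solution: "mucogarch_volatility M F L A B C Y"
    and stationary: "second_order_stationary M Y"
    and second_moment: "has_bochner_integral \<nu> (\<lambda>x. outer x x) (\<sigma> *\<^sub>R mat 1)"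
    and fourth_moment: "has_bochner_integral \<nu> (\<lambda>x. outer (stack (outer x x)) (stack (outer x x)))
           (\<rho> *\<^sub>R (mat 1 + commutation_matrix + outer (stack (mat 1)) (stack (mat 1))))"
begin

text \<open>\<open>psd_part\<close> makes the volatility factor continuous on all matrices without changing it on the
  state space.\<close>

definition vol :: "real^'d^'d \<Rightarrow> real^'d^'d"
  where "vol y = A ** psd_sqrt (C + psd_part y)"

definition cov_jump :: "real^'d^'d \<Rightarrow> real^'d^'d"
  where "cov_jump y = A ** (C + y) ** transpose A"

definition drift :: "real^'d^'d \<Rightarrow> real^'d^'d"
  where "drift y = B ** y + y ** transpose B"

lemma psd_C_add: "psd y \<Longrightarrow> psd (C + y)"
  using psd_add[OF pos_def_imp_psd[OF pos_def]] .

lemma continuous_on_vol: "continuous_on UNIV (\<lambda>y. vol y $ i $ k)"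
proof -
  have "continuous_on UNIV (\<lambda>y. psd_sqrt (C + psd_part y))"
    by (rule continuous_on_compose2[OF continuous_on_psd_sqrt])
      (auto intro!: continuous_intros continuous_on_psd_part psd_C_add psd_psd_part)
  then show ?thesis
    unfolding vol_def by (intro continuous_on_vec_nth2 continuous_on_matrix_mult continuous_on_const)
qed

text \<open>Here the square root disappears: the factor times its transpose is A (C + y) A^T, with
  symmetry of the root turning the transpose into a second copy of it.\<close>

lemma vol_square:
  assumes "psd y"
  shows "(\<Sum>k\<in>UNIV. vol y $ i $ k * vol y $ j $ k) = cov_jump y $ i $ j"
proof -
  let ?S = "psd_sqrt (C + y)"
  have v: "vol y = A ** ?S" using psd_part_id[OF assms] by (simp add: vol_def)
  have "transpose ?S = ?S" using psd_psd_sqrt[OF psd_C_add[OF assms]] by (simp add: psd_def)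
  then have "vol y ** transpose (vol y) = A ** (?S ** ?S) ** transpose A"
    by (simp add: v matrix_transpose_mul matrix_mul_assoc)
  also have "\<dots> = cov_jump y" by (simp add: psd_sqrt_square[OF psd_C_add[OF assms]] cov_jump_def)
  finally have "(vol y ** transpose (vol y)) $ i $ j = cov_jump y $ i $ j" by simp
  then show ?thesis by (simp add: matrix_matrix_mult_def transpose_def)
qed

text \<open>Continuity is asked on the whole space, so that composition with a path commutes with
  left limits; the polynomial bound is asked only where \<open>Y\<close> takes its values. Degree 2
  is what the second moments of \<open>Y\<close> control.\<close>

definition growth :: "nat \<Rightarrow> (real^'d^'d \<Rightarrow> real) \<Rightarrow> bool"
  where "growth n \<phi> \<longleftrightarrow> continuous_on UNIV \<phi> \<and> (\<exists>c. \<forall>y. psd y \<longrightarrow> \<bar>\<phi> y\<bar> \<le> c * (1 + norm y) ^ n)"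

lemma growthD:
  assumes "growth n \<phi>"
  obtains c where "c \<ge> 0" "\<And>y. psd y \<Longrightarrow> \<bar>\<phi> y\<bar> \<le> c * (1 + norm y) ^ n"
proof -
  obtain c where c: "\<And>y. psd y \<Longrightarrow> \<bar>\<phi> y\<bar> \<le> c * (1 + norm y) ^ n" using assms by (auto simp: growth_def)
  have "\<bar>\<phi> y\<bar> \<le> \<bar>c\<bar> * (1 + norm y) ^ n" if "psd y" for y
    using c[OF that] by (rule order_trans) (intro mult_right_mono, auto)
  then show ?thesis using that[of "\<bar>c\<bar>"] by simp
qed

lemma growth_continuous: "growth n \<phi> \<Longrightarrow> continuous_on UNIV \<phi>"
  by (simp add: growth_def)

lemma growth_mult:
  assumes "growth n \<phi>" "growth m \<psi>"
  shows "growth (n + m) (\<lambda>y. \<phi> y * \<psi> y)"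
proof -
  obtain c where c: "c \<ge> 0" "\<And>y. psd y \<Longrightarrow> \<bar>\<phi> y\<bar> \<le> c * (1 + norm y) ^ n" using growthD[OF assms(1)] by blast
  obtain d where d: "d \<ge> 0" "\<And>y. psd y \<Longrightarrow> \<bar>\<psi> y\<bar> \<le> d * (1 + norm y) ^ m" using growthD[OF assms(2)] by blast
  have "\<bar>\<phi> y * \<psi> y\<bar> \<le> (c * d) * (1 + norm y) ^ (n + m)" if "psd y" for y
  proof -
    have "\<bar>\<phi> y\<bar> * \<bar>\<psi> y\<bar> \<le> (c * (1 + norm y) ^ n) * (d * (1 + norm y) ^ m)"
      using c d that by (intro mult_mono) auto
    then show ?thesis by (simp add: abs_mult power_add mult_ac)
  qed
  then show ?thesis using assms unfolding growth_def by (auto intro!: continuous_intros)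
qed

lemma growth_add:
  assumes "growth n \<phi>" "growth n \<psi>"
  shows "growth n (\<lambda>y. \<phi> y + \<psi> y)"
proof -
  obtain c where c: "c \<ge> 0" "\<And>y. psd y \<Longrightarrow> \<bar>\<phi> y\<bar> \<le> c * (1 + norm y) ^ n" using growthD[OF assms(1)] by blast
  obtain d where d: "d \<ge> 0" "\<And>y. psd y \<Longrightarrow> \<bar>\<psi> y\<bar> \<le> d * (1 + norm y) ^ n" using growthD[OF assms(2)] by blast
  have "\<bar>\<phi> y + \<psi> y\<bar> \<le> (c + d) * (1 + norm y) ^ n" if "psd y" for y
    using c(2)[OF that] d(2)[OF that] by (simp add: distrib_right)
  then show ?thesis using assms unfolding growth_def by (auto intro!: continuous_intros)
qed

lemma growth_const: "growth n (\<lambda>_. c)"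
proof -
  have "\<bar>c\<bar> \<le> \<bar>c\<bar> * (1 + norm y) ^ n" for y :: "real^'d^'d"
    using mult_left_mono[of 1 "(1 + norm y) ^ n" "\<bar>c\<bar>"] by (simp add: one_le_power)
  then show ?thesis unfolding growth_def by auto
qed

lemma growth_cmult: "growth n \<phi> \<Longrightarrow> growth n (\<lambda>y. c * \<phi> y)"
  using growth_mult[OF growth_const[of 0 c], of n \<phi>] by simp

lemma growth_sum: "finite I \<Longrightarrow> (\<And>i. i \<in> I \<Longrightarrow> growth n (\<phi> i)) \<Longrightarrow> growth n (\<lambda>y. \<Sum>i\<in>I. \<phi> i y)"
  by (induction I rule: finite_induct) (auto intro: growth_add growth_const)

lemma growth_mono:
  assumes "growth n \<phi>" "n \<le> m"
  shows "growth m \<phi>"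
  using growth_mult[OF assms(1) growth_const[of "m - n" 1]] assms(2) by simp

lemma growth_nth: "growth 1 (\<lambda>y. y $ i $ j)"
proof -
  have "\<bar>y $ i $ j\<bar> \<le> 1 * (1 + norm y) ^ 1" for y :: "real^'d^'d"
    using norm_matrix_nth_le[of y i j] by simp
  then show ?thesis
    unfolding growth_def by (intro conjI continuous_on_vec_nth2 continuous_on_id exI[of _ 1]) auto
qed

lemma growth_cov_jump: "growth 1 (\<lambda>y. cov_jump y $ i $ j)"
proof -
  have "cov_jump y $ i $ j = (\<Sum>k\<in>UNIV. \<Sum>l\<in>UNIV. (A $ i $ l * A $ j $ k) * (C $ l $ k + y $ l $ k))" for y
    by (simp add: cov_jump_def matrix_matrix_mult_def transpose_def sum_distrib_left sum_distrib_right mult_ac)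
  then show ?thesis
    by (simp only:) (intro growth_sum growth_cmult growth_add growth_const growth_nth finite)
qed

lemma growth_drift: "growth 1 (\<lambda>y. drift y $ i $ j)"
proof -
  have "drift y $ i $ j = (\<Sum>k\<in>UNIV. B $ i $ k * y $ k $ j) + (\<Sum>k\<in>UNIV. B $ j $ k * y $ i $ k)" for y
    by (simp add: drift_def matrix_matrix_mult_def transpose_def mult.commute)
  then show ?thesis
    by (simp only:) (intro growth_sum growth_cmult growth_add growth_nth finite)
qed

text \<open>The square of one entry is a summand of a diagonal entry of \<open>cov_jump\<close>,
  which is affine in the state; the arithmetic-geometric mean inequality then bounds the
  product.\<close>

lemma growth_vol: "growth 1 (\<lambda>y. vol y $ i $ k * vol y $ j $ l)"
proof -
  obtain c where c: "\<And>y. psd y \<Longrightarrow> \<bar>cov_jump y $ i $ i\<bar> \<le> c * (1 + norm y) ^ 1"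
    using growthD[OF growth_cov_jump[of i i]] by blast
  obtain d where d: "\<And>y. psd y \<Longrightarrow> \<bar>cov_jump y $ j $ j\<bar> \<le> d * (1 + norm y) ^ 1"
    using growthD[OF growth_cov_jump[of j j]] by blast
  have "\<bar>vol y $ i $ k * vol y $ j $ l\<bar> \<le> (c + d) * (1 + norm y) ^ 1" if "psd y" for y
  proof -
    have sq: "(vol y $ i $ k)\<^sup>2 \<le> cov_jump y $ i $ i" for i k
      unfolding vol_square[OF that, symmetric] power2_eq_square
      by (rule member_le_sum[where f = "\<lambda>k. vol y $ i $ k * vol y $ i $ k"]) auto
    have "2 * \<bar>vol y $ i $ k * vol y $ j $ l\<bar> \<le> (vol y $ i $ k)\<^sup>2 + (vol y $ j $ l)\<^sup>2"
      using sum_squares_bound[of "\<bar>vol y $ i $ k\<bar>" "\<bar>vol y $ j $ l\<bar>"] by (simp add: abs_mult)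
    also have "\<dots> \<le> cov_jump y $ i $ i + cov_jump y $ j $ j" by (intro add_mono sq)
    also have "\<dots> \<le> (c + d) * (1 + norm y)" using c[OF that] d[OF that] by (simp add: distrib_right)
    finally show ?thesis by simp
  qed
  then show ?thesis unfolding growth_def by (auto intro!: continuous_intros continuous_on_vol)
qed

section \<open>Integrability and constancy of moments along the solution\<close>

lemma Y_paths: "AE \<omega> in M. cadlag (\<lambda>t. Y t \<omega>) \<and> (\<forall>t\<ge>0. psd (Y t \<omega>))"
proof -
  have "AE \<omega> in M. cadlag (\<lambda>t. Y t \<omega>) \<and> (\<forall>t\<ge>0. psd (Y t \<omega>)) \<and>
       (let Yl = left_lim (\<lambda>t. Y t \<omega>) in
        \<forall>t\<ge>0. \<exists>J.
          has_matrix_LS_integral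
            (\<lambda>s. A ** psd_sqrt (C + Yl s))
            (disc_quad_var (\<lambda>t. L t \<omega>))
            (\<lambda>s. psd_sqrt (C + Yl s) ** transpose A) t J \<and>
          Y t \<omega> = Y 0 \<omega> + (LINT s:{0..t}|lborel. B ** Yl s + Yl s ** transpose B) + J)"
    using solution by (simp add: mucogarch_volatility_def)
  then show ?thesis by (rule eventually_mono) blast
qed

lemma psd_left_lim:
  assumes c: "cadlag (\<lambda>t. Y t \<omega>)" and p: "\<And>t. t \<ge> 0 \<Longrightarrow> psd (Y t \<omega>)" and s: "s > 0"
  shows "psd (left_lim (\<lambda>t. Y t \<omega>) s)"
proof -
  have "left_lim (\<lambda>t. Y t \<omega>) s \<in> {V. psd V}"
  proof (rule Lim_in_closed_set[OF closed_psd _ _ cadlag_left_lim[OF c s]])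
    show "\<forall>\<^sub>F x in at_left s. Y x \<omega> \<in> {V. psd V}"
      using eventually_at_left_real[OF s] by eventually_elim (auto intro!: p)
  qed simp
  then show ?thesis by simp
qed

lemma Y_measurable: "t \<ge> 0 \<Longrightarrow> Y t \<in> borel_measurable M"
  and Y_square_integrable: "t \<ge> 0 \<Longrightarrow> integrable M (\<lambda>\<omega>. (norm (Y t \<omega>))\<^sup>2)"
  and Y_mean: "t \<ge> 0 \<Longrightarrow> (LINT \<omega>|M. Y t \<omega>) = (LINT \<omega>|M. Y 0 \<omega>)"
  using stationary unfolding second_order_stationary_def by blast+

lemma growth_cadlag_process:
  assumes "growth n \<phi>"
  shows "cadlag_process (\<lambda>t \<omega>. \<phi> (Y t \<omega>))"
  unfolding cadlag_process_def adapted_def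
proof (intro conjI allI impI)
  note c = growth_continuous[OF assms]
  show "(\<lambda>\<omega>. \<phi> (Y t \<omega>)) \<in> borel_measurable (F t)" if "t \<ge> 0" for t
    using solution that unfolding mucogarch_volatility_def adapted_def
    by (intro measurable_compose[OF _ borel_measurable_continuous_onI[OF c]]) auto
  show "AE \<omega> in M. cadlag (\<lambda>t. \<phi> (Y t \<omega>))"
    using Y_paths by eventually_elim (rule cadlag_compose(1)[OF _ c], blast)
qed

lemma growth_integrable:
  assumes "growth 2 \<phi>" "t \<ge> 0"
  shows "integrable M (\<lambda>\<omega>. \<phi> (Y t \<omega>))"
proof -
  obtain c where c: "c \<ge> 0" "\<And>y. psd y \<Longrightarrow> \<bar>\<phi> y\<bar> \<le> c * (1 + norm y)\<^sup>2" using growthD[OF assms(1)] by blast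
  have "integrable M (\<lambda>\<omega>. c * (2 + 2 * (norm (Y t \<omega>))\<^sup>2))"
    by (intro integrable_mult_right Bochner_Integration.integrable_add Y_square_integrable assms) auto
  then show ?thesis
  proof (rule Bochner_Integration.integrable_bound)
    show "(\<lambda>\<omega>. \<phi> (Y t \<omega>)) \<in> borel_measurable M"
      by (rule measurable_compose[OF Y_measurable[OF assms(2)] borel_measurable_continuous_onI[OF growth_continuous[OF assms(1)]]])
    show "AE \<omega> in M. norm (\<phi> (Y t \<omega>)) \<le> norm (c * (2 + 2 * (norm (Y t \<omega>))\<^sup>2))"
      using Y_paths
    proof eventually_elim
      fix \<omega> assume "cadlag (\<lambda>t. Y t \<omega>) \<and> (\<forall>t\<ge>0. psd (Y t \<omega>))"
      then have "\<bar>\<phi> (Y t \<omega>)\<bar> \<le> c * (1 + norm (Y t \<omega>))\<^sup>2" using assms(2) by (intro c(2)) auto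
      also have "\<dots> \<le> c * (2 + 2 * (norm (Y t \<omega>))\<^sup>2)"
        using sum_squares_bound[of 1 "norm (Y t \<omega>)"] c(1)
        by (intro mult_left_mono) (auto simp: power2_sum)
      finally show "norm (\<phi> (Y t \<omega>)) \<le> norm (c * (2 + 2 * (norm (Y t \<omega>))\<^sup>2))" by simp
    qed
  qed
qed

lemma Y_integrable: "t \<ge> 0 \<Longrightarrow> integrable M (Y t)"
  by (intro integrable_vecI growth_integrable[OF growth_mono[OF growth_nth]]) auto

lemma Y_nth_mean: "t \<ge> 0 \<Longrightarrow> (LINT \<omega>|M. Y t \<omega> $ i $ j) = (LINT \<omega>|M. Y 0 \<omega>) $ i $ j"
proof -
  assume t: "t \<ge> 0"
  have "(LINT \<omega>|M. Y t \<omega> $ i $ j) = (LINT \<omega>|M. Y t \<omega>) $ i $ j"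
    using integral_nth[OF Y_integrable[OF t]] integral_nth(1)[OF integral_nth(2)[OF Y_integrable[OF t]]] by simp
  then show ?thesis by (simp add: Y_mean[OF t])
qed

lemma growth_nth_mult: "growth 2 (\<lambda>y. y $ i $ j * y $ k $ l)"
  using growth_mult[OF growth_nth growth_nth] by (simp add: numeral_2_eq_2)

lemma outer_integrable: "t \<ge> 0 \<Longrightarrow> integrable M (\<lambda>\<omega>. outer (stack (Y t \<omega>)) (stack (Y t \<omega>)))"
  by (intro integrable_vecI) (simp add: outer_nth stack_def growth_integrable[OF growth_nth_mult])

lemma stack_integrable: "t \<ge> 0 \<Longrightarrow> integrable M (\<lambda>\<omega>. stack (Y t \<omega>))"
  by (intro integrable_vecI) (simp add: stack_def growth_integrable[OF growth_mono[OF growth_nth]])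

lemma stack_mean: "t \<ge> 0 \<Longrightarrow> (LINT \<omega>|M. stack (Y t \<omega>)) = stack (LINT \<omega>|M. Y 0 \<omega>)"
  by (simp add: vec_eq_iff integral_nth[OF stack_integrable]) (simp add: stack_def Y_nth_mean)

text \<open>The covariance condition at lag 0, combined with the constant mean, fixes the uncentred
  second moments.\<close>

lemma outer_mean:
  assumes "t \<ge> 0"
  shows "(LINT \<omega>|M. outer (stack (Y t \<omega>)) (stack (Y t \<omega>))) = (LINT \<omega>|M. outer (stack (Y 0 \<omega>)) (stack (Y 0 \<omega>)))"
proof -
  have "cov_vec M (\<lambda>\<omega>. stack (Y (t + 0) \<omega>)) (\<lambda>\<omega>. stack (Y t \<omega>)) = cov_vec M (\<lambda>\<omega>. stack (Y 0 \<omega>)) (\<lambda>\<omega>. stack (Y 0 \<omega>))"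
    using stationary assms unfolding second_order_stationary_def by blast
  then show ?thesis using assms by (simp add: cov_vec_def stack_mean)
qed

lemma Y_nth_mult_mean:
  assumes "t \<ge> 0"
  shows "(LINT \<omega>|M. Y t \<omega> $ i $ j * Y t \<omega> $ k $ l) = (LINT \<omega>|M. Y 0 \<omega> $ i $ j * Y 0 \<omega> $ k $ l)"
proof -
  have "(LINT \<omega>|M. Y t \<omega> $ i $ j * Y t \<omega> $ k $ l) =
      (LINT \<omega>|M. outer (stack (Y t \<omega>)) (stack (Y t \<omega>))) $ (j, i) $ (l, k)" if "t \<ge> 0" for t
    using integral_nth[OF outer_integrable[OF that]] integral_nth(1)[OF integral_nth(2)[OF outer_integrable[OF that]]]
    by (simp add: outer_nth stack_nth)
  from this[OF assms] this[of 0] outer_mean[OF assms] show ?thesis by simp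
qed

text \<open>Uniformity in time comes from stationarity: (1 + x)^2 is at most 2 + 2 x^2, and the
  squared Frobenius norm is a sum of second moments, which are constant.\<close>

lemma growth_abs_bounded:
  assumes "growth 2 \<phi>"
  obtains K where "\<And>t. t \<ge> 0 \<Longrightarrow> (\<integral>\<^sup>+\<omega>. ennreal \<bar>\<phi> (Y t \<omega>)\<bar> \<partial>M) \<le> ennreal K"
proof -
  obtain c where c: "c \<ge> 0" "\<And>y. psd y \<Longrightarrow> \<bar>\<phi> y\<bar> \<le> c * (1 + norm y)\<^sup>2" using growthD[OF assms(1)] by blast
  define K where "K = c * (2 + 2 * (\<Sum>i\<in>UNIV. \<Sum>j\<in>UNIV. (LINT \<omega>|M. Y 0 \<omega> $ i $ j * Y 0 \<omega> $ i $ j)))"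
  have "(\<integral>\<^sup>+\<omega>. ennreal \<bar>\<phi> (Y t \<omega>)\<bar> \<partial>M) \<le> ennreal K" if t: "t \<ge> 0" for t
  proof -
    have nn: "(norm y)\<^sup>2 = (\<Sum>i\<in>UNIV. \<Sum>j\<in>UNIV. y $ i $ j * y $ i $ j)" for y :: "real^'d^'d"
      by (simp add: power2_norm_eq_inner inner_vec_def)
    have int: "integrable M (\<lambda>\<omega>. Y t \<omega> $ i $ j * Y t \<omega> $ i $ j)" for i j
      by (rule growth_integrable[OF growth_nth_mult t])
    have "(\<integral>\<^sup>+\<omega>. ennreal \<bar>\<phi> (Y t \<omega>)\<bar> \<partial>M) = ennreal (LINT \<omega>|M. \<bar>\<phi> (Y t \<omega>)\<bar>)"
      by (intro nn_integral_eq_integral integrable_abs growth_integrable assms t) auto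
    also have "(LINT \<omega>|M. \<bar>\<phi> (Y t \<omega>)\<bar>) \<le> (LINT \<omega>|M. c * (2 + 2 * (norm (Y t \<omega>))\<^sup>2))"
    proof (rule integral_mono_AE)
      show "integrable M (\<lambda>\<omega>. \<bar>\<phi> (Y t \<omega>)\<bar>)" by (intro integrable_abs growth_integrable assms t)
      show "integrable M (\<lambda>\<omega>. c * (2 + 2 * (norm (Y t \<omega>))\<^sup>2))"
        by (intro integrable_mult_right Bochner_Integration.integrable_add Y_square_integrable t) auto
      show "AE \<omega> in M. \<bar>\<phi> (Y t \<omega>)\<bar> \<le> c * (2 + 2 * (norm (Y t \<omega>))\<^sup>2)"
        using Y_paths
      proof eventually_elim
        fix \<omega> assume "cadlag (\<lambda>t. Y t \<omega>) \<and> (\<forall>t\<ge>0. psd (Y t \<omega>))"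
        then have "\<bar>\<phi> (Y t \<omega>)\<bar> \<le> c * (1 + norm (Y t \<omega>))\<^sup>2" using t by (intro c(2)) auto
        also have "\<dots> \<le> c * (2 + 2 * (norm (Y t \<omega>))\<^sup>2)"
          using sum_squares_bound[of 1 "norm (Y t \<omega>)"] c(1)
          by (intro mult_left_mono) (auto simp: power2_sum)
        finally show "\<bar>\<phi> (Y t \<omega>)\<bar> \<le> c * (2 + 2 * (norm (Y t \<omega>))\<^sup>2)" .
      qed
    qed
    also have "(LINT \<omega>|M. c * (2 + 2 * (norm (Y t \<omega>))\<^sup>2)) = K"
      unfolding nn K_def using int
      by (simp add: prob_space Y_nth_mult_mean[OF t])
    finally show ?thesis by (simp add: ennreal_leI)
  qed
  then show ?thesis using that by blast
qed

definition jump_int :: "(real^'d^'d \<Rightarrow> real) \<Rightarrow> (real^'d \<Rightarrow> real) \<Rightarrow> 'a \<Rightarrow> real"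
  where "jump_int \<phi> g \<omega> = (LINT r:{0<..1}|count_space UNIV. \<phi> (left_lim (\<lambda>t. Y t \<omega>) r) * g (jump (\<lambda>t. L t \<omega>) r))"

definition time_int :: "(real^'d^'d \<Rightarrow> real) \<Rightarrow> 'a \<Rightarrow> real"
  where "time_int \<phi> \<omega> = (LINT r:{0<..1}|lborel. \<phi> (left_lim (\<lambda>t. Y t \<omega>) r))"

definition mean_int :: "(real^'d^'d \<Rightarrow> real) \<Rightarrow> real"
  where "mean_int \<phi> = (LINT \<omega>|M. time_int \<phi> \<omega>)"

lemma growth_left_lim:
  assumes "growth n \<phi>" "cadlag (\<lambda>t. Y t \<omega>)"
  shows "cadlag (\<lambda>t. \<phi> (Y t \<omega>))"
    "r \<in> {0<..1} \<Longrightarrow> left_lim (\<lambda>t. \<phi> (Y t \<omega>)) r = \<phi> (left_lim (\<lambda>t. Y t \<omega>) r)"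
  using cadlag_compose[OF assms(2) growth_continuous[OF assms(1)]] by auto

text \<open>The signed compensation formula for the process \<open>\<phi> (Y t \<omega>)\<close>,
  rewritten with \<phi> outside the left limit. The two forms agree on cadlag paths, hence almost
  surely. The last conclusion is a Fubini argument on an interval of length one, so no factor
  appears.\<close>

lemma
  assumes \<phi>: "growth 2 \<phi>" and g: "continuous_on UNIV g" "g 0 = 0" "integrable \<nu> g"
  shows jump_set_integrable: "AE \<omega> in M. set_integrable (count_space UNIV) {0<..1}
      (\<lambda>r. \<phi> (left_lim (\<lambda>t. Y t \<omega>) r) * g (jump (\<lambda>t. L t \<omega>) r))"
    and jump_int_integrable: "integrable M (jump_int \<phi> g)"
    and time_int_integrable: "integrable M (time_int \<phi>)"
    and jump_int_mean: "(LINT \<omega>|M. jump_int \<phi> g \<omega>) = (LINT x|\<nu>. g x) * mean_int \<phi>"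
    and mean_int_eq: "(\<And>r. r \<ge> 0 \<Longrightarrow> (LINT \<omega>|M. \<phi> (Y r \<omega>)) = m) \<Longrightarrow> mean_int \<phi> = m"
proof -
  let ?U = "\<lambda>t \<omega>. \<phi> (Y t \<omega>)"
  have U: "cadlag_process ?U" by (rule growth_cadlag_process[OF \<phi>])
  obtain K where K: "\<And>t. t \<ge> 0 \<Longrightarrow> (\<integral>\<^sup>+\<omega>. ennreal \<bar>\<phi> (Y t \<omega>)\<bar> \<partial>M) \<le> ennreal K"
    using growth_abs_bounded[OF \<phi>] by blast
  then have K': "\<And>r. r \<in> {0<..1} \<Longrightarrow> (\<integral>\<^sup>+\<omega>. ennreal \<bar>?U r \<omega>\<bar> \<partial>M) \<le> ennreal K" by auto
  have T: "(\<integral>\<^sup>+\<omega>. time_integral (\<lambda>t \<omega>. \<bar>?U t \<omega>\<bar>) \<omega> \<partial>M) < \<infinity>"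
    by (rule time_integral_abs_finite[OF U K'])
  let ?s = "\<lambda>\<omega>. LINT r:{0<..1}|count_space UNIV. left_lim (\<lambda>t. ?U t \<omega>) r * g (jump (\<lambda>t. L t \<omega>) r)"
  let ?t = "\<lambda>\<omega>. LINT r:{0<..1}|lborel. left_lim (\<lambda>t. ?U t \<omega>) r"
  have l: "AE \<omega> in M. \<forall>r\<in>{0<..1}. left_lim (\<lambda>t. ?U t \<omega>) r = \<phi> (left_lim (\<lambda>t. Y t \<omega>) r)"
    using Y_paths by eventually_elim (use growth_left_lim(2)[OF \<phi>] in blast)
  have s: "AE \<omega> in M. ?s \<omega> = jump_int \<phi> g \<omega>"
    using l by eventually_elim (unfold jump_int_def, intro set_lebesgue_integral_cong, auto)
  have t: "AE \<omega> in M. ?t \<omega> = time_int \<phi> \<omega>"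
    using l by eventually_elim (unfold time_int_def, intro set_lebesgue_integral_cong, auto)
  note S = compensation_integrable[OF U T g] compensation_time_integrable[OF U T g]
  have sm: "jump_int \<phi> g \<in> borel_measurable M"
    using measurable_AE_eq[OF borel_measurable_integrable[OF S(1)] s] by simp
  have tm: "time_int \<phi> \<in> borel_measurable M"
    using measurable_AE_eq[OF borel_measurable_integrable[OF S(2)] t] by simp
  show "AE \<omega> in M. set_integrable (count_space UNIV) {0<..1}
      (\<lambda>r. \<phi> (left_lim (\<lambda>t. Y t \<omega>) r) * g (jump (\<lambda>t. L t \<omega>) r))"
    using compensation_set_integrable[OF U T g] l
  proof eventually_elim
    case (elim \<omega>)
    show ?case
      by (rule set_integrable_cong[THEN iffD1, OF refl refl _ elim(1)]) (use elim(2) in auto)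
  qed
  show "integrable M (jump_int \<phi> g)"
    using integrable_cong_AE[OF borel_measurable_integrable[OF S(1)] sm s] S(1) by blast
  show "integrable M (time_int \<phi>)"
    using integrable_cong_AE[OF borel_measurable_integrable[OF S(2)] tm t] S(2) by blast
  have ti: "(LINT \<omega>|M. ?t \<omega>) = mean_int \<phi>"
    unfolding mean_int_def by (rule integral_cong_AE[OF borel_measurable_integrable[OF S(2)] tm t])
  have "(LINT \<omega>|M. jump_int \<phi> g \<omega>) = (LINT \<omega>|M. ?s \<omega>)"
    by (rule integral_cong_AE[OF borel_measurable_integrable[OF S(1)] sm s, symmetric])
  also have "\<dots> = (LINT x|\<nu>. g x) * mean_int \<phi>"
    unfolding compensation_formula[OF U T g] ti ..
  finally show "(LINT \<omega>|M. jump_int \<phi> g \<omega>) = (LINT x|\<nu>. g x) * mean_int \<phi>" .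
  show "mean_int \<phi> = m" if "\<And>r. r \<ge> 0 \<Longrightarrow> (LINT \<omega>|M. \<phi> (Y r \<omega>)) = m"
  proof -
    have "(LINT \<omega>|M. ?t \<omega>) = m"
      by (rule time_integral_expectation[OF U K']) (use that in auto)
    then show ?thesis using ti by simp
  qed
qed

end

text \<open>A unit vector is the stacking of a matrix unit, and transposing a matrix unit swaps its
  two indices.\<close>

lemma commutation_matrix_nth: "commutation_matrix $ i $ j = (if i = prod.swap j then 1 else 0)"
proof -
  have "commutation_matrix $ i $ j = (commutation_matrix *v axis j 1) $ i"
    by (simp add: matrix_vector_mult_basis column_def)
  also have "axis j 1 = stack (outer (axis (snd j) 1) (axis (fst j) 1))"
    by (simp add: stack_outer kron_vec_axis)
  also have "(commutation_matrix *v stack (outer (axis (snd j) 1) (axis (fst j) 1))) $ i = axis (snd j, fst j) 1 $ i"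
  proof -
    have "transpose (outer (axis (snd j) 1) (axis (fst j) 1)) = outer (axis (fst j) 1 :: real^'a) (axis (snd j) 1)"
      by (simp add: vec_eq_iff transpose_def outer_nth)
    then show ?thesis unfolding commutation_matrix_stack by (simp add: stack_outer kron_vec_axis)
  qed
  finally show ?thesis by (cases j) (auto simp: axis_def)
qed

lemma set_integral_sum_count:
  fixes f :: "'i \<Rightarrow> real \<Rightarrow> real"
  assumes "finite I" "\<And>i. i \<in> I \<Longrightarrow> set_integrable N S (f i)"
  shows "set_integrable N S (\<lambda>r. \<Sum>i\<in>I. f i r)"
    and "(LINT r:S|N. (\<Sum>i\<in>I. f i r)) = (\<Sum>i\<in>I. LINT r:S|N. f i r)"
proof -
  have i: "integrable N (\<lambda>r. indicator S r *\<^sub>R f i r)" if "i \<in> I" for i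
    using assms(2)[OF that] by (simp add: set_integrable_def)
  show "set_integrable N S (\<lambda>r. \<Sum>i\<in>I. f i r)"
    unfolding set_integrable_def scaleR_sum_right by (intro Bochner_Integration.integrable_sum i)
  show "(LINT r:S|N. (\<Sum>i\<in>I. f i r)) = (\<Sum>i\<in>I. LINT r:S|N. f i r)"
    unfolding set_lebesgue_integral_def scaleR_sum_right by (intro Bochner_Integration.integral_sum i)
qed

section \<open>Entries of the volatility process as paths with drift and jumps\<close>

context mucogarch_setting
begin

abbreviation Yl :: "'a \<Rightarrow> real \<Rightarrow> real^'d^'d"
  where "Yl \<omega> \<equiv> left_lim (\<lambda>t. Y t \<omega>)"

abbreviation dL :: "'a \<Rightarrow> real \<Rightarrow> real^'d"
  where "dL \<omega> \<equiv> jump (\<lambda>t. L t \<omega>)"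

lemma levy_second_moment:
  "integrable \<nu> (\<lambda>x. x $ k * x $ l)" "(LINT x|\<nu>. x $ k * x $ l) = (if k = l then \<sigma> else 0)"
proof -
  have i: "integrable \<nu> (\<lambda>x. outer x x)" and e: "(LINT x|\<nu>. outer x x) = \<sigma> *\<^sub>R mat 1"
    using second_moment by (auto simp: has_bochner_integral_iff)
  note i1 = integral_nth[OF i, of k]
  note i2 = integral_nth[OF i1(2), of l]
  show "integrable \<nu> (\<lambda>x. x $ k * x $ l)" using i2(2) by (simp add: outer_nth)
  have "(LINT x|\<nu>. x $ k * x $ l) = (LINT x|\<nu>. outer x x) $ k $ l"
    unfolding i1(1) i2(1) by (simp add: outer_nth)
  then show "(LINT x|\<nu>. x $ k * x $ l) = (if k = l then \<sigma> else 0)"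
    by (simp add: e mat_def)
qed

lemma levy_fourth_moment:
  "integrable \<nu> (\<lambda>x. (x $ a * x $ b) * (x $ c * x $ d))"
  "(LINT x|\<nu>. (x $ a * x $ b) * (x $ c * x $ d)) =
    \<rho> * ((if a = b \<and> c = d then 1 else 0) + (if a = c \<and> b = d then 1 else 0) + (if a = d \<and> b = c then 1 else 0))"
proof -
  let ?f = "\<lambda>x :: real^'d. outer (stack (outer x x)) (stack (outer x x))"
  have i: "integrable \<nu> ?f"
    and e: "(LINT x|\<nu>. ?f x) = \<rho> *\<^sub>R (mat 1 + commutation_matrix + outer (stack (mat 1)) (stack (mat 1)))"
    using fourth_moment by (auto simp: has_bochner_integral_iff)
  \<comment> \<open>Stacked positions list the column first, so \<open>(b, a)\<close> selects the
    entry in row \<open>a\<close> and column \<open>b\<close>.\<close>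
  note i1 = integral_nth[OF i, of "(b, a)"]
  note i2 = integral_nth[OF i1(2), of "(d, c)"]
  have eq: "?f x $ (b, a) $ (d, c) = (x $ a * x $ b) * (x $ c * x $ d)" for x
    by (simp add: outer_nth stack_nth)
  show "integrable \<nu> (\<lambda>x. (x $ a * x $ b) * (x $ c * x $ d))" using i2(2) unfolding eq .
  have "(LINT x|\<nu>. (x $ a * x $ b) * (x $ c * x $ d)) = (LINT x|\<nu>. ?f x) $ (b, a) $ (d, c)"
    unfolding i1(1) i2(1) eq ..
  moreover have "(mat 1 :: real^('d \<times> 'd)^('d \<times> 'd)) $ (b, a) $ (d, c) = (if a = c \<and> b = d then 1 else 0)"
    "(commutation_matrix :: real^('d \<times> 'd)^('d \<times> 'd)) $ (b, a) $ (d, c) = (if a = d \<and> b = c then 1 else 0)"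
    "outer (stack (mat 1 :: real^'d^'d)) (stack (mat 1 :: real^'d^'d)) $ (b, a) $ (d, c) = (if a = b \<and> c = d then 1 else 0)"
    by (auto simp: mat_def commutation_matrix_nth outer_nth stack_nth)
  ultimately show "(LINT x|\<nu>. (x $ a * x $ b) * (x $ c * x $ d)) =
    \<rho> * ((if a = b \<and> c = d then 1 else 0) + (if a = c \<and> b = d then 1 else 0) + (if a = d \<and> b = c then 1 else 0))"
    unfolding e by (simp only: vector_scaleR_component vector_add_component real_scaleR_def add_ac)
qed

text \<open>On almost every path, \<open>outer (amp \<omega> r) (amp \<omega> r)\<close> is the jump
  of \<open>Y\<close> at a time r in (0, 1].\<close>

definition amp :: "'a \<Rightarrow> real \<Rightarrow> real^'d"
  where "amp \<omega> r = vol (Yl \<omega> r) *v dL \<omega> r"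

abbreviation volvol :: "'d \<Rightarrow> 'd \<Rightarrow> 'd \<times> 'd \<Rightarrow> real^'d^'d \<Rightarrow> real"
  where "volvol i j p y \<equiv> vol y $ i $ fst p * vol y $ j $ snd p"

abbreviation xx :: "'d \<times> 'd \<Rightarrow> real^'d \<Rightarrow> real"
  where "xx p x \<equiv> x $ fst p * x $ snd p"

lemma amp_mult: "amp \<omega> r $ i * amp \<omega> r $ j = (\<Sum>p\<in>UNIV. volvol i j p (Yl \<omega> r) * xx p (dL \<omega> r))"
  by (simp add: amp_def matrix_vector_mult_def sum_product sum_UNIV_prod mult_ac)

text \<open>Products of two or four entries of \<open>amp\<close> expand into finite sums of this
  shape: a function of the left limit of \<open>Y\<close> times a polynomial in the jump of
  \<open>L\<close>.\<close>

lemma jump_terms: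
  assumes I: "finite I" and \<phi>: "\<And>i. i \<in> I \<Longrightarrow> growth 2 (\<phi> i)"
    and g: "\<And>i. i \<in> I \<Longrightarrow> continuous_on UNIV (g i)" "\<And>i. i \<in> I \<Longrightarrow> g i 0 = 0" "\<And>i. i \<in> I \<Longrightarrow> integrable \<nu> (g i)"
  shows "AE \<omega> in M. set_integrable (count_space UNIV) {0<..1} (\<lambda>r. \<Sum>i\<in>I. \<phi> i (Yl \<omega> r) * g i (dL \<omega> r))"
    and "integrable M (\<lambda>\<omega>. LINT r:{0<..1}|count_space UNIV. (\<Sum>i\<in>I. \<phi> i (Yl \<omega> r) * g i (dL \<omega> r)))"
    and "(LINT \<omega>|M. (LINT r:{0<..1}|count_space UNIV. (\<Sum>i\<in>I. \<phi> i (Yl \<omega> r) * g i (dL \<omega> r)))) =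
      (\<Sum>i\<in>I. (LINT x|\<nu>. g i x) * mean_int (\<phi> i))"
proof -
  have ae: "AE \<omega> in M. \<forall>i\<in>I. set_integrable (count_space UNIV) {0<..1} (\<lambda>r. \<phi> i (Yl \<omega> r) * g i (dL \<omega> r))"
    by (intro AE_finite_allI I jump_set_integrable \<phi> g)
  then show "AE \<omega> in M. set_integrable (count_space UNIV) {0<..1} (\<lambda>r. \<Sum>i\<in>I. \<phi> i (Yl \<omega> r) * g i (dL \<omega> r))"
    by eventually_elim (intro set_integral_sum_count(1) I, blast)
  have s: "AE \<omega> in M. (\<Sum>i\<in>I. jump_int (\<phi> i) (g i) \<omega>) =
      (LINT r:{0<..1}|count_space UNIV. (\<Sum>i\<in>I. \<phi> i (Yl \<omega> r) * g i (dL \<omega> r)))"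
    using ae
  proof eventually_elim
    case (elim \<omega>)
    then show ?case unfolding jump_int_def
      by (intro set_integral_sum_count(2)[symmetric] I) blast
  qed
  have i: "integrable M (\<lambda>\<omega>. \<Sum>i\<in>I. jump_int (\<phi> i) (g i) \<omega>)"
    by (intro Bochner_Integration.integrable_sum jump_int_integrable \<phi> g)
  have m: "(\<lambda>\<omega>. LINT r:{0<..1}|count_space UNIV. (\<Sum>i\<in>I. \<phi> i (Yl \<omega> r) * g i (dL \<omega> r))) \<in> borel_measurable M"
    using measurable_AE_eq[OF borel_measurable_integrable[OF i] s] by simp
  show "integrable M (\<lambda>\<omega>. LINT r:{0<..1}|count_space UNIV. (\<Sum>i\<in>I. \<phi> i (Yl \<omega> r) * g i (dL \<omega> r)))"
    using integrable_cong_AE[OF borel_measurable_integrable[OF i] m s] i by blast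
  have "(LINT \<omega>|M. (LINT r:{0<..1}|count_space UNIV. (\<Sum>i\<in>I. \<phi> i (Yl \<omega> r) * g i (dL \<omega> r)))) =
      (LINT \<omega>|M. (\<Sum>i\<in>I. jump_int (\<phi> i) (g i) \<omega>))"
    by (rule integral_cong_AE[OF borel_measurable_integrable[OF i] m s, symmetric])
  also have "\<dots> = (\<Sum>i\<in>I. LINT \<omega>|M. jump_int (\<phi> i) (g i) \<omega>)"
    by (intro Bochner_Integration.integral_sum jump_int_integrable \<phi> g)
  also have "\<dots> = (\<Sum>i\<in>I. (LINT x|\<nu>. g i x) * mean_int (\<phi> i))"
    by (intro sum.cong refl jump_int_mean \<phi> g)
  finally show "(LINT \<omega>|M. (LINT r:{0<..1}|count_space UNIV. (\<Sum>i\<in>I. \<phi> i (Yl \<omega> r) * g i (dL \<omega> r)))) =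
      (\<Sum>i\<in>I. (LINT x|\<nu>. g i x) * mean_int (\<phi> i))" .
qed

lemma growth2: "growth 1 \<phi> \<Longrightarrow> growth 2 \<phi>"
  by (rule growth_mono) auto

lemma growth_volvol: "growth 1 (volvol i j p)"
  by (rule growth_vol)

lemma growth_mult2: "growth 1 \<phi> \<Longrightarrow> growth 1 \<psi> \<Longrightarrow> growth 2 (\<lambda>y. \<phi> y * \<psi> y)"
  using growth_mult[of 1 \<phi> 1 \<psi>] by (simp add: numeral_2_eq_2)

text \<open>Agreement on the cone suffices, because the cone is closed and so the left limits of
  \<open>Y\<close> stay in it. This is how \<open>vol_square\<close> enters the time
  averages.\<close>

lemma mean_int_cong:
  assumes "\<And>y. psd y \<Longrightarrow> \<phi> y = \<psi> y" and "growth 2 \<phi>" "growth 2 \<psi>"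
  shows "mean_int \<phi> = mean_int \<psi>"
  unfolding mean_int_def
proof (rule integral_cong_AE)
  show "AE \<omega> in M. time_int \<phi> \<omega> = time_int \<psi> \<omega>"
    using Y_paths
  proof eventually_elim
    case (elim \<omega>)
    then show ?case
      unfolding time_int_def
      by (intro set_lebesgue_integral_cong) (auto intro!: assms(1) psd_left_lim)
  qed
\<comment> \<open>\<open>time_int_integrable\<close> is stated together with the jump formulas and
  shares their assumptions; the zero function is supplied as jump function.\<close>
qed (use time_int_integrable[OF assms(2) continuous_on_const, of 0] time_int_integrable[OF assms(3) continuous_on_const, of 0] in auto)

lemma time_int_set_integrable:
  assumes "growth 2 \<phi>" and c: "cadlag (\<lambda>t. Y t \<omega>)"
  shows "set_integrable lborel {0<..1} (\<lambda>r. \<phi> (Yl \<omega> r))"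
  by (rule set_integrable_cong[THEN iffD1, OF refl refl _ lborel_left_lim_integrable[OF growth_left_lim(1)[OF assms]]])
    (rule growth_left_lim(2)[OF assms])

lemma mean_int_sum:
  assumes I: "finite I" and \<phi>: "\<And>i. i \<in> I \<Longrightarrow> growth 2 (\<phi> i)"
  shows "mean_int (\<lambda>y. \<Sum>i\<in>I. c i * \<phi> i y) = (\<Sum>i\<in>I. c i * mean_int (\<phi> i))"
proof -
  have g: "growth 2 (\<lambda>y. \<Sum>i\<in>I. c i * \<phi> i y)" by (intro growth_sum growth_cmult I \<phi>)
  have ti: "integrable M (time_int \<psi>)" if "growth 2 \<psi>" for \<psi>
    using time_int_integrable[OF that continuous_on_const, of 0] by auto
  have i: "integrable M (\<lambda>\<omega>. \<Sum>i\<in>I. c i * time_int (\<phi> i) \<omega>)"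
    by (intro Bochner_Integration.integrable_sum integrable_mult_right ti \<phi>)
  have "AE \<omega> in M. time_int (\<lambda>y. \<Sum>i\<in>I. c i * \<phi> i y) \<omega> = (\<Sum>i\<in>I. c i * time_int (\<phi> i) \<omega>)"
    using Y_paths
  proof eventually_elim
    case (elim \<omega>)
    then have s: "set_integrable lborel {0<..1} (\<lambda>r. \<phi> i (Yl \<omega> r))" if "i \<in> I" for i
      by (intro time_int_set_integrable \<phi> that) auto
    show ?case
      unfolding time_int_def using s
      by (subst set_integral_sum_count(2)[OF I]) (auto intro!: sum.cong)
  qed
  then have "mean_int (\<lambda>y. \<Sum>i\<in>I. c i * \<phi> i y) = (LINT \<omega>|M. (\<Sum>i\<in>I. c i * time_int (\<phi> i) \<omega>))"
    unfolding mean_int_def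
    by (intro integral_cong_AE borel_measurable_integrable[OF ti[OF g]] borel_measurable_integrable[OF i])
  also have "\<dots> = (\<Sum>i\<in>I. LINT \<omega>|M. c i * time_int (\<phi> i) \<omega>)"
    by (intro Bochner_Integration.integral_sum integrable_mult_right ti \<phi>)
  also have "\<dots> = (\<Sum>i\<in>I. c i * mean_int (\<phi> i))"
    by (simp add: mean_int_def)
  finally show ?thesis .
qed

lemma mean_int_add:
  assumes "growth 2 \<phi>" "growth 2 \<psi>"
  shows "mean_int (\<lambda>y. \<phi> y + \<psi> y) = mean_int \<phi> + mean_int \<psi>"
  using mean_int_sum[of "UNIV :: bool set" "\<lambda>b. if b then \<phi> else \<psi>" "\<lambda>_. 1"] assms
  by (simp add: UNIV_bool add.commute)

text \<open>The Stieltjes integral of the defining equation is turned into an absolutely summable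
  series of jumps, entry by entry; this is the form to which \<open>product_formula\<close>
  applies.\<close>

lemma Y_jump_path:
  "AE \<omega> in M. \<forall>i j. jump_path (\<lambda>t. Y t \<omega> $ i $ j) (\<lambda>s. drift (Yl \<omega> s) $ i $ j)
    (\<lambda>r. amp \<omega> r $ i * amp \<omega> r $ j) 1"
proof -
  have sol: "AE \<omega> in M. \<forall>t\<ge>0. \<exists>J.
          has_matrix_LS_integral
            (\<lambda>s. A ** psd_sqrt (C + Yl \<omega> s))
            (disc_quad_var (\<lambda>t. L t \<omega>))
            (\<lambda>s. psd_sqrt (C + Yl \<omega> s) ** transpose A) t J \<and>
          Y t \<omega> = Y 0 \<omega> + (LINT s:{0..t}|lborel. B ** Yl \<omega> s + Yl \<omega> s ** transpose B) + J"
    using conjunct2[OF solution[unfolded mucogarch_volatility_def Let_def]] by (rule eventually_mono) blast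
  have xx_cont: "continuous_on UNIV (xx p)" for p
    by (intro continuous_intros)
  have "AE \<omega> in M. set_integrable (count_space UNIV) {0<..1} (\<lambda>r. 1 * xx p (dL \<omega> r))" for p
    using jump_set_integrable[OF growth_const[of 2 1] xx_cont _ levy_second_moment(1)] by simp
  then have "AE \<omega> in M. \<forall>p\<in>UNIV. set_integrable (count_space UNIV) {0<..1} (\<lambda>r. 1 * xx p (dL \<omega> r))"
    by (intro AE_finite_allI) auto
  then show ?thesis
    using sol Y_paths
  proof eventually_elim
    case (elim \<omega>)
    have int: "set_integrable (count_space UNIV) {0<..1} (\<lambda>r. dL \<omega> r $ k * dL \<omega> r $ l)" for k l
      using elim(1)[rule_format, of "(k, l)"] by simp
    have c: "cadlag (\<lambda>t. Y t \<omega>)" and p: "\<And>t. t \<ge> 0 \<Longrightarrow> psd (Y t \<omega>)" using elim(3) by auto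
    have vl: "cadlag (\<lambda>t. volvol i j q (Y t \<omega>))"
      "r \<in> {0<..1} \<Longrightarrow> left_lim (\<lambda>t. volvol i j q (Y t \<omega>)) r = volvol i j q (Yl \<omega> r)" for i j q r
      using growth_left_lim[OF growth_volvol c] by auto
    have vint: "set_integrable (count_space UNIV) {0<..1} (\<lambda>r. volvol i j q (Yl \<omega> r) * xx q (dL \<omega> r))" for i j q
    proof (rule set_integrable_cong[THEN iffD1, OF refl refl])
      show "set_integrable (count_space UNIV) {0<..1} (\<lambda>r. left_lim (\<lambda>t. volvol i j q (Y t \<omega>)) r * xx q (dL \<omega> r))"
        by (rule left_lim_integrable[OF zero_less_one _ _ int vl(1)]) auto
    qed (simp add: vl(2))
    have dint: "set_integrable lborel {0<..1} (\<lambda>s. drift (Yl \<omega> s) $ i $ j)" for i j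
      by (rule time_int_set_integrable[OF growth2[OF growth_drift] c])
    have aint: "set_integrable (count_space UNIV) {0<..1} (\<lambda>r. amp \<omega> r $ i * amp \<omega> r $ j)" for i j
      unfolding amp_mult by (rule set_integral_sum_count(1)) (auto intro: vint)
    show ?case
    proof (intro allI jump_path.intro)
      fix i j
      show "cadlag (\<lambda>t. Y t \<omega> $ i $ j)" by (rule growth_left_lim(1)[OF growth_nth c])
      fix t :: real assume t: "0 \<le> t" "t \<le> 1"
      show "Y t \<omega> $ i $ j = Y 0 \<omega> $ i $ j + (LINT s:{0<..t}|lborel. drift (Yl \<omega> s) $ i $ j) +
          (LINT r:{0<..t}|count_space UNIV. amp \<omega> r $ i * amp \<omega> r $ j)"
      proof (cases "t = 0")
        case True
        then show ?thesis by (simp add: set_lebesgue_integral_def)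
      next
        case False
        then have t0: "t > 0" using t by simp
        obtain J where J: "has_matrix_LS_integral (\<lambda>s. A ** psd_sqrt (C + Yl \<omega> s))
            (disc_quad_var (\<lambda>t. L t \<omega>)) (\<lambda>s. psd_sqrt (C + Yl \<omega> s) ** transpose A) t J"
          "Y t \<omega> = Y 0 \<omega> + (LINT s:{0..t}|lborel. B ** Yl \<omega> s + Yl \<omega> s ** transpose B) + J"
          using elim(2) t by blast
        have "\<exists>I. (\<forall>k l. has_LS_integral (\<lambda>s. (A ** psd_sqrt (C + Yl \<omega> s)) $ i $ k * (psd_sqrt (C + Yl \<omega> s) ** transpose A) $ l $ j)
            (\<lambda>s. disc_quad_var (\<lambda>t. L t \<omega>) s $ k $ l) t (I k l)) \<and> J $ i $ j = (\<Sum>k\<in>UNIV. \<Sum>l\<in>UNIV. I k l)"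
          by (rule J(1)[unfolded has_matrix_LS_integral_def, THEN spec, THEN spec])
        then obtain I where I: "\<And>k l. has_LS_integral (\<lambda>s. (A ** psd_sqrt (C + Yl \<omega> s)) $ i $ k * (psd_sqrt (C + Yl \<omega> s) ** transpose A) $ l $ j)
            (\<lambda>s. disc_quad_var (\<lambda>t. L t \<omega>) s $ k $ l) t (I k l)"
          and JI: "J $ i $ j = (\<Sum>k\<in>UNIV. \<Sum>l\<in>UNIV. I k l)"
          by blast
        have I_eq: "I k l = (LINT r:{0<..t}|count_space UNIV. volvol i j (k, l) (Yl \<omega> r) * xx (k, l) (dL \<omega> r))" for k l
        proof -
          have "I k l = (LINT r:{0<..t}|count_space UNIV. left_lim (\<lambda>t. volvol i j (k, l) (Y t \<omega>)) r * (dL \<omega> r $ k * dL \<omega> r $ l))"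
          proof (rule LS_integral_pure_jump[OF t0 I vl(1)])
            fix s assume s: "s \<in> {0<..t}"
            then have s': "s \<in> {0<..1}" using t by auto
            \<comment> \<open>On the cone \<open>psd_part\<close> is the identity, so the integrand
              of the equation is the left limit of a continuous function of \<open>Y\<close>.
              Symmetry of the root moves the right-hand factor into a second copy of
              \<open>vol\<close>.\<close>
            have ps: "psd (Yl \<omega> s)" using s by (intro psd_left_lim c p) auto
            have sym: "transpose (psd_sqrt (C + Yl \<omega> s)) = psd_sqrt (C + Yl \<omega> s)"
              using psd_psd_sqrt[OF psd_C_add[OF ps]] by (simp add: psd_def)
            have "psd_sqrt (C + Yl \<omega> s) ** transpose A = transpose (A ** psd_sqrt (C + Yl \<omega> s))"
              by (simp add: matrix_transpose_mul sym)
            then show "(A ** psd_sqrt (C + Yl \<omega> s)) $ i $ k * (psd_sqrt (C + Yl \<omega> s) ** transpose A) $ l $ j =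
                left_lim (\<lambda>t. volvol i j (k, l) (Y t \<omega>)) s"
              unfolding vl(2)[OF s'] by (simp add: vol_def psd_part_id[OF ps] transpose_def)
          next
            show "set_integrable (count_space UNIV) {0<..t} (\<lambda>r. dL \<omega> r $ k * dL \<omega> r $ l)"
              by (rule set_integrable_subset[OF int]) (use t in auto)
            show "disc_quad_var (\<lambda>t. L t \<omega>) s $ k $ l = (LINT r:{0<..s}|count_space UNIV. dL \<omega> r $ k * dL \<omega> r $ l)"
              if "0 \<le> s" "s \<le> t" for s
              by (rule disc_quad_var_component[OF int]) (use that t in auto)
          qed
          also have "\<dots> = (LINT r:{0<..t}|count_space UNIV. volvol i j (k, l) (Yl \<omega> r) * xx (k, l) (dL \<omega> r))"
          proof (intro set_lebesgue_integral_cong allI impI)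
            fix r assume "r \<in> {0<..t}"
            then have "left_lim (\<lambda>t. volvol i j (k, l) (Y t \<omega>)) r = volvol i j (k, l) (Yl \<omega> r)"
              using t by (intro vl(2)) auto
            then show "left_lim (\<lambda>t. volvol i j (k, l) (Y t \<omega>)) r * (dL \<omega> r $ k * dL \<omega> r $ l) =
                volvol i j (k, l) (Yl \<omega> r) * xx (k, l) (dL \<omega> r)" by simp
          qed simp
          finally show ?thesis .
        qed
        have "J $ i $ j = (\<Sum>q\<in>UNIV. LINT r:{0<..t}|count_space UNIV. volvol i j q (Yl \<omega> r) * xx q (dL \<omega> r))"
          unfolding JI I_eq sum_UNIV_prod ..
        also have "\<dots> = (LINT r:{0<..t}|count_space UNIV. (\<Sum>q\<in>UNIV. volvol i j q (Yl \<omega> r) * xx q (dL \<omega> r)))"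
          by (intro set_integral_sum_count(2)[symmetric] finite set_integrable_subset[OF vint]) (use t in auto)
        finally have Jij: "J $ i $ j = (LINT r:{0<..t}|count_space UNIV. amp \<omega> r $ i * amp \<omega> r $ j)"
          unfolding amp_mult .
        have dt: "set_integrable lborel {0<..t} (\<lambda>s. drift (Yl \<omega> s) $ i $ j)" for i j
          by (rule set_integrable_subset[OF dint]) (use t in auto)
        have m1: "integrable lborel (\<lambda>s. indicator {0..t} s *\<^sub>R drift (Yl \<omega> s))"
          by (intro integrable_vecI) (use Icc_integral_eq_Ioc(1)[OF dt t(1)] in \<open>simp add: set_integrable_def\<close>)
        have "(LINT s:{0..t}|lborel. drift (Yl \<omega> s)) $ i $ j = (LINT s:{0..t}|lborel. drift (Yl \<omega> s) $ i $ j)"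
          unfolding set_lebesgue_integral_def
          using integral_nth[OF m1, of i] integral_nth(1)[OF integral_nth(2)[OF m1, of i], of j] by simp
        also have "\<dots> = (LINT s:{0<..t}|lborel. drift (Yl \<omega> s) $ i $ j)"
          by (rule Icc_integral_eq_Ioc(2)[OF dt t(1)])
        finally show ?thesis using J(2) Jij by (simp add: drift_def)
      qed
    qed (auto intro: dint aint)
  qed
qed

section \<open>First and second moment equations\<close>

definition Y_mean0 :: "real^'d^'d" where "Y_mean0 = (LINT \<omega>|M. Y 0 \<omega>)"

lemma mean_cov_jump: "t \<ge> 0 \<Longrightarrow> (LINT \<omega>|M. cov_jump (Y t \<omega>) $ i $ j) = cov_jump Y_mean0 $ i $ j"
proof -
  assume t: "t \<ge> 0"
  have eq: "cov_jump y $ i $ j = (\<Sum>k\<in>UNIV. \<Sum>l\<in>UNIV. (A $ i $ l * A $ j $ k) * (C $ l $ k + y $ l $ k))" for y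
    by (simp add: cov_jump_def matrix_matrix_mult_def transpose_def sum_distrib_left sum_distrib_right mult_ac)
  have "integrable M (\<lambda>\<omega>. Y t \<omega> $ l $ k)" for l k
    by (rule growth_integrable[OF growth2[OF growth_nth] t])
  then show ?thesis unfolding eq by (simp add: Y_nth_mean[OF t] prob_space Y_mean0_def)
qed

lemma mean_drift: "t \<ge> 0 \<Longrightarrow> (LINT \<omega>|M. drift (Y t \<omega>) $ i $ j) = drift Y_mean0 $ i $ j"
proof -
  assume t: "t \<ge> 0"
  have eq: "drift y $ i $ j = (\<Sum>k\<in>UNIV. B $ i $ k * y $ k $ j) + (\<Sum>k\<in>UNIV. B $ j $ k * y $ i $ k)" for y
    by (simp add: drift_def matrix_matrix_mult_def transpose_def mult.commute)
  have "integrable M (\<lambda>\<omega>. Y t \<omega> $ l $ k)" for l k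
    by (rule growth_integrable[OF growth2[OF growth_nth] t])
  then show ?thesis unfolding eq by (simp add: Y_nth_mean[OF t] Y_mean0_def)
qed

lemma xx_props: "continuous_on UNIV (xx p)" "xx p 0 = 0" "integrable \<nu> (xx p)"
  by (auto intro!: continuous_intros levy_second_moment(1))

text \<open>As the second moment of \<nu> is \<sigma> times the identity, only the pairs with equal
  indices remain, and their sum is the one evaluated by \<open>vol_square\<close>.\<close>

lemma mean_int_volvol:
  assumes "growth 1 \<phi>"
  shows "(\<Sum>p\<in>UNIV. (LINT x|\<nu>. xx p x) * mean_int (\<lambda>y. \<phi> y * volvol i j p y)) = \<sigma> * mean_int (\<lambda>y. \<phi> y * cov_jump y $ i $ j)"
proof -
  have g: "growth 2 (\<lambda>y. \<phi> y * volvol i j p y)" for p by (rule growth_mult2[OF assms growth_volvol])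
  have "(\<Sum>p\<in>UNIV. (LINT x|\<nu>. xx p x) * mean_int (\<lambda>y. \<phi> y * volvol i j p y)) =
      mean_int (\<lambda>y. \<Sum>p\<in>UNIV. (LINT x|\<nu>. xx p x) * (\<phi> y * volvol i j p y))"
    by (rule mean_int_sum[symmetric]) (auto intro: g)
  \<comment> \<open>The sum over a singleton puts a single term into the shape of
    \<open>mean_int_sum\<close>, which then pulls out the factor \<sigma>.\<close>
  also have "\<dots> = mean_int (\<lambda>y. \<Sum>u\<in>{()}. \<sigma> * (\<phi> y * cov_jump y $ i $ j))"
  proof (rule mean_int_cong)
    fix y :: "real^'d^'d" assume y: "psd y"
    have "(\<Sum>p\<in>UNIV. (LINT x|\<nu>. xx p x) * (\<phi> y * volvol i j p y)) =
        (\<Sum>a\<in>UNIV. \<Sum>b\<in>UNIV. if a = b then \<sigma> * \<phi> y * (vol y $ i $ a * vol y $ j $ b) else 0)"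
      unfolding sum_UNIV_prod fst_conv snd_conv levy_second_moment(2) by (intro sum.cong refl) auto
    also have "\<dots> = \<sigma> * (\<phi> y * cov_jump y $ i $ j)"
      by (simp add: vol_square[OF y, symmetric] sum_distrib_left mult_ac)
    finally show "(\<Sum>p\<in>UNIV. (LINT x|\<nu>. xx p x) * (\<phi> y * volvol i j p y)) = (\<Sum>u\<in>{()}. \<sigma> * (\<phi> y * cov_jump y $ i $ j))"
      by simp
  qed (auto intro!: growth_sum growth_cmult g growth_mult2[OF assms growth_cov_jump])
  also have "\<dots> = \<sigma> * mean_int (\<lambda>y. \<phi> y * cov_jump y $ i $ j)"
    by (subst mean_int_sum) (auto intro!: growth_mult2[OF assms growth_cov_jump])
  finally show ?thesis .
qed

text \<open>The expected increment over [0, 1] is zero. Drift and \<open>cov_jump\<close> are affine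
  in the state, so the resulting equation closes in the mean alone.\<close>

lemma first_moment_equation: "drift Y_mean0 + \<sigma> *\<^sub>R cov_jump Y_mean0 = 0"
proof -
  have "drift Y_mean0 $ i $ j + \<sigma> * cov_jump Y_mean0 $ i $ j = 0" for i j
  proof -
    have one: "growth 1 (\<lambda>_. 1)" by (rule growth_const)
    have g: "growth 2 (\<lambda>y. 1 * volvol i j p y)" for p by (rule growth_mult2[OF one growth_volvol])
    note J = jump_terms[of UNIV "\<lambda>p y. 1 * volvol i j p y" xx, OF finite g xx_props]
    let ?S = "\<lambda>\<omega>. LINT r:{0<..1}|count_space UNIV. (\<Sum>p\<in>UNIV. 1 * volvol i j p (Yl \<omega> r) * xx p (dL \<omega> r))"
    note gd = growth2[OF growth_drift[of i j]]
    have T: "integrable M (time_int (\<lambda>y. drift y $ i $ j))"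
      using time_int_integrable[OF gd continuous_on_const, of 0] by auto
    have ae: "AE \<omega> in M. Y 1 \<omega> $ i $ j - Y 0 \<omega> $ i $ j = time_int (\<lambda>y. drift y $ i $ j) \<omega> + ?S \<omega>"
      using Y_jump_path
    proof eventually_elim
      case (elim \<omega>)
      then have "jump_path (\<lambda>t. Y t \<omega> $ i $ j) (\<lambda>s. drift (Yl \<omega> s) $ i $ j) (\<lambda>r. amp \<omega> r $ i * amp \<omega> r $ j) 1" by blast
      from jump_path.increment[OF this, of 1] show ?case
        by (simp add: time_int_def amp_mult)
    qed
    have Yi: "integrable M (\<lambda>\<omega>. Y t \<omega> $ i $ j)" if "t \<ge> 0" for t
      by (rule growth_integrable[OF growth2[OF growth_nth] that])
    have "(LINT \<omega>|M. Y 1 \<omega> $ i $ j - Y 0 \<omega> $ i $ j) = (LINT \<omega>|M. time_int (\<lambda>y. drift y $ i $ j) \<omega> + ?S \<omega>)"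
      using ae Yi[of 1] Yi[of 0] T J(2) by (intro integral_cong_AE) auto
    then have "0 = mean_int (\<lambda>y. drift y $ i $ j) + (LINT \<omega>|M. ?S \<omega>)"
      using Yi[of 1] Yi[of 0] T J(2) by (simp add: Y_nth_mean mean_int_def)
    also have "(LINT \<omega>|M. ?S \<omega>) = \<sigma> * mean_int (\<lambda>y. 1 * cov_jump y $ i $ j)"
      unfolding J(3) by (rule mean_int_volvol[OF one])
    also have "mean_int (\<lambda>y. 1 * cov_jump y $ i $ j) = cov_jump Y_mean0 $ i $ j"
      by (rule mean_int_eq[OF growth_mult2[OF one growth_cov_jump] continuous_on_const, of 0]) (auto simp: mean_cov_jump)
    also have "mean_int (\<lambda>y. drift y $ i $ j) = drift Y_mean0 $ i $ j"
      by (rule mean_int_eq[OF gd continuous_on_const, of 0]) (auto simp: mean_drift)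
    finally show ?thesis by simp
  qed
  then show ?thesis by (simp add: vec_eq_iff)
qed

text \<open>With \<sigma> = 0 a coordinate vanishes \<nu>-almost everywhere. For four equal indices
  the three pairings coincide, so its fourth moment is 3 \<rho>.\<close>

lemma sigma_zero_imp_rho_zero:
  assumes "\<sigma> = 0"
  shows "\<rho> = 0"
proof -
  fix i :: 'd
  have "AE x in \<nu>. x $ i * x $ i = 0"
    using integral_nonneg_eq_0_iff_AE[OF levy_second_moment(1)[of i i]] levy_second_moment(2)[of i i] assms by simp
  then have "(LINT x|\<nu>. (x $ i * x $ i) * (x $ i * x $ i)) = 0"
    by (intro integral_eq_zero_AE) auto
  then show ?thesis using levy_fourth_moment(2)[of i i i i] by simp
qed

text \<open>Each of the three pairings in the fourth moment of \<nu> contracts the four volatility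
  factors in pairs, and each pair is an entry of \<open>cov_jump\<close> by
  \<open>vol_square\<close>.\<close>

lemma fourth_volvol_sum:
  assumes y: "psd y"
  shows "(\<Sum>p\<in>UNIV. \<Sum>q\<in>UNIV. (LINT x|\<nu>. xx p x * xx q x) * (volvol i j p y * volvol k l q y)) =
    \<rho> * (cov_jump y $ i $ j * cov_jump y $ k $ l + cov_jump y $ i $ k * cov_jump y $ j $ l + cov_jump y $ i $ l * cov_jump y $ j $ k)"
proof -
  let ?v = "vol y"
  have "(\<Sum>p\<in>UNIV. \<Sum>q\<in>UNIV. (LINT x|\<nu>. xx p x * xx q x) * (volvol i j p y * volvol k l q y)) =
      (\<Sum>a\<in>UNIV. \<Sum>b\<in>UNIV. \<Sum>c\<in>UNIV. \<Sum>d\<in>UNIV.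
        \<rho> * ((if a = b \<and> c = d then 1 else 0) + (if a = c \<and> b = d then 1 else 0) + (if a = d \<and> b = c then 1 else 0)) *
        ((?v $ i $ a * ?v $ j $ b) * (?v $ k $ c * ?v $ l $ d)))"
    unfolding sum_UNIV_prod fst_conv snd_conv levy_fourth_moment(2) ..
  also have "\<dots> = \<rho> * ((\<Sum>a\<in>UNIV. \<Sum>b\<in>UNIV. \<Sum>c\<in>UNIV. \<Sum>d\<in>UNIV. if d = c then (if a = b then (?v $ i $ a * ?v $ j $ b) * (?v $ k $ c * ?v $ l $ d) else 0) else 0) +
      (\<Sum>a\<in>UNIV. \<Sum>b\<in>UNIV. \<Sum>c\<in>UNIV. \<Sum>d\<in>UNIV. if d = b then (if c = a then (?v $ i $ a * ?v $ j $ b) * (?v $ k $ c * ?v $ l $ d) else 0) else 0) +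
      (\<Sum>a\<in>UNIV. \<Sum>b\<in>UNIV. \<Sum>c\<in>UNIV. \<Sum>d\<in>UNIV. if d = a then (if c = b then (?v $ i $ a * ?v $ j $ b) * (?v $ k $ c * ?v $ l $ d) else 0) else 0))"
    unfolding sum_distrib_left sum.distrib[symmetric] distrib_left[symmetric] by (intro sum.cong refl) auto
  also have "(\<Sum>a\<in>UNIV. \<Sum>b\<in>UNIV. \<Sum>c\<in>UNIV. \<Sum>d\<in>UNIV. if d = c then (if a = b then (?v $ i $ a * ?v $ j $ b) * (?v $ k $ c * ?v $ l $ d) else 0) else 0) =
      (\<Sum>a\<in>UNIV. \<Sum>c\<in>UNIV. (?v $ i $ a * ?v $ j $ a) * (?v $ k $ c * ?v $ l $ c))"
    by (rule sum.cong[OF refl], subst sum.swap, simp)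
  also have "\<dots> = cov_jump y $ i $ j * cov_jump y $ k $ l"
    by (simp add: vol_square[OF y, symmetric] sum_product)
  also have "(\<Sum>a\<in>UNIV. \<Sum>b\<in>UNIV. \<Sum>c\<in>UNIV. \<Sum>d\<in>UNIV. if d = b then (if c = a then (?v $ i $ a * ?v $ j $ b) * (?v $ k $ c * ?v $ l $ d) else 0) else 0) =
      (\<Sum>a\<in>UNIV. \<Sum>b\<in>UNIV. (?v $ i $ a * ?v $ k $ a) * (?v $ j $ b * ?v $ l $ b))"
    by (simp add: mult_ac)
  also have "\<dots> = cov_jump y $ i $ k * cov_jump y $ j $ l"
    by (simp add: vol_square[OF y, symmetric] sum_product)
  also have "(\<Sum>a\<in>UNIV. \<Sum>b\<in>UNIV. \<Sum>c\<in>UNIV. \<Sum>d\<in>UNIV. if d = a then (if c = b then (?v $ i $ a * ?v $ j $ b) * (?v $ k $ c * ?v $ l $ d) else 0) else 0) =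
      (\<Sum>a\<in>UNIV. \<Sum>b\<in>UNIV. (?v $ i $ a * ?v $ l $ a) * (?v $ j $ b * ?v $ k $ b))"
    by (simp add: mult_ac)
  also have "\<dots> = cov_jump y $ i $ l * cov_jump y $ j $ k"
    by (simp add: vol_square[OF y, symmetric] sum_product)
  finally show ?thesis .
qed

text \<open>The generator applied to the product of the entries (i, j) and (k, l): the Leibniz terms
  of drift and mean jumps, plus the mean product of two simultaneous jumps.\<close>

definition second_moment_rate :: "'d \<Rightarrow> 'd \<Rightarrow> 'd \<Rightarrow> 'd \<Rightarrow> real^'d^'d \<Rightarrow> real"
  where "second_moment_rate i j k l y =
    y $ i $ j * (drift y $ k $ l + \<sigma> * cov_jump y $ k $ l) + y $ k $ l * (drift y $ i $ j + \<sigma> * cov_jump y $ i $ j) +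
    \<rho> * (cov_jump y $ i $ j * cov_jump y $ k $ l + cov_jump y $ i $ k * cov_jump y $ j $ l + cov_jump y $ i $ l * cov_jump y $ j $ k)"

lemma growth_second_moment_rate: "growth 2 (second_moment_rate i j k l)"
  unfolding second_moment_rate_def
  by (intro growth_add growth_cmult growth_mult2 growth_nth growth_drift growth_cov_jump)

text \<open>Integration by parts for two entries over [0, 1]. Of the jump sums, \<open>?S1\<close>
  and \<open>?S2\<close> pair the left limit of one entry with the jump of the other and use the
  second moment of \<nu>; \<open>?S3\<close> is the product of both jumps and uses the fourth. The
  left-hand side has expectation zero by stationarity.\<close>

lemma second_moment_mean_int: "mean_int (second_moment_rate i j k l) = 0"
proof -
  have g1: "growth 2 (\<lambda>y. y $ a $ b * volvol c d p y)" for a b c d p by (rule growth_mult2[OF growth_nth growth_volvol])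
  have g2: "growth 2 (\<lambda>y. volvol i j (fst z) y * volvol k l (snd z) y)" for z by (rule growth_mult2[OF growth_volvol growth_volvol])
  have x4: "continuous_on UNIV (\<lambda>x. xx (fst z) x * xx (snd z) x)" "xx (fst z) 0 * xx (snd z) 0 = 0"
    "integrable \<nu> (\<lambda>x. xx (fst z) x * xx (snd z) x)" for z
    by (auto intro!: continuous_intros levy_fourth_moment(1))
  note J1 = jump_terms[of UNIV "\<lambda>p y. y $ i $ j * volvol k l p y" xx, OF finite g1 xx_props]
  note J2 = jump_terms[of UNIV "\<lambda>p y. y $ k $ l * volvol i j p y" xx, OF finite g1 xx_props]
  note J3 = jump_terms[of UNIV "\<lambda>z y. volvol i j (fst z) y * volvol k l (snd z) y" "\<lambda>z x. xx (fst z) x * xx (snd z) x",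
      OF finite g2 x4]
  let ?f1 = "\<lambda>\<omega> r. \<Sum>p\<in>UNIV. Yl \<omega> r $ i $ j * volvol k l p (Yl \<omega> r) * xx p (dL \<omega> r)"
  let ?f2 = "\<lambda>\<omega> r. \<Sum>p\<in>UNIV. Yl \<omega> r $ k $ l * volvol i j p (Yl \<omega> r) * xx p (dL \<omega> r)"
  let ?f3 = "\<lambda>\<omega> r. \<Sum>z\<in>UNIV. volvol i j (fst z) (Yl \<omega> r) * volvol k l (snd z) (Yl \<omega> r) * (xx (fst z) (dL \<omega> r) * xx (snd z) (dL \<omega> r))"
  let ?S1 = "\<lambda>\<omega>. LINT r:{0<..1}|count_space UNIV. ?f1 \<omega> r"
  let ?S2 = "\<lambda>\<omega>. LINT r:{0<..1}|count_space UNIV. ?f2 \<omega> r"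
  let ?S3 = "\<lambda>\<omega>. LINT r:{0<..1}|count_space UNIV. ?f3 \<omega> r"
  let ?\<tau> = "\<lambda>y. y $ i $ j * drift y $ k $ l + y $ k $ l * drift y $ i $ j"
  have g\<tau>: "growth 2 ?\<tau>" by (intro growth_add growth_mult2 growth_nth growth_drift)
  have T: "integrable M (time_int ?\<tau>)" using time_int_integrable[OF g\<tau> continuous_on_const, of 0] by auto
  have ae: "AE \<omega> in M. Y 1 \<omega> $ i $ j * Y 1 \<omega> $ k $ l - Y 0 \<omega> $ i $ j * Y 0 \<omega> $ k $ l =
      time_int ?\<tau> \<omega> + (?S1 \<omega> + ?S2 \<omega> + ?S3 \<omega>)"
    using Y_jump_path Y_paths J1(1) J2(1) J3(1)
  proof eventually_elim
    case (elim \<omega>)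
    have P: "jump_path (\<lambda>t. Y t \<omega> $ i $ j) (\<lambda>s. drift (Yl \<omega> s) $ i $ j) (\<lambda>r. amp \<omega> r $ i * amp \<omega> r $ j) 1"
      "jump_path (\<lambda>t. Y t \<omega> $ k $ l) (\<lambda>s. drift (Yl \<omega> s) $ k $ l) (\<lambda>r. amp \<omega> r $ k * amp \<omega> r $ l) 1"
      using elim(1) by blast+
    have l: "left_lim (\<lambda>t. Y t \<omega> $ a $ b) r = Yl \<omega> r $ a $ b" if "r \<in> {0<..1}" for a b r
      by (rule growth_left_lim(2)[OF growth_nth _ that]) (use elim(2) in blast)
    have "(LINT s:{0<..1}|lborel. left_lim (\<lambda>t. Y t \<omega> $ i $ j) s * drift (Yl \<omega> s) $ k $ l +
        left_lim (\<lambda>t. Y t \<omega> $ k $ l) s * drift (Yl \<omega> s) $ i $ j) = time_int ?\<tau> \<omega>"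
      unfolding time_int_def by (intro set_lebesgue_integral_cong) (auto simp: l)
    moreover have "(LINT s:{0<..1}|count_space UNIV. left_lim (\<lambda>t. Y t \<omega> $ i $ j) s * (amp \<omega> s $ k * amp \<omega> s $ l) +
        left_lim (\<lambda>t. Y t \<omega> $ k $ l) s * (amp \<omega> s $ i * amp \<omega> s $ j) +
        (amp \<omega> s $ i * amp \<omega> s $ j) * (amp \<omega> s $ k * amp \<omega> s $ l)) = ?S1 \<omega> + ?S2 \<omega> + ?S3 \<omega>"
    proof -
      have e: "left_lim (\<lambda>t. Y t \<omega> $ i $ j) s * (amp \<omega> s $ k * amp \<omega> s $ l) +
          left_lim (\<lambda>t. Y t \<omega> $ k $ l) s * (amp \<omega> s $ i * amp \<omega> s $ j) +
          (amp \<omega> s $ i * amp \<omega> s $ j) * (amp \<omega> s $ k * amp \<omega> s $ l) = ?f1 \<omega> s + ?f2 \<omega> s + ?f3 \<omega> s"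
        if "s \<in> {0<..1}" for s
      proof -
        have "(amp \<omega> s $ i * amp \<omega> s $ j) * (amp \<omega> s $ k * amp \<omega> s $ l) = ?f3 \<omega> s"
          unfolding amp_mult sum_product sum_UNIV_prod[where f = "\<lambda>z. g (fst z) (snd z)" for g]
          by (simp add: mult_ac sum_UNIV_prod)
        moreover have "left_lim (\<lambda>t. Y t \<omega> $ i $ j) s * (amp \<omega> s $ k * amp \<omega> s $ l) = ?f1 \<omega> s"
          "left_lim (\<lambda>t. Y t \<omega> $ k $ l) s * (amp \<omega> s $ i * amp \<omega> s $ j) = ?f2 \<omega> s"
          unfolding amp_mult sum_distrib_left l[OF that] by (simp_all only: mult.assoc)
        ultimately show ?thesis by simp
      qed
      have "(LINT s:{0<..1}|count_space UNIV. left_lim (\<lambda>t. Y t \<omega> $ i $ j) s * (amp \<omega> s $ k * amp \<omega> s $ l) +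
        left_lim (\<lambda>t. Y t \<omega> $ k $ l) s * (amp \<omega> s $ i * amp \<omega> s $ j) +
        (amp \<omega> s $ i * amp \<omega> s $ j) * (amp \<omega> s $ k * amp \<omega> s $ l)) =
        (LINT s:{0<..1}|count_space UNIV. ?f1 \<omega> s + ?f2 \<omega> s + ?f3 \<omega> s)"
        using e by (intro set_lebesgue_integral_cong) auto
      also have "\<dots> = ?S1 \<omega> + ?S2 \<omega> + ?S3 \<omega>"
        using elim(3,4,5) by (simp only: set_integral_add)
      finally show ?thesis .
    qed
    ultimately show ?case using product_formula[OF P] by simp
  qed
  have Yi: "integrable M (\<lambda>\<omega>. Y t \<omega> $ i $ j * Y t \<omega> $ k $ l)" if "t \<ge> 0" for t
    by (rule growth_integrable[OF growth_nth_mult that])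
  have "(LINT \<omega>|M. Y 1 \<omega> $ i $ j * Y 1 \<omega> $ k $ l - Y 0 \<omega> $ i $ j * Y 0 \<omega> $ k $ l) =
      (LINT \<omega>|M. time_int ?\<tau> \<omega> + (?S1 \<omega> + ?S2 \<omega> + ?S3 \<omega>))"
    using ae
  proof (intro integral_cong_AE)
    show "(\<lambda>\<omega>. Y 1 \<omega> $ i $ j * Y 1 \<omega> $ k $ l - Y 0 \<omega> $ i $ j * Y 0 \<omega> $ k $ l) \<in> borel_measurable M"
      by (intro borel_measurable_integrable Bochner_Integration.integrable_diff Yi) auto
    show "(\<lambda>\<omega>. time_int ?\<tau> \<omega> + (?S1 \<omega> + ?S2 \<omega> + ?S3 \<omega>)) \<in> borel_measurable M"
      by (intro borel_measurable_integrable Bochner_Integration.integrable_add T J1(2) J2(2) J3(2))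
  qed
  moreover have "(LINT \<omega>|M. Y 1 \<omega> $ i $ j * Y 1 \<omega> $ k $ l - Y 0 \<omega> $ i $ j * Y 0 \<omega> $ k $ l) = 0"
    by (subst Bochner_Integration.integral_diff) (auto intro!: Yi simp: Y_nth_mult_mean[of 1])
  moreover have "(LINT \<omega>|M. time_int ?\<tau> \<omega> + (?S1 \<omega> + ?S2 \<omega> + ?S3 \<omega>)) =
      mean_int ?\<tau> + ((LINT \<omega>|M. ?S1 \<omega>) + (LINT \<omega>|M. ?S2 \<omega>) + (LINT \<omega>|M. ?S3 \<omega>))"
    unfolding mean_int_def
    by (simp only: Bochner_Integration.integral_add Bochner_Integration.integrable_add T J1(2) J2(2) J3(2))
  ultimately have zero: "mean_int ?\<tau> + ((LINT \<omega>|M. ?S1 \<omega>) + (LINT \<omega>|M. ?S2 \<omega>) + (LINT \<omega>|M. ?S3 \<omega>)) = 0"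
    by simp
  have s1: "(LINT \<omega>|M. ?S1 \<omega>) = mean_int (\<lambda>y. \<Sum>u\<in>{()}. \<sigma> * (y $ i $ j * cov_jump y $ k $ l))"
    unfolding J1(3) mean_int_volvol[OF growth_nth]
    by (subst mean_int_sum) (auto intro!: growth_mult2 growth_nth growth_cov_jump)
  have s2: "(LINT \<omega>|M. ?S2 \<omega>) = mean_int (\<lambda>y. \<Sum>u\<in>{()}. \<sigma> * (y $ k $ l * cov_jump y $ i $ j))"
    unfolding J2(3) mean_int_volvol[OF growth_nth]
    by (subst mean_int_sum) (auto intro!: growth_mult2 growth_nth growth_cov_jump)
  let ?\<gamma> = "\<lambda>y. \<rho> * (cov_jump y $ i $ j * cov_jump y $ k $ l + cov_jump y $ i $ k * cov_jump y $ j $ l + cov_jump y $ i $ l * cov_jump y $ j $ k)"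
  have g\<gamma>: "growth 2 ?\<gamma>" by (intro growth_add growth_cmult growth_mult2 growth_cov_jump)
  have "(LINT \<omega>|M. ?S3 \<omega>) = mean_int (\<lambda>y. \<Sum>z\<in>UNIV. (LINT x|\<nu>. xx (fst z) x * xx (snd z) x) * (volvol i j (fst z) y * volvol k l (snd z) y))"
    unfolding J3(3) by (rule mean_int_sum[symmetric]) (auto intro: g2)
  also have "\<dots> = mean_int ?\<gamma>"
  proof (rule mean_int_cong)
    fix y :: "real^'d^'d" assume y: "psd y"
    show "(\<Sum>z\<in>UNIV. (LINT x|\<nu>. xx (fst z) x * xx (snd z) x) * (volvol i j (fst z) y * volvol k l (snd z) y)) = ?\<gamma> y"
      using fourth_volvol_sum[OF y, of i j k l]
      by (subst sum_UNIV_prod[where f = "\<lambda>z. (LINT x|\<nu>. xx (fst z) x * xx (snd z) x) * (volvol i j (fst z) y * volvol k l (snd z) y)"]) simp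
  qed (intro growth_sum growth_cmult g2 finite g\<gamma>)+
  finally have s3: "(LINT \<omega>|M. ?S3 \<omega>) = mean_int ?\<gamma>" .
  let ?a = "\<lambda>y. \<Sum>u\<in>{()}. \<sigma> * (y $ i $ j * cov_jump y $ k $ l)"
  let ?b = "\<lambda>y. \<Sum>u\<in>{()}. \<sigma> * (y $ k $ l * cov_jump y $ i $ j)"
  have gab: "growth 2 ?a" "growth 2 ?b"
    by (intro growth_sum growth_cmult growth_mult2 growth_nth growth_cov_jump finite)+
  have "mean_int (second_moment_rate i j k l) = mean_int (\<lambda>y. ?\<tau> y + ((?a y + ?b y) + ?\<gamma> y))"
    by (rule arg_cong[of _ _ mean_int]) (simp add: second_moment_rate_def fun_eq_iff algebra_simps)
  also have "\<dots> = mean_int ?\<tau> + (mean_int ?a + mean_int ?b + mean_int ?\<gamma>)"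
    by (subst mean_int_add[OF g\<tau> growth_add[OF growth_add[OF gab] g\<gamma>]],
        subst mean_int_add[OF growth_add[OF gab] g\<gamma>], subst mean_int_add[OF gab]) (rule refl)
  also have "\<dots> = 0" using zero unfolding s1 s2 s3 .
  finally show ?thesis .
qed

end

section \<open>The stationary variance\<close>

lemma stack_add: "stack (X + Z) = stack X + stack Z"
  and stack_scaleR: "stack (c *\<^sub>R X) = c *\<^sub>R stack X"
  and stack_diff: "stack (X - Z) = stack X - stack Z"
  by (simp_all add: stack_def vec_eq_iff)

lemma matrix_add_rdistrib:
  fixes P Q :: "real^'n^'m"
  shows "(P + Q) ** R = P ** R + Q ** R"
  by (simp add: matrix_matrix_mult_def vec_eq_iff distrib_right sum.distrib)

lemma symmetric_nth:
  assumes "transpose V = V"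
  shows "V $ a $ b = V $ b $ a"
proof -
  have "V $ a $ b = transpose V $ b $ a" by (simp add: transpose_def)
  then show ?thesis by (simp only: assms)
qed

lemma scr_A_mult_nth: "(scr_A A *v w) $ ((i, j), (k, l)) =
    (\<Sum>a\<in>UNIV. \<Sum>b\<in>UNIV. \<Sum>c\<in>UNIV. \<Sum>d\<in>UNIV. (A $ i $ a * A $ j $ b) * (A $ k $ c * A $ l $ d) * w $ ((a, b), (c, d)))"
  by (simp only: scr_A_def kron_def matrix_vector_mult_def vec_lambda_beta fst_conv snd_conv sum_UNIV_prod)

lemma congruence_nth:
  fixes A V :: "real^'n^'n"
  shows "(A ** V ** transpose A) $ i $ k = (\<Sum>a\<in>UNIV. \<Sum>c\<in>UNIV. A $ i $ a * V $ a $ c * A $ k $ c)"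
proof -
  have "(A ** V ** transpose A) $ i $ k = (\<Sum>c\<in>UNIV. \<Sum>a\<in>UNIV. A $ i $ a * V $ a $ c * A $ k $ c)"
    by (simp add: matrix_matrix_mult_def transpose_def sum_distrib_right)
  also have "\<dots> = (\<Sum>a\<in>UNIV. \<Sum>c\<in>UNIV. A $ i $ a * V $ a $ c * A $ k $ c)" by (rule sum.swap)
  finally show ?thesis .
qed

text \<open>As for Gaussian fourth moments, the three pairings of four indices appear; \<open>Q_matrix\<close> and
  \<open>K_matrix ** Q_matrix\<close> produce the two pairings across the factors.\<close>

lemma scr_A_cal_R_nth:
  fixes A V :: "real^'d^'d"
  assumes sym: "transpose V = V"
  defines "G \<equiv> A ** V ** transpose A"
  shows "((scr_A A ** cal_R \<rho>) *v (stack V \<otimes>\<^sub>v stack V)) $ ((i, j), (k, l)) =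
    \<rho> * (G $ i $ j * G $ k $ l + G $ i $ k * G $ j $ l + G $ i $ l * G $ j $ k)"
proof -
  let ?X = "outer (stack V) (stack V)"
  have V: "V $ a $ b = V $ b $ a" for a b by (rule symmetric_nth[OF sym])
  have "transpose G = G"
    using sym by (simp add: G_def matrix_transpose_mul matrix_mul_assoc)
  then have G: "G $ a $ b = G $ b $ a" for a b by (rule symmetric_nth)
  let ?t1 = "stack (Q_map ?X)" and ?t2 = "stack (commutation_matrix ** Q_map ?X)"
  have t1: "?t1 $ ((a, b), (c, d)) = V $ a $ c * V $ b $ d" for a b c d
    by (simp add: stack_nth Q_map_nth outer_nth)
  have t2: "?t2 $ ((a, b), (c, d)) = V $ a $ d * V $ b $ c" for a b c d
  proof -
    have "?t2 $ ((a, b), (c, d)) = (\<Sum>z\<in>UNIV. (if (c, d) = prod.swap z then 1 else 0) * Q_map ?X $ z $ (a, b))"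
      by (simp add: stack_nth matrix_matrix_mult_def commutation_matrix_nth)
    also have "\<dots> = (\<Sum>z\<in>UNIV. if z = (d, c) then Q_map ?X $ z $ (a, b) else 0)"
      by (intro sum.cong refl) auto
    also have "\<dots> = V $ a $ d * V $ b $ c"
      by (simp add: Q_map_nth outer_nth stack_nth)
    finally show ?thesis .
  qed
  have "cal_R \<rho> *v (stack V \<otimes>\<^sub>v stack V) = \<rho> *\<^sub>R (?t1 + ?t2 + stack V \<otimes>\<^sub>v stack V)"
    unfolding cal_R_def stack_outer[symmetric]
    by (simp add: scaleR_matrix_vector_assoc[symmetric] matrix_vector_mult_add_rdistrib
        Q_matrix_stack K_matrix_stack flip: matrix_vector_mul_assoc)
  then have "((scr_A A ** cal_R \<rho>) *v (stack V \<otimes>\<^sub>v stack V)) $ ((i, j), (k, l)) =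
      \<rho> * ((scr_A A *v ?t1) $ ((i, j), (k, l)) + (scr_A A *v ?t2) $ ((i, j), (k, l)) +
        (scr_A A *v (stack V \<otimes>\<^sub>v stack V)) $ ((i, j), (k, l)))"
    by (simp add: matrix_vector_mul_assoc[symmetric] matrix_vector_mult_scaleR matrix_vector_right_distrib)
  also have "(scr_A A *v ?t1) $ ((i, j), (k, l)) = G $ i $ k * G $ j $ l"
    unfolding scr_A_mult_nth t1 G_def congruence_nth sum_product
    by (intro sum.cong refl) (simp add: mult_ac)
  also have "(scr_A A *v ?t2) $ ((i, j), (k, l)) = G $ i $ l * G $ j $ k"
  proof -
    have "(scr_A A *v ?t2) $ ((i, j), (k, l)) =
        (\<Sum>a\<in>UNIV. \<Sum>b\<in>UNIV. \<Sum>d\<in>UNIV. \<Sum>c\<in>UNIV. (A $ i $ a * V $ a $ d * A $ l $ d) * (A $ j $ b * V $ b $ c * A $ k $ c))"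
      unfolding scr_A_mult_nth t2
      by (rule sum.cong[OF refl], rule sum.cong[OF refl], subst sum.swap) (simp add: mult_ac)
    then show ?thesis unfolding G_def congruence_nth sum_product .
  qed
  also have "(scr_A A *v (stack V \<otimes>\<^sub>v stack V)) $ ((i, j), (k, l)) = G $ i $ j * G $ k $ l"
  proof -
    have "scr_A A *v (stack V \<otimes>\<^sub>v stack V) = stack G \<otimes>\<^sub>v stack G"
      by (simp add: scr_A_def kron_mult_kron_vec kron_mult_stack G_def)
    then show ?thesis using G[of i j] G[of k l] by (simp add: kron_vec_def stack_nth)
  qed
  finally show ?thesis by (simp add: algebra_simps)
qed

lemma (in prob_space) var_vec_shift:
  fixes X :: "'a \<Rightarrow> real^'n"
  assumes X: "integrable M X" and XX: "integrable M (\<lambda>\<omega>. outer (X \<omega>) (X \<omega>))"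
  shows "var_vec M (\<lambda>\<omega>. c + X \<omega>) = var_vec M X"
proof -
  have Xi: "integrable M (\<lambda>\<omega>. X \<omega> $ i)" and Xi': "(LINT \<omega>|M. X \<omega>) $ i = (LINT \<omega>|M. X \<omega> $ i)" for i
    using integral_nth[OF X] by auto
  have XXi: "integrable M (\<lambda>\<omega>. X \<omega> $ i * X \<omega> $ j)"
    and XXi': "(LINT \<omega>|M. outer (X \<omega>) (X \<omega>)) $ i $ j = (LINT \<omega>|M. X \<omega> $ i * X \<omega> $ j)" for i j
    using integral_nth[OF XX, of i] integral_nth[OF integral_nth(2)[OF XX, of i], of j]
    by (simp_all add: outer_nth)
  have Z: "integrable M (\<lambda>\<omega>. outer (c + X \<omega>) (c + X \<omega>))"
    by (intro integrable_vecI)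
      (simp add: outer_nth distrib_left distrib_right Xi XXi)
  have Zi: "(LINT \<omega>|M. outer (c + X \<omega>) (c + X \<omega>)) $ i $ j = (LINT \<omega>|M. (c $ i + X \<omega> $ i) * (c $ j + X \<omega> $ j))" for i j
    using integral_nth[OF Z, of i] integral_nth[OF integral_nth(2)[OF Z, of i], of j]
    by (simp add: outer_nth)
  have m: "(LINT \<omega>|M. c + X \<omega>) = c + (LINT \<omega>|M. X \<omega>)" using X by (simp add: prob_space)
  show ?thesis
    unfolding var_vec_def m vec_eq_iff
    by (simp add: Zi XXi' outer_nth Xi' distrib_left distrib_right Xi XXi prob_space)
qed

context mucogarch_setting
begin

section \<open>Matrix form of the moment equations\<close>

lemma psd_Y_mean0: "psd Y_mean0"
  unfolding psd_def
proof (intro conjI allI)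
  note i = Y_integrable[of 0, simplified]
  have p: "AE \<omega> in M. psd (Y 0 \<omega>)" using Y_paths by eventually_elim auto
  have n: "Y_mean0 $ a $ b = (LINT \<omega>|M. Y 0 \<omega> $ a $ b)" for a b
    unfolding Y_mean0_def using integral_nth(1)[OF i, of a] integral_nth(1)[OF integral_nth(2)[OF i, of a], of b] by simp
  have m: "(\<lambda>\<omega>. Y 0 \<omega> $ a $ b) \<in> borel_measurable M" for a b
    by (intro borel_measurable_integrable integral_nth(2) i)
  have "Y_mean0 $ a $ b = Y_mean0 $ b $ a" for a b
    unfolding n
  proof (rule integral_cong_AE[OF m m], use p in eventually_elim)
    fix \<omega> assume "psd (Y 0 \<omega>)"
    then show "Y 0 \<omega> $ a $ b = Y 0 \<omega> $ b $ a" by (intro symmetric_nth) (simp add: psd_def)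
  qed
  then show "transpose Y_mean0 = Y_mean0" by (simp add: transpose_def vec_eq_iff)
  fix x :: "real^'d"
  have "linear (\<lambda>X :: real^'d^'d. x \<bullet> (X *v x))"
    by (rule linearI) (simp_all add: matrix_vector_mult_add_rdistrib inner_add_right scaleR_matrix_vector_assoc[symmetric])
  then have bl: "bounded_linear (\<lambda>X :: real^'d^'d. x \<bullet> (X *v x))" by (simp add: linear_conv_bounded_linear)
  have "x \<bullet> (Y_mean0 *v x) = (LINT \<omega>|M. x \<bullet> (Y 0 \<omega> *v x))"
    unfolding Y_mean0_def by (rule integral_bounded_linear[OF bl i, symmetric])
  also have "\<dots> \<ge> 0" by (rule integral_nonneg_AE, use p in eventually_elim) (simp add: psd_def)
  finally show "0 \<le> x \<bullet> (Y_mean0 *v x)" .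
qed

lemma scr_B_stack: "scr_B A B \<sigma> *v stack y = stack (drift y + \<sigma> *\<^sub>R (A ** y ** transpose A))"
  by (simp add: scr_B_def matrix_vector_mult_add_rdistrib scaleR_matrix_vector_assoc[symmetric]
      kron_mult_stack drift_def stack_add stack_scaleR add_ac)

lemma cov_jump_stack: "stack (cov_jump y) = (A \<otimes>\<^sub>m A) *v stack C + (A \<otimes>\<^sub>m A) *v stack y"
  by (simp add: kron_mult_stack cov_jump_def matrix_add_ldistrib matrix_add_rdistrib stack_add)

text \<open>\<open>second_moment_rate\<close> in matrix form with V = C + y multiplied out, so that
  each summand is constant, linear or quadratic in \<open>y\<close> and expectations can be taken
  termwise.\<close>

definition rate :: "real^'d^'d \<Rightarrow> real^(('d \<times> 'd) \<times> ('d \<times> 'd))"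
  where "rate y = scr_C A B \<sigma> \<rho> *v (stack y \<otimes>\<^sub>v stack y) + ((scr_A A ** cal_R \<rho>) *v (stack C \<otimes>\<^sub>v stack C) +
    (\<sigma> *\<^sub>R ((A \<otimes>\<^sub>m A) \<otimes>\<^sub>m mat 1) + scr_A A ** cal_R \<rho>) *v (stack C \<otimes>\<^sub>v stack y) +
    (\<sigma> *\<^sub>R (mat 1 \<otimes>\<^sub>m (A \<otimes>\<^sub>m A)) + scr_A A ** cal_R \<rho>) *v (stack y \<otimes>\<^sub>v stack C))"

text \<open>The terms with \<open>scr_B\<close> and \<sigma> reassemble into Leibniz terms with
  \<open>?d\<close>, the four terms with \<open>?R\<close> into its value at the tensor square of
  the stacked C + y. Stacking lists columns first and so swaps the indices within each pair;
  symmetry of \<open>y\<close>, of \<open>?d\<close> and of C + y undoes this.\<close>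

lemma rate_nth:
  assumes y: "psd y"
  shows "rate y $ ((i, j), (k, l)) = second_moment_rate i j k l y"
proof -
  let ?R = "scr_A A ** cal_R \<rho>"
  let ?d = "drift y + \<sigma> *\<^sub>R cov_jump y"
  have tr: "transpose y = y" "transpose (C + y) = C + y"
    using y psd_C_add[OF y] by (auto simp: psd_def)
  have ty: "y $ a $ b = y $ b $ a" for a b by (rule symmetric_nth[OF tr(1)])
  have tadd: "transpose (X + Z) = transpose X + transpose Z" for X Z :: "real^'d^'d"
    by (simp add: transpose_def vec_eq_iff)
  have "transpose ?d = ?d"
    using tr by (simp add: drift_def cov_jump_def tadd transpose_scalar matrix_transpose_mul matrix_mul_assoc)
  then have td: "?d $ a $ b = ?d $ b $ a" for a b by (rule symmetric_nth)
  have d: "stack ?d = scr_B A B \<sigma> *v stack y + \<sigma> *\<^sub>R ((A \<otimes>\<^sub>m A) *v stack C)"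
    unfolding scr_B_stack
    by (simp add: stack_add stack_scaleR cov_jump_stack kron_mult_stack scaleR_add_right add_ac)
  have v: "stack (C + y) = stack C + stack y" by (rule stack_add)
  have "rate y = stack ?d \<otimes>\<^sub>v stack y + stack y \<otimes>\<^sub>v stack ?d + ?R *v (stack (C + y) \<otimes>\<^sub>v stack (C + y))"
  proof -
    define b where "b = scr_B A B \<sigma> *v stack y"
    define a where "a = \<sigma> *\<^sub>R ((A \<otimes>\<^sub>m A) *v stack C)"
    define s c where "s = stack y" and "c = stack C"
    have "scr_C A B \<sigma> \<rho> *v (s \<otimes>\<^sub>v s) = b \<otimes>\<^sub>v s + s \<otimes>\<^sub>v b + ?R *v (s \<otimes>\<^sub>v s)"
      by (simp only: scr_C_alt matrix_vector_mult_add_rdistrib kron_mult_kron_vec matrix_vector_mul_lid b_def s_def)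
    moreover have "(\<sigma> *\<^sub>R ((A \<otimes>\<^sub>m A) \<otimes>\<^sub>m mat 1) + ?R) *v (c \<otimes>\<^sub>v s) = a \<otimes>\<^sub>v s + ?R *v (c \<otimes>\<^sub>v s)"
      by (simp only: matrix_vector_mult_add_rdistrib scaleR_matrix_vector_assoc[symmetric] kron_mult_kron_vec
          matrix_vector_mul_lid kron_vec_scaleR_left a_def c_def)
    moreover have "(\<sigma> *\<^sub>R (mat 1 \<otimes>\<^sub>m (A \<otimes>\<^sub>m A)) + ?R) *v (s \<otimes>\<^sub>v c) = s \<otimes>\<^sub>v a + ?R *v (s \<otimes>\<^sub>v c)"
      by (simp only: matrix_vector_mult_add_rdistrib scaleR_matrix_vector_assoc[symmetric] kron_mult_kron_vec
          matrix_vector_mul_lid kron_vec_scaleR_right a_def c_def)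
    moreover have "stack ?d = b + a" unfolding d b_def a_def ..
    ultimately show ?thesis
      unfolding rate_def v s_def[symmetric] c_def[symmetric]
      by (simp only: kron_vec_add_left kron_vec_add_right matrix_vector_right_distrib add_ac)
  qed
  then have "rate y $ ((i, j), (k, l)) = ?d $ j $ i * y $ l $ k + y $ j $ i * ?d $ l $ k +
      (?R *v (stack (C + y) \<otimes>\<^sub>v stack (C + y))) $ ((i, j), (k, l))"
    by (simp add: kron_vec_def stack_nth)
  also have "\<dots> = second_moment_rate i j k l y"
    unfolding scr_A_cal_R_nth[OF tr(2)] td[of j i] td[of l k] ty[of j i] ty[of l k]
    by (simp add: second_moment_rate_def cov_jump_def algebra_simps)
  finally show ?thesis .
qed

lemma bounded_linear_euclideanI:
  fixes f :: "'b::euclidean_space \<Rightarrow> 'c::euclidean_space"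
  assumes "\<And>x y. f (x + y) = f x + f y" "\<And>c x. f (c *\<^sub>R x) = c *\<^sub>R f x"
  shows "bounded_linear f"
  using linearI[of f] assms by (simp add: linear_conv_bounded_linear)

text \<open>\<open>rate\<close> is affine in \<open>Y\<close> and its outer square, whose
  expectations are constant in time. Hence the expectation of \<open>rate\<close> at every time is
  \<open>?E\<close>, and so is its average over [0, 1], which vanishes.\<close>

lemma second_moment_equation:
  defines "m \<equiv> (LINT \<omega>|M. stack (Y 0 \<omega>))"
  shows "scr_C A B \<sigma> \<rho> *v stack (LINT \<omega>|M. outer (stack (Y 0 \<omega>)) (stack (Y 0 \<omega>))) +
    ((scr_A A ** cal_R \<rho>) *v (stack C \<otimes>\<^sub>v stack C) +
    (\<sigma> *\<^sub>R ((A \<otimes>\<^sub>m A) \<otimes>\<^sub>m mat 1) + scr_A A ** cal_R \<rho>) *v (stack C \<otimes>\<^sub>v m) +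
    (\<sigma> *\<^sub>R (mat 1 \<otimes>\<^sub>m (A \<otimes>\<^sub>m A)) + scr_A A ** cal_R \<rho>) *v (m \<otimes>\<^sub>v stack C)) = 0"
    (is "?E = 0")
proof -
  let ?P = "scr_C A B \<sigma> \<rho>" and ?K = "(scr_A A ** cal_R \<rho>) *v (stack C \<otimes>\<^sub>v stack C)"
  let ?N2 = "\<sigma> *\<^sub>R ((A \<otimes>\<^sub>m A) \<otimes>\<^sub>m mat 1) + scr_A A ** cal_R \<rho>"
  let ?N3 = "\<sigma> *\<^sub>R (mat 1 \<otimes>\<^sub>m (A \<otimes>\<^sub>m A)) + scr_A A ** cal_R \<rho>"
  have bl: "bounded_linear (\<lambda>X. ?P *v stack X)" "bounded_linear (\<lambda>x. ?N2 *v (stack C \<otimes>\<^sub>v x))"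
    "bounded_linear (\<lambda>x. ?N3 *v (x \<otimes>\<^sub>v stack C))"
    by (auto intro!: bounded_linear_euclideanI simp: stack_add stack_scaleR kron_vec_add_left kron_vec_add_right
        kron_vec_scaleR_left kron_vec_scaleR_right matrix_vector_right_distrib matrix_vector_mult_scaleR)
  have rate: "integrable M (\<lambda>\<omega>. rate (Y t \<omega>))" "(LINT \<omega>|M. rate (Y t \<omega>)) = ?E" if t: "t \<ge> 0" for t
  proof -
    have eq: "rate (Y t \<omega>) = ?P *v stack (outer (stack (Y t \<omega>)) (stack (Y t \<omega>))) + (?K +
        ?N2 *v (stack C \<otimes>\<^sub>v stack (Y t \<omega>)) + ?N3 *v (stack (Y t \<omega>) \<otimes>\<^sub>v stack C))" for \<omega>
      by (simp add: rate_def stack_outer)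
    note i = integrable_bounded_linear[OF bl(1) outer_integrable[OF t]]
      integrable_bounded_linear[OF bl(2) stack_integrable[OF t]]
      integrable_bounded_linear[OF bl(3) stack_integrable[OF t]]
    have k: "integrable M (\<lambda>_. ?K)" by simp
    show "integrable M (\<lambda>\<omega>. rate (Y t \<omega>))"
      unfolding eq by (intro Bochner_Integration.integrable_add i k)
    have m: "(LINT \<omega>|M. stack (Y t \<omega>)) = m" unfolding m_def stack_mean[OF t] using stack_mean[of 0] by simp
    have "(LINT \<omega>|M. rate (Y t \<omega>)) = ?P *v stack (LINT \<omega>|M. outer (stack (Y t \<omega>)) (stack (Y t \<omega>))) +
        (?K + ?N2 *v (stack C \<otimes>\<^sub>v (LINT \<omega>|M. stack (Y t \<omega>))) + ?N3 *v ((LINT \<omega>|M. stack (Y t \<omega>)) \<otimes>\<^sub>v stack C))"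
      unfolding eq
      using i k integral_bounded_linear[OF bl(1) outer_integrable[OF t]]
        integral_bounded_linear[OF bl(2) stack_integrable[OF t]]
        integral_bounded_linear[OF bl(3) stack_integrable[OF t]]
      by (simp only: Bochner_Integration.integral_add Bochner_Integration.integrable_add lebesgue_integral_const
          prob_space scaleR_one)
    then show "(LINT \<omega>|M. rate (Y t \<omega>)) = ?E" unfolding m outer_mean[OF t] .
  qed
  have "?E $ ((i, j), (k, l)) = 0" for i j k l
  proof -
    have g: "growth 2 (second_moment_rate i j k l)" by (rule growth_second_moment_rate)
    have "mean_int (second_moment_rate i j k l) = ?E $ ((i, j), (k, l))"
    proof (rule mean_int_eq[OF g continuous_on_const, of 0])
      fix r :: real assume r: "0 \<le> r"
      have "(LINT \<omega>|M. second_moment_rate i j k l (Y r \<omega>)) = (LINT \<omega>|M. rate (Y r \<omega>) $ ((i, j), (k, l)))"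
      proof (rule integral_cong_AE)
        show "AE \<omega> in M. second_moment_rate i j k l (Y r \<omega>) = rate (Y r \<omega>) $ ((i, j), (k, l))"
          using Y_paths by eventually_elim (use r rate_nth in auto)
      qed (intro borel_measurable_integrable growth_integrable[OF g r] integral_nth(2) rate(1) r)+
      also have "\<dots> = ?E $ ((i, j), (k, l))"
        using integral_nth(1)[OF rate(1)[OF r]] rate(2)[OF r] by simp
      finally show "(LINT \<omega>|M. second_moment_rate i j k l (Y r \<omega>)) = ?E $ ((i, j), (k, l))" .
    qed auto
    then show ?thesis by (simp only: second_moment_mean_int)
  qed
  then show ?thesis by (simp add: vec_eq_iff)
qed

lemma stationary_variance:
  assumes inv: "invertible (scr_C A B \<sigma> \<rho>)" and \<sigma>: "0 \<le> \<sigma>"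
  shows "stack (var_vec M (\<lambda>\<omega>. stack (Y 0 \<omega>))) =
      - (matrix_inv (scr_C A B \<sigma> \<rho>) *v
          ((\<sigma>\<^sup>2 *\<^sub>R (scr_C A B \<sigma> \<rho> **
                (matrix_inv (scr_B A B \<sigma>) \<otimes>\<^sub>m matrix_inv (scr_B A B \<sigma>)) ** scr_A A)
              + scr_A A ** cal_R \<rho>) *v (stack C \<otimes>\<^sub>v stack C)
           + (\<sigma> *\<^sub>R ((A \<otimes>\<^sub>m A) \<otimes>\<^sub>m mat 1) + scr_A A ** cal_R \<rho>)
                *v (stack C \<otimes>\<^sub>v (LINT \<omega>|M. stack (Y 0 \<omega>)))
           + (\<sigma> *\<^sub>R (mat 1 \<otimes>\<^sub>m (A \<otimes>\<^sub>m A)) + scr_A A ** cal_R \<rho>)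
                *v ((LINT \<omega>|M. stack (Y 0 \<omega>)) \<otimes>\<^sub>v stack C)))"
proof -
  let ?P = "scr_C A B \<sigma> \<rho>" and ?B = "scr_B A B \<sigma>" and ?A = "A \<otimes>\<^sub>m A"
  define m where "m = (LINT \<omega>|M. stack (Y 0 \<omega>))"
  define S where "S = stack (LINT \<omega>|M. outer (stack (Y 0 \<omega>)) (stack (Y 0 \<omega>)))"
  have m: "m = stack Y_mean0" unfolding m_def Y_mean0_def by (rule stack_mean) simp
  have eq: "B ** Y_mean0 + Y_mean0 ** transpose B + \<sigma> *\<^sub>R (A ** (C + Y_mean0) ** transpose A) = 0"
    using first_moment_equation by (simp add: drift_def cov_jump_def)
  have invB: "invertible ?B"
    by (rule scr_B_invertible[OF pos_def psd_Y_mean0 \<sigma> sigma_zero_imp_rho_zero eq inv])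
  have "?B *v m = - (\<sigma> *\<^sub>R (?A *v stack C))"
  proof -
    have "?B *v m + \<sigma> *\<^sub>R (?A *v stack C) = stack (drift Y_mean0 + \<sigma> *\<^sub>R cov_jump Y_mean0)"
      unfolding m scr_B_stack
      by (simp add: stack_add stack_scaleR cov_jump_stack kron_mult_stack scaleR_add_right add_ac)
    also have "\<dots> = 0" unfolding first_moment_equation by (simp add: stack_def vec_eq_iff)
    finally show ?thesis by (simp add: add_eq_0_iff2)
  qed
  then have "matrix_inv ?B *v (?B *v m) = - (\<sigma> *\<^sub>R (matrix_inv ?B *v (?A *v stack C)))"
    by (simp add: matrix_vector_mult_scaleR flip: scaleR_minus_left)
  then have m_eq: "m = - (\<sigma> *\<^sub>R (matrix_inv ?B *v (?A *v stack C)))"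
    by (simp add: matrix_vector_mul_assoc matrix_inv_mult'[OF invB])
  \<comment> \<open>The first summand of the claimed formula is \<open>scr_C\<close> applied to the
    tensor square of the mean, that is, the correction from the second moment to the
    variance.\<close>
  have "(\<sigma>\<^sup>2 *\<^sub>R (?P ** (matrix_inv ?B \<otimes>\<^sub>m matrix_inv ?B) ** scr_A A)) *v (stack C \<otimes>\<^sub>v stack C) = ?P *v (m \<otimes>\<^sub>v m)"
  proof -
    have "m \<otimes>\<^sub>v m = \<sigma>\<^sup>2 *\<^sub>R ((matrix_inv ?B *v (?A *v stack C)) \<otimes>\<^sub>v (matrix_inv ?B *v (?A *v stack C)))"
      unfolding m_eq scaleR_minus_left[symmetric]
      by (simp add: kron_vec_scaleR_left kron_vec_scaleR_right power2_eq_square del: scaleR_minus_left)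
    then show ?thesis
      by (simp add: scaleR_matrix_vector_assoc[symmetric] matrix_vector_mult_scaleR scr_A_def kron_mult_kron_vec
          flip: matrix_vector_mul_assoc)
  qed
  moreover have "?P *v S + ((scr_A A ** cal_R \<rho>) *v (stack C \<otimes>\<^sub>v stack C) +
    (\<sigma> *\<^sub>R (?A \<otimes>\<^sub>m mat 1) + scr_A A ** cal_R \<rho>) *v (stack C \<otimes>\<^sub>v m) +
    (\<sigma> *\<^sub>R (mat 1 \<otimes>\<^sub>m ?A) + scr_A A ** cal_R \<rho>) *v (m \<otimes>\<^sub>v stack C)) = 0"
    unfolding S_def m_def by (rule second_moment_equation)
  ultimately have "(\<sigma>\<^sup>2 *\<^sub>R (?P ** (matrix_inv ?B \<otimes>\<^sub>m matrix_inv ?B) ** scr_A A) + scr_A A ** cal_R \<rho>) *v (stack C \<otimes>\<^sub>v stack C) +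
      (\<sigma> *\<^sub>R (?A \<otimes>\<^sub>m mat 1) + scr_A A ** cal_R \<rho>) *v (stack C \<otimes>\<^sub>v m) +
      (\<sigma> *\<^sub>R (mat 1 \<otimes>\<^sub>m ?A) + scr_A A ** cal_R \<rho>) *v (m \<otimes>\<^sub>v stack C) = - (?P *v (S - m \<otimes>\<^sub>v m))"
    unfolding matrix_vector_mult_add_rdistrib[of "\<sigma>\<^sup>2 *\<^sub>R (?P ** (matrix_inv ?B \<otimes>\<^sub>m matrix_inv ?B) ** scr_A A)"]
      matrix_vector_mult_diff_distrib
    by (simp add: algebra_simps add_eq_0_iff2)
  moreover have "S - m \<otimes>\<^sub>v m = stack (var_vec M (\<lambda>\<omega>. stack (Y 0 \<omega>)))"
    by (simp add: var_vec_def S_def stack_diff stack_outer m_def)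
  moreover have "- (matrix_inv ?P *v (- (?P *v x))) = x" for x
  proof -
    have "matrix_inv ?P *v (- (?P *v x)) = - (matrix_inv ?P *v (?P *v x))"
      using matrix_vector_mult_diff_distrib[of "matrix_inv ?P" 0 "?P *v x"] by simp
    then show ?thesis by (simp add: matrix_vector_mul_assoc matrix_inv_mult'[OF inv])
  qed
  ultimately show ?thesis unfolding m_def[symmetric] by simp
qed

end

theorem corollary4p19:
  fixes M :: "'a measure" and F :: "real \<Rightarrow> 'a measure"
    and L :: "real \<Rightarrow> 'a \<Rightarrow> real^'d"
    and \<nu> :: "(real^'d) measure"
    and Y V :: "real \<Rightarrow> 'a \<Rightarrow> real^'d^'d"
    and A B C :: "real^'d^'d"
    and \<sigma> \<rho> :: real
  assumes "usual_conditions M F"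
    and "levy_process M F L"
    and "is_levy_measure M L \<nu>"
    and "pos_def C"
    and "mucogarch_volatility M F L A B C Y"
    and "second_order_stationary M Y"
    and "\<And>t \<omega>. V t \<omega> = C + Y t \<omega>"
    and "0 \<le> \<sigma>"
    and "has_bochner_integral \<nu> (\<lambda>x. outer x x) (\<sigma> *\<^sub>R mat 1)"
    and "integrable \<nu> (\<lambda>x. norm x ^ 4)"
    and "has_bochner_integral \<nu> (\<lambda>x. outer (stack (outer x x)) (stack (outer x x)))
           (\<rho> *\<^sub>R (mat 1 + commutation_matrix + outer (stack (mat 1)) (stack (mat 1))))"
    and "invertible (scr_C A B \<sigma> \<rho>)"
  shows "var_vec M (\<lambda>\<omega>. stack (Y 0 \<omega>)) = var_vec M (\<lambda>\<omega>. stack (V 0 \<omega>)) \<and>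
    stack (var_vec M (\<lambda>\<omega>. stack (Y 0 \<omega>))) =
      - (matrix_inv (scr_C A B \<sigma> \<rho>) *v
          ((\<sigma>\<^sup>2 *\<^sub>R (scr_C A B \<sigma> \<rho> **
                (matrix_inv (scr_B A B \<sigma>) \<otimes>\<^sub>m matrix_inv (scr_B A B \<sigma>)) ** scr_A A)
              + scr_A A ** cal_R \<rho>) *v (stack C \<otimes>\<^sub>v stack C)
           + (\<sigma> *\<^sub>R ((A \<otimes>\<^sub>m A) \<otimes>\<^sub>m mat 1) + scr_A A ** cal_R \<rho>)
                *v (stack C \<otimes>\<^sub>v (LINT \<omega>|M. stack (Y 0 \<omega>)))
           + (\<sigma> *\<^sub>R (mat 1 \<otimes>\<^sub>m (A \<otimes>\<^sub>m A)) + scr_A A ** cal_R \<rho>)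
                *v ((LINT \<omega>|M. stack (Y 0 \<omega>)) \<otimes>\<^sub>v stack C)))"
proof -
  interpret mucogarch_setting M F L \<nu> Y A B C \<sigma> \<rho>
    by (unfold_locales) (rule assms)+
  have "var_vec M (\<lambda>\<omega>. stack (V 0 \<omega>)) = var_vec M (\<lambda>\<omega>. stack C + stack (Y 0 \<omega>))"
    by (simp add: assms(7) stack_add)
  also have "\<dots> = var_vec M (\<lambda>\<omega>. stack (Y 0 \<omega>))"
    by (intro var_vec_shift stack_integrable outer_integrable) auto
  finally show ?thesis using stationary_variance[OF assms(12) assms(8)] by simp
qed

end
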